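(* Let $G$ be a compact abelian Hausdorff group and $A$ an invariant algebra on $G$. Then the restriction of functionals to $\mathrm{Sp}\,A\subset A$ defines an isomorphism $\rho:\mathcal{M}_A\to\mathrm{Hom}(\mathrm{Sp}\,A,\overline{\mathbb{D}})$ of topological semigroups. For any $\varphi\in\mathcal{M}_A$ and $\chi\in \mathrm{Sp}\,A$, $$\rho(\varphi^* )(\chi)=\overline{\varphi(\chi)},$$ where the bar denotes complex conjugation.
   Context: $C(G)$ is the Banach algebra of continuous complex functions on $G$ with the sup-norm. An invariant algebra on $G$ is a closed subalgebra $A\subseteq C(G)$ that contains the constants and is invariant under all translations. $\mathcal{M}_A$ is the set of all nonzero multiplicative linear functionals on $A$ with the weak-* topology. It is a semigroup under convolution: $(\varphi*\psi)(f)=\int_{G\times G}f(gh)\,d\mu(g)\,d\nu(h)$ for any finite regular Borel complex measures $\mu,\nu$ on $G$ extending $\varphi,\psi$ from $A$ to $C(G)$ (independent of the choice). Involution: $\varphi^*(f)=\overline{\varphi(f^\star)}$ where $f^\star(g)=\overline{f(g^{-1})}$ (one has $A^\star=A$). $\widehat{G}$ is the group of continuous characters $G\to\mathbb{T}$, regarded as a subset of $C(G)$; $\mathrm{Sp}\,A=A\cap\widehat{G}$, which is a subsemigroup of $\widehat G$ containing the identity. $\overline{\mathbb{D}}$ is the closed unit disc in $\mathbb{C}$ regarded as a multiplicative semigroup. $\mathrm{Hom}(\mathrm{Sp}\,A,\overline{\mathbb{D}})$ is the set of all nonzero semigroup homomorphisms $\mathrm{Sp}\,A\to\overline{\mathbb{D}}$,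 with pointwise multiplication and the topology of pointwise convergence. *)

theory Defs
  imports "HOL-Analysis.Analysis"
begin

text \<open>
  A compact abelian Hausdorff group is written additively: a type of sort
  \<open>{topological_ab_group_add, t2_space}\<close> whose universe is compact.
\<close>

section \<open>Invariant algebras\<close>

text \<open>
  Algebras of functions are sets of plain functions, so that the operations are pointwise.
  The sup-norm topology is that of the type of bounded continuous functions; on a compact
  group every continuous function is bounded, so nothing of \<open>A\<close> is lost in the preimage below.
\<close>

definition invariant_algebra ::
    "('a::topological_ab_group_add \<Rightarrow> complex) set \<Rightarrow> bool" where
  "invariant_algebra A \<longleftrightarrow>
     A \<subseteq> {f. continuous_on UNIV f} \<and>
     (\<forall>c. (\<lambda>x. c) \<in> A) \<and>
     (\<forall>f\<in>A. \<forall>g\<in>A. (\<lambda>x. f x + g x) \<in> A) \<and>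
     (\<forall>f\<in>A. \<forall>g\<in>A. (\<lambda>x. f x * g x) \<in> A) \<and>
     (\<forall>c. \<forall>f\<in>A. (\<lambda>x. c * f x) \<in> A) \<and>
     closed (apply_bcontfun -` A :: ('a \<Rightarrow>\<^sub>C complex) set) \<and>
     (\<forall>f\<in>A. \<forall>a. (\<lambda>x. f (x + a)) \<in> A)"

definition characters :: "('a::topological_ab_group_add \<Rightarrow> complex) set" where
  "characters =
     {\<gamma>. continuous_on UNIV \<gamma> \<and> (\<forall>x. cmod (\<gamma> x) = 1) \<and> (\<forall>x y. \<gamma> (x + y) = \<gamma> x * \<gamma> y)}"

definition Sp :: "('a::topological_ab_group_add \<Rightarrow> complex) set \<Rightarrow> ('a \<Rightarrow> complex) set" where
  "Sp A = A \<inter> characters"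


section \<open>Multiplicative functionals\<close>

text \<open>Functionals on \<open>A\<close> are extensional functions, i.e. \<open>undefined\<close> outside \<open>A\<close>.\<close>

definition mult_functionals ::
    "('a \<Rightarrow> complex) set \<Rightarrow> (('a \<Rightarrow> complex) \<Rightarrow> complex) set" where
  "mult_functionals A =
     {\<phi> \<in> extensional A.
        (\<forall>f\<in>A. \<forall>g\<in>A. \<phi> (\<lambda>x. f x + g x) = \<phi> f + \<phi> g) \<and>
        (\<forall>c. \<forall>f\<in>A. \<phi> (\<lambda>x. c * f x) = c * \<phi> f) \<and>
        (\<forall>f\<in>A. \<forall>g\<in>A. \<phi> (\<lambda>x. f x * g x) = \<phi> f * \<phi> g) \<and>
        (\<exists>f\<in>A. \<phi> f \<noteq> 0)}"

text \<open>The weak-* topology is the topology of pointwise convergence on \<open>A\<close>.\<close>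

definition mult_functionals_topology ::
    "('a \<Rightarrow> complex) set \<Rightarrow> (('a \<Rightarrow> complex) \<Rightarrow> complex) topology" where
  "mult_functionals_topology A =
     subtopology (product_topology (\<lambda>_. euclidean) A) (mult_functionals A)"


section \<open>Complex Borel measures\<close>

definition complex_borel_measure :: "('a::topological_space set \<Rightarrow> complex) \<Rightarrow> bool" where
  "complex_borel_measure \<mu> \<longleftrightarrow>
     \<mu> {} = 0 \<and>
     (\<forall>E :: nat \<Rightarrow> 'a set. range E \<subseteq> sets borel \<longrightarrow> disjoint_family E \<longrightarrow>
        (\<lambda>n. \<mu> (E n)) sums \<mu> (\<Union>n. E n))"

definition total_variation :: "('a::topological_space set \<Rightarrow> complex) \<Rightarrow> 'a set \<Rightarrow> ennreal" where
  "total_variation \<mu> B =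
     (SUP E \<in> {E :: nat \<Rightarrow> 'a set. range E \<subseteq> sets borel \<and> disjoint_family E \<and> (\<Union>n. E n) = B}.
        \<Sum>n. ennreal (cmod (\<mu> (E n))))"

definition finite_regular_complex_measure ::
    "('a::topological_space set \<Rightarrow> complex) \<Rightarrow> bool" where
  "finite_regular_complex_measure \<mu> \<longleftrightarrow>
     complex_borel_measure \<mu> \<and>
     total_variation \<mu> UNIV < \<infinity> \<and>
     (\<forall>B\<in>sets borel.
        total_variation \<mu> B = (INF U\<in>{U. open U \<and> B \<subseteq> U}. total_variation \<mu> U) \<and>
        total_variation \<mu> B = (SUP K\<in>{K. compact K \<and> K \<subseteq> B}. total_variation \<mu> K))"

text \<open>
  The positive part of the Jordan decomposition of a real set function \<open>\<nu>\<close>: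
  \<open>\<nu>\<^sup>+ B\<close> is the supremum of \<open>\<nu> C\<close> over Borel sets \<open>C \<subseteq> B\<close>. Negative values are truncated
  by \<open>ennreal\<close>, which is harmless since \<open>C = {}\<close> contributes 0. The negative part is the
  positive part of \<open>- \<nu>\<close>.
\<close>

definition positive_variation :: "('a::topological_space set \<Rightarrow> real) \<Rightarrow> 'a measure" where
  "positive_variation \<nu> =
     measure_of UNIV (sets borel) (\<lambda>B. SUP C\<in>{C \<in> sets borel. C \<subseteq> B}. ennreal (\<nu> C))"

definition complex_measure_integral ::
    "('a::topological_space set \<Rightarrow> complex) \<Rightarrow> ('a \<Rightarrow> complex) \<Rightarrow> complex" where
  "complex_measure_integral \<mu> f =
     integral\<^sup>L (positive_variation (\<lambda>B. Re (\<mu> B))) f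
     - integral\<^sup>L (positive_variation (\<lambda>B. - Re (\<mu> B))) f
     + \<i> * (integral\<^sup>L (positive_variation (\<lambda>B. Im (\<mu> B))) f
             - integral\<^sup>L (positive_variation (\<lambda>B. - Im (\<mu> B))) f)"


section \<open>Convolution and involution\<close>

definition representing_measure ::
    "('a::topological_space \<Rightarrow> complex) set \<Rightarrow> (('a \<Rightarrow> complex) \<Rightarrow> complex) \<Rightarrow>
     ('a set \<Rightarrow> complex) \<Rightarrow> bool" where
  "representing_measure A \<phi> \<mu> \<longleftrightarrow>
     finite_regular_complex_measure \<mu> \<and> (\<forall>f\<in>A. complex_measure_integral \<mu> f = \<phi> f)"

text \<open>
  The integral over the product is written as an iterated integral; for continuous \<open>f\<close> on a
  compact group the two agree by Fubini. The definite description is meaningful only if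
  representing measures exist and the value does not depend on their choice.
\<close>

definition convolution ::
    "('a::topological_ab_group_add \<Rightarrow> complex) set \<Rightarrow> (('a \<Rightarrow> complex) \<Rightarrow> complex) \<Rightarrow>
     (('a \<Rightarrow> complex) \<Rightarrow> complex) \<Rightarrow> (('a \<Rightarrow> complex) \<Rightarrow> complex)" where
  "convolution A \<phi> \<psi> =
     (\<lambda>f\<in>A. THE z. \<exists>\<mu> \<nu>. representing_measure A \<phi> \<mu> \<and> representing_measure A \<psi> \<nu> \<and>
        z = complex_measure_integral \<nu> (\<lambda>h. complex_measure_integral \<mu> (\<lambda>g. f (g + h))))"

definition star :: "('a::topological_ab_group_add \<Rightarrow> complex) \<Rightarrow> 'a \<Rightarrow> complex" where
  "star f = (\<lambda>g. cnj (f (- g)))"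

definition involution ::
    "('a::topological_ab_group_add \<Rightarrow> complex) set \<Rightarrow> (('a \<Rightarrow> complex) \<Rightarrow> complex) \<Rightarrow>
     (('a \<Rightarrow> complex) \<Rightarrow> complex)" where
  "involution A \<phi> = (\<lambda>f\<in>A. cnj (\<phi> (star f)))"


section \<open>Homomorphisms into the closed unit disc\<close>

definition disc_homs :: "('a \<Rightarrow> complex) set \<Rightarrow> (('a \<Rightarrow> complex) \<Rightarrow> complex) set" where
  "disc_homs S =
     {h \<in> S \<rightarrow>\<^sub>E cball 0 1.
        (\<forall>\<gamma>\<in>S. \<forall>\<delta>\<in>S. h (\<lambda>x. \<gamma> x * \<delta> x) = h \<gamma> * h \<delta>) \<and> (\<exists>\<gamma>\<in>S. h \<gamma> \<noteq> 0)}"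

definition disc_homs_topology ::
    "('a \<Rightarrow> complex) set \<Rightarrow> (('a \<Rightarrow> complex) \<Rightarrow> complex) topology" where
  "disc_homs_topology S = subtopology (product_topology (\<lambda>_. euclidean) S) (disc_homs S)"

definition disc_homs_mult ::
    "('a \<Rightarrow> complex) set \<Rightarrow> (('a \<Rightarrow> complex) \<Rightarrow> complex) \<Rightarrow>
     (('a \<Rightarrow> complex) \<Rightarrow> complex) \<Rightarrow> (('a \<Rightarrow> complex) \<Rightarrow> complex)" where
  "disc_homs_mult S h k = (\<lambda>\<gamma>\<in>S. h \<gamma> * k \<gamma>)"


section \<open>Topological semigroups\<close>

definition topological_semigroup :: "'b topology \<Rightarrow> ('b \<Rightarrow> 'b \<Rightarrow> 'b) \<Rightarrow> bool" where
  "topological_semigroup T m \<longleftrightarrow>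
     (\<forall>x\<in>topspace T. \<forall>y\<in>topspace T. m x y \<in> topspace T) \<and>
     (\<forall>x\<in>topspace T. \<forall>y\<in>topspace T. \<forall>z\<in>topspace T. m (m x y) z = m x (m y z)) \<and>
     continuous_map (prod_topology T T) T (\<lambda>(x, y). m x y)"

definition topological_semigroup_iso ::
    "'b topology \<Rightarrow> ('b \<Rightarrow> 'b \<Rightarrow> 'b) \<Rightarrow> 'c topology \<Rightarrow> ('c \<Rightarrow> 'c \<Rightarrow> 'c) \<Rightarrow> ('b \<Rightarrow> 'c) \<Rightarrow> bool" where
  "topological_semigroup_iso T m T' m' \<rho> \<longleftrightarrow>
     topological_semigroup T m \<and> topological_semigroup T' m' \<and>
     homeomorphic_map T T' \<rho> \<and>
     (\<forall>x\<in>topspace T. \<forall>y\<in>topspace T. \<rho> (m x y) = m' (\<rho> x) (\<rho> y))"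

definition spectral_restriction ::
    "('a::topological_ab_group_add \<Rightarrow> complex) set \<Rightarrow> (('a \<Rightarrow> complex) \<Rightarrow> complex) \<Rightarrow>
     (('a \<Rightarrow> complex) \<Rightarrow> complex)" where
  "spectral_restriction A \<phi> = restrict \<phi> (Sp A)"

end

theory Submission
  imports Defs "HOL-Probability.Probability_Measure" "HOL-Complex_Analysis.Great_Picard"
    "HOL-Real_Asymp.Real_Asymp"
begin

text \<open>
  Fourier analysis shows that \<open>A\<close> is the closed linear span of \<open>Sp A\<close>: if the Fourier coefficient
  of some \<open>f \<in> A\<close> at a character \<open>\<gamma>\<close> is nonzero, then \<open>\<gamma>\<close> is a uniform limit of combinations of
  translates of \<open>f\<close>, and convolution with a trigonometric approximate identity approximates \<open>f\<close> by
  trigonometric polynomials with frequencies in \<open>Sp A\<close>. Since elements of \<open>\<M>\<^sub>A\<close> are contractive,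
  they are determined by their values on \<open>Sp A\<close>.

  Conversely let \<open>h\<close> be a homomorphism from \<open>Sp A\<close> into the disc. The \<open>n\<close>-th power of a
  trigonometric polynomial \<open>p\<close> has only polynomially many frequencies, each with a coefficient bounded by
  \<open>\<parallel>p\<parallel>\<^sup>n\<close>, so extracting \<open>n\<close>-th roots shows that the linear extension of \<open>h\<close> satisfies
  \<open>\<bar>h(p)\<bar> \<le> \<parallel>p\<parallel>\<close>. By Hahn-Banach and Riesz it is integration against a regular probability measure,
  which restricts to the element of \<open>\<M>\<^sub>A\<close> extending \<open>h\<close> and also represents it in convolutions.

  Haar measure arises in the same way, from the infimum of the suprema of averages of translates.
  Characters are found as extreme points of the positive definite functions in an eigenspace of a
  convolution operator.
\<close>

section \<open>Hahn-Banach and Riesz-Markov\<close>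

text \<open>The group need not be metrisable, so the Borel sets of the product may go beyond the
  product of the Borel \<sigma>-algebras. Double integrals are therefore interchanged only for
  continuous integrands, through Riemann sums that are uniform in the second variable, and
  eigenfunctions and extremal functions are found as uniform cluster points of equicontinuous
  sequences, without completing any space. The convolution of functionals is a definite description:
  it denotes nothing until representing measures exist and their choice is known not to matter.
  Existence is settled with probability measures, for which the Jordan decomposition in
  \<open>complex_measure_integral\<close> is trivial. They can be had because a contractive
  functional with value 1 at the constant 1 satisfies Re h(p) \<le> sup Re p, a one-sided bound that
  yields positivity. Independence is settled by integrating out one variable: the function that
  remains lies again in \<open>A\<close>, where every representing measure of the other functional
  gives the same value.\<close>

lemma sublinear_dominates_linear:
  fixes p :: "'v::real_vector \<Rightarrow> real"
  assumes sub: "\<And>x y. p (x + y) \<le> p x + p y"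
    and hom: "\<And>c x. c > 0 \<Longrightarrow> p (c *\<^sub>R x) \<le> c * p x"
  obtains L where "linear L" "\<And>x. L x \<le> p x"
proof -
  define subl where "subl q \<longleftrightarrow> (\<forall>x y. q (x + y) \<le> q x + q y) \<and> (\<forall>c>0. \<forall>x. q (c *\<^sub>R x) \<le> c * q x)"
    for q :: "'v \<Rightarrow> real"
  have hom_eq: "q (c *\<^sub>R x) = c * q x" if "subl q" "c > 0" for q c x
  proof (rule antisym)
    show "q (c *\<^sub>R x) \<le> c * q x" using that by (auto simp: subl_def)
    have "q (inverse c *\<^sub>R (c *\<^sub>R x)) \<le> inverse c * q (c *\<^sub>R x)"
      using that unfolding subl_def by (metis inverse_positive_iff_positive)
    then show "c * q x \<le> q (c *\<^sub>R x)" using that by (simp add: field_simps)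
  qed
  have zero: "q 0 = 0" if "subl q" for q
    using hom_eq[OF that, of 2 0] by simp
  have lower: "- q (- x) \<le> q x" if "subl q" for q x
  proof -
    have "q (x + - x) \<le> q x + q (- x)" using that unfolding subl_def by blast
    then show ?thesis using zero[OF that] by simp
  qed
  \<comment> \<open>Zorn's lemma is applied downwards to the sublinear minorants of
    \<open>p\<close>; a minimal one will turn out to be additive.\<close>
  define A where "A = {q. subl q \<and> (\<forall>x. q x \<le> p x)}"
  have pA: "p \<in> A" using sub hom by (auto simp: A_def subl_def)
  have ex: "\<exists>m\<in>A. \<forall>a\<in>A. a \<le> m \<longrightarrow> a = m"
  proof (rule predicate_Zorn[where P = "\<lambda>q r. r \<le> q"])
    show "partial_order_on A (relation_of (\<lambda>q r. r \<le> q) A)"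
      by (rule partial_order_on_relation_ofI) auto
    fix C assume C: "C \<in> Chains (relation_of (\<lambda>q r. r \<le> q) A)"
    show "\<exists>u\<in>A. \<forall>a\<in>C. u \<le> a"
    proof (cases "C = {}")
      case True then show ?thesis using pA by auto
    next
      case False
      have CA: "C \<subseteq> A" and chain: "\<And>q r. q \<in> C \<Longrightarrow> r \<in> C \<Longrightarrow> q \<le> r \<or> r \<le> q"
        using C by (auto simp: Chains_def relation_of_def)
      \<comment> \<open>Every member is at least \<open>- p (- x)\<close> at \<open>x\<close>, so
        the pointwise infimum of a chain stays finite.\<close>
      have bdd: "bdd_below ((\<lambda>q. q x) ` C)" for x
      proof (rule bdd_belowI2)
        fix q assume "q \<in> C"
        then have "subl q" "q (- x) \<le> p (- x)" using CA by (auto simp: A_def)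
        then show "- p (- x) \<le> q x" using lower[of q x] by simp
      qed
      define u where "u x = (INF q\<in>C. q x)" for x
      have le: "u x \<le> q x" if "q \<in> C" for q x
        unfolding u_def using bdd that by (rule cINF_lower)
      have ge: "c \<le> u x" if "\<And>q. q \<in> C \<Longrightarrow> c \<le> q x" for c x
        unfolding u_def using False that by (rule cINF_greatest)
      have "subl u" unfolding subl_def
      proof (intro conjI allI impI)
        fix x y
        have "u (x + y) - q2 y \<le> u x" if q2: "q2 \<in> C" for q2
        proof (rule ge)
          fix q1 assume q1: "q1 \<in> C"
          \<comment> \<open>Subadditivity passes to the infimum because two members of a chain can
            both be replaced by the smaller one.\<close>
          obtain q where q: "q \<in> C" "q \<le> q1" "q \<le> q2" using chain[OF q1 q2] q1 q2 by auto
          have "u (x + y) \<le> q (x + y)" using le q by auto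
          also have "\<dots> \<le> q x + q y" using q CA by (auto simp: A_def subl_def)
          also have "\<dots> \<le> q1 x + q2 y" using q by (intro add_mono) (auto simp: le_fun_def)
          finally show "u (x + y) - q2 y \<le> q1 x" by simp
        qed
        then have "u (x + y) - u x \<le> u y" by (intro ge) (simp add: algebra_simps)
        then show "u (x + y) \<le> u x + u y" by simp
      next
        fix c :: real and x assume c: "c > 0"
        have "u (c *\<^sub>R x) / c \<le> u x"
        proof (rule ge)
          fix q assume q: "q \<in> C"
          have "u (c *\<^sub>R x) \<le> q (c *\<^sub>R x)" using le q by auto
          also have "\<dots> \<le> c * q x" using q c CA by (auto simp: A_def subl_def)
          finally show "u (c *\<^sub>R x) / c \<le> q x" using c by (simp add: field_simps)
        qed
        then show "u (c *\<^sub>R x) \<le> c * u x" using c by (simp add: field_simps)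
      qed
      moreover have "u x \<le> p x" for x
        using False le[of _ x] CA unfolding A_def by (force intro: order_trans)
      ultimately have "u \<in> A" by (simp add: A_def)
      then show ?thesis using le by (auto simp: le_fun_def)
    qed
  qed
  then obtain m where m: "m \<in> A" and min: "\<And>a. a \<in> A \<Longrightarrow> a \<le> m \<Longrightarrow> a = m" by blast
  have sm: "subl m" using m by (simp add: A_def)
  have msub: "m (x + y) \<le> m x + m y" for x y using sm by (auto simp: subl_def)
  have mhom: "m (c *\<^sub>R x) = c * m x" if "c \<ge> 0" for c x
    using that hom_eq[OF sm, of c x] zero[OF sm] by (cases "c = 0") auto
  txt \<open>The functional \<open>n\<close> below is again sublinear, so minimality of \<open>m\<close> forces \<open>n = m\<close>.\<close>
  have super: "m x + m a \<le> m (x + a)" for x a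
  proof -
    define n where "n x = (INF t\<in>{0..}. m (x + t *\<^sub>R a) - t * m a)" for x
    have "bdd_below ((\<lambda>t. m (x + t *\<^sub>R a) - t * m a) ` {0..})" for x
    proof (rule bdd_belowI2)
      fix t :: real assume "t \<in> {0..}"
      then have "t * m a \<le> m (x + t *\<^sub>R a) + m (- x)"
        using msub[of "x + t *\<^sub>R a" "- x"] mhom[of t a] by simp
      then show "- m (- x) \<le> m (x + t *\<^sub>R a) - t * m a" by simp
    qed
    then have le: "n x \<le> m (x + t *\<^sub>R a) - t * m a" if "t \<ge> 0" for x t
      unfolding n_def using that by (intro cINF_lower) auto
    have ge: "c \<le> n x" if "\<And>t. t \<ge> 0 \<Longrightarrow> c \<le> m (x + t *\<^sub>R a) - t * m a" for c x
      unfolding n_def using that by (intro cINF_greatest) auto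
    have "subl n" unfolding subl_def
    proof (intro conjI allI impI)
      fix x y
      have "n (x + y) - (m (y + t *\<^sub>R a) - t * m a) \<le> n x" if t: "t \<ge> 0" for t
      proof (rule ge)
        fix s :: real assume s: "s \<ge> 0"
        have "n (x + y) \<le> m (x + y + (s + t) *\<^sub>R a) - (s + t) * m a" using le s t by auto
        also have "x + y + (s + t) *\<^sub>R a = (x + s *\<^sub>R a) + (y + t *\<^sub>R a)"
          by (simp add: algebra_simps)
        also have "m ((x + s *\<^sub>R a) + (y + t *\<^sub>R a)) \<le> m (x + s *\<^sub>R a) + m (y + t *\<^sub>R a)"
          by (rule msub)
        finally show "n (x + y) - (m (y + t *\<^sub>R a) - t * m a) \<le> m (x + s *\<^sub>R a) - s * m a"
          by (simp add: algebra_simps)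
      qed
      then have "n (x + y) - n x \<le> n y" by (intro ge) (simp add: algebra_simps)
      then show "n (x + y) \<le> n x + n y" by simp
    next
      fix c :: real and x assume c: "c > 0"
      have "n (c *\<^sub>R x) / c \<le> n x"
      proof (rule ge)
        fix t :: real assume t: "t \<ge> 0"
        have "n (c *\<^sub>R x) \<le> m (c *\<^sub>R x + (c * t) *\<^sub>R a) - c * t * m a" using le c t by auto
        also have "c *\<^sub>R x + (c * t) *\<^sub>R a = c *\<^sub>R (x + t *\<^sub>R a)" by (simp add: algebra_simps)
        also have "m \<dots> = c * m (x + t *\<^sub>R a)" using mhom c by auto
        finally show "n (c *\<^sub>R x) / c \<le> m (x + t *\<^sub>R a) - t * m a"
          using c by (simp add: field_simps)
      qed
      then show "n (c *\<^sub>R x) \<le> c * n x" using c by (simp add: field_simps)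
    qed
    moreover have nm: "n x \<le> m x" for x using le[of 0 x] by simp
    moreover have "n x \<le> p x" for x using nm[of x] m unfolding A_def
      by (auto intro: order_trans)
    ultimately have "n = m" by (intro min) (auto simp: A_def le_fun_def)
    \<comment> \<open>Once \<open>n = m\<close>, the competitor \<open>t = 1\<close> in the infimum
      is superadditivity.\<close>
    then show ?thesis using le[of 1 x] by simp
  qed
  have add: "m (x + y) = m x + m y" for x y using msub super by (intro antisym)
  have "linear m"
  proof (rule linearI)
    show "m (x + y) = m x + m y" for x y by (rule add)
    have neg: "m (- x) = - m x" for x using add[of x "- x"] zero[OF sm] by simp
    show "m (c *\<^sub>R x) = c *\<^sub>R m x" for c x
    proof (cases "c \<ge> 0")
      case True then show ?thesis using mhom by simp
    next
      case False
      then have "m ((- c) *\<^sub>R x) = (- c) * m x" by (intro mhom) auto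
      then show ?thesis using neg[of "c *\<^sub>R x"] by simp
    qed
  qed
  moreover have "m x \<le> p x" for x using m by (auto simp: A_def)
  ultimately show ?thesis by (rule that)
qed

text \<open>\<open>q\<close> is controlled only on continuous functions, which do not form a type.
  On a compact space they are all bounded, so the abstract statement is applied on the vector space
  of bounded continuous functions and carried back along \<open>Bcontfun\<close>.\<close>

lemma hahn_banach_continuous:
  fixes q :: "('a::topological_space \<Rightarrow> real) \<Rightarrow> real"
  assumes cpt: "compact (UNIV :: 'a set)"
    and sub: "\<And>u v. continuous_on UNIV u \<Longrightarrow> continuous_on UNIV v \<Longrightarrow> q (\<lambda>x. u x + v x) \<le> q u + q v"
    and hom: "\<And>c u. c > 0 \<Longrightarrow> continuous_on UNIV u \<Longrightarrow> q (\<lambda>x. c * u x) \<le> c * q u"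
  obtains L where
    "\<And>u v. continuous_on UNIV u \<Longrightarrow> continuous_on UNIV v \<Longrightarrow> L (\<lambda>x. u x + v x) = L u + L v"
    "\<And>c u. continuous_on UNIV u \<Longrightarrow> L (\<lambda>x. c * u x) = c * L u"
    "\<And>u. continuous_on UNIV u \<Longrightarrow> L u \<le> q u"
proof -
  have bc: "u \<in> bcontfun" if "continuous_on UNIV u" for u :: "'a \<Rightarrow> real"
    using that compact_imp_bounded[OF compact_continuous_image[OF that cpt]]
    by (simp add: bcontfun_def)
  have c_app: "continuous_on UNIV (apply_bcontfun f)" for f :: "'a \<Rightarrow>\<^sub>C real"
    by (rule continuous_on_apply_bcontfun)
  obtain L0 :: "('a \<Rightarrow>\<^sub>C real) \<Rightarrow> real" where L0: "linear L0" "\<And>f. L0 f \<le> q (apply_bcontfun f)"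
  proof (rule sublinear_dominates_linear[of "\<lambda>f. q (apply_bcontfun f)"])
    fix f g :: "'a \<Rightarrow>\<^sub>C real"
    have "apply_bcontfun (f + g) = (\<lambda>x. f x + g x)" by (rule ext) simp
    then show "q (apply_bcontfun (f + g)) \<le> q (apply_bcontfun f) + q (apply_bcontfun g)"
      using sub[OF c_app c_app, of f g] by simp
  next
    fix c :: real and f :: "'a \<Rightarrow>\<^sub>C real" assume "c > 0"
    have "apply_bcontfun (c *\<^sub>R f) = (\<lambda>x. c * f x)" by (rule ext) simp
    then show "q (apply_bcontfun (c *\<^sub>R f)) \<le> c * q (apply_bcontfun f)"
      using hom[OF \<open>c > 0\<close> c_app, of f] by simp
  qed blast
  show ?thesis
  proof (rule that[of "\<lambda>u. L0 (Bcontfun u)"])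
    fix u v :: "'a \<Rightarrow> real" assume uv: "continuous_on UNIV u" "continuous_on UNIV v"
    have "Bcontfun (\<lambda>x. u x + v x) = Bcontfun u + Bcontfun v"
      using uv by (intro bcontfun_eqI) (simp add: Bcontfun_inverse bc continuous_on_add)
    then show "L0 (Bcontfun (\<lambda>x. u x + v x)) = L0 (Bcontfun u) + L0 (Bcontfun v)"
      using L0(1) by (simp add: linear_add)
  next
    fix c and u :: "'a \<Rightarrow> real" assume u: "continuous_on UNIV u"
    have "Bcontfun (\<lambda>x. c * u x) = c *\<^sub>R Bcontfun u"
      using u by (intro bcontfun_eqI) (simp add: Bcontfun_inverse bc continuous_on_mult_left)
    then show "L0 (Bcontfun (\<lambda>x. c * u x)) = c * L0 (Bcontfun u)"
      using L0(1) by (simp add: linear_cmul)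
  next
    fix u :: "'a \<Rightarrow> real" assume "continuous_on UNIV u"
    then show "L0 (Bcontfun u) \<le> q u" using L0(2)[of "Bcontfun u"] by (simp add: Bcontfun_inverse bc)
  qed
qed

section \<open>Boundedness, separation and regular probability measures on compact spaces\<close>

lemma compact_continuous_bounded:
  fixes f :: "'a::topological_space \<Rightarrow> 'b::real_normed_vector"
  assumes "compact (UNIV :: 'a set)" "continuous_on UNIV f"
  obtains B where "B > 0" "\<And>x. norm (f x) \<le> B"
  using compact_imp_bounded[OF compact_continuous_image[OF assms(2,1)]]
  unfolding bounded_pos by auto

lemma urysohn_compact:
  fixes S T :: "'a::t2_space set"
  assumes "compact (UNIV :: 'a set)" "closed S" "closed T" "S \<inter> T = {}"
  obtains w :: "'a \<Rightarrow> real" where "continuous_on UNIV w" "\<And>x. 0 \<le> w x \<and> w x \<le> 1"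
    "\<And>x. x \<in> S \<Longrightarrow> w x = 0" "\<And>x. x \<in> T \<Longrightarrow> w x = 1"
proof -
  have "normal_space (euclidean :: 'a topology)"
  proof (rule compact_Hausdorff_or_regular_imp_normal_space)
    show "compact_space (euclidean :: 'a topology)" using assms(1) by (simp add: compact_space_def)
    have "Hausdorff_space (euclidean :: 'a topology)"
      using separation_t2 by (auto simp: Hausdorff_space_def disjnt_def)
    then show "Hausdorff_space (euclidean :: 'a topology) \<or> regular_space (euclidean :: 'a topology)" ..
  qed
  from Urysohn_lemma[OF this, of S T 0 1] obtain w where
    w: "continuous_map euclidean (top_of_set {0..1::real}) w" "w ` S \<subseteq> {0}" "w ` T \<subseteq> {1}"
    using assms by (auto simp: disjnt_def)
  show ?thesis
  proof (rule that[of w])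
    show "continuous_on UNIV w" using w(1) by (simp add: continuous_map_in_subtopology)
    show "0 \<le> w x \<and> w x \<le> 1" for x using w(1) by (force simp: continuous_map_in_subtopology)
  qed (use w in auto)
qed

text \<open>The regularity clauses copy those of \<open>finite_regular_complex_measure\<close>: the
  total variation of a probability measure is the measure itself, so they transfer word for
  word.\<close>

definition regular_prob :: "'a::topological_space measure \<Rightarrow> bool" where
  "regular_prob N \<longleftrightarrow> prob_space N \<and> sets N = sets borel \<and>
     (\<forall>B\<in>sets borel.
        emeasure N B = (INF U\<in>{U. open U \<and> B \<subseteq> U}. emeasure N U) \<and>
        emeasure N B = (SUP K\<in>{K. compact K \<and> K \<subseteq> B}. emeasure N K))"

section \<open>Riesz representation of a normalised positive functional\<close>

locale positive_functional =
  fixes L :: "('a::t2_space \<Rightarrow> real) \<Rightarrow> real"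
  assumes cpt: "compact (UNIV :: 'a set)"
    and L_add: "\<And>u v. continuous_on UNIV u \<Longrightarrow> continuous_on UNIV v \<Longrightarrow> L (\<lambda>x. u x + v x) = L u + L v"
    and L_cmult: "\<And>c u. continuous_on UNIV u \<Longrightarrow> L (\<lambda>x. c * u x) = c * L u"
    and L_mono: "\<And>u v. continuous_on UNIV u \<Longrightarrow> continuous_on UNIV v \<Longrightarrow> (\<And>x. u x \<le> v x) \<Longrightarrow> L u \<le> L v"
    and L_one: "L (\<lambda>x. 1) = 1"
begin

lemma L_const: "L (\<lambda>x. c) = c"
  using L_cmult[of "\<lambda>x. 1" c] L_one by simp

lemma L_nonneg: "continuous_on UNIV u \<Longrightarrow> (\<And>x. 0 \<le> u x) \<Longrightarrow> 0 \<le> L u"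
  using L_mono[of "\<lambda>x. 0" u] L_const[of 0] by simp

lemma L_le_add: "L u \<le> L v + e"
  if "continuous_on UNIV u" "continuous_on UNIV v" "\<And>x. u x \<le> v x + e"
proof -
  have "L u \<le> L (\<lambda>x. v x + e)"
    using that by (intro L_mono continuous_on_add continuous_on_const)
  also have "\<dots> = L v + e" using L_add[of v "\<lambda>x. e"] L_const[of e] that by simp
  finally show ?thesis .
qed

lemma L_sum: "finite I \<Longrightarrow> (\<And>i. i \<in> I \<Longrightarrow> continuous_on UNIV (u i)) \<Longrightarrow>
   L (\<lambda>x. \<Sum>i\<in>I. u i x) = (\<Sum>i\<in>I. L (u i))"
proof (induction I rule: finite_induct)
  case (insert i I)
  then show ?case by (simp add: L_add continuous_on_sum)
qed (simp add: L_const)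

text \<open>Vanishing off \<open>U\<close> is weaker than having compact support in
  \<open>U\<close>. The compactness is recovered by \<open>cut\<close>: for \<open>e > 0\<close> the
  function \<open>cut e u\<close> is zero outside the compact set \<open>{x. u x \<ge> e}\<close>,
  which lies in \<open>U\<close>, and \<open>L\<close> loses at most \<open>e\<close>.\<close>

definition test :: "'a set \<Rightarrow> ('a \<Rightarrow> real) set" where
  "test U = {u. continuous_on UNIV u \<and> (\<forall>x. 0 \<le> u x \<and> u x \<le> 1) \<and> (\<forall>x. x \<notin> U \<longrightarrow> u x = 0)}"

definition cut :: "real \<Rightarrow> ('a \<Rightarrow> real) \<Rightarrow> 'a \<Rightarrow> real" where
  "cut e u x = max 0 (u x - e)"

lemma cut_cont: "continuous_on UNIV u \<Longrightarrow> continuous_on UNIV (cut e u)"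
  unfolding cut_def by (intro continuous_intros)

lemma L_le_cut: "continuous_on UNIV u \<Longrightarrow> L u \<le> L (cut e u) + e"
  by (rule L_le_add) (auto simp: cut_cont, simp add: cut_def)

lemma cut_test: "u \<in> test U \<Longrightarrow> e \<ge> 0 \<Longrightarrow> cut e u \<in> test {x. u x > e}"
  unfolding test_def
proof (intro CollectI conjI allI impI)
  assume u: "u \<in> {u. continuous_on UNIV u \<and> (\<forall>x. 0 \<le> u x \<and> u x \<le> 1) \<and> (\<forall>x. x \<notin> U \<longrightarrow> u x = 0)}"
    and e: "0 \<le> e"
  show "continuous_on UNIV (cut e u)" using u by (intro cut_cont) simp
  fix x
  have "u x \<le> 1" using u by simp
  then show "0 \<le> cut e u x" "cut e u x \<le> 1" using e by (auto simp: cut_def)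
  show "cut e u x = 0" if "x \<notin> {x. e < u x}" using that by (simp add: cut_def)
qed

lemma closed_superlevel: "continuous_on UNIV u \<Longrightarrow> closed {x. u x \<ge> e}" for u :: "'a \<Rightarrow> real"
  by (intro closed_Collect_le continuous_intros)

definition nu :: "'a set \<Rightarrow> ennreal" where
  "nu U = (SUP u\<in>test U. ennreal (L u))"

lemma test_ne: "test U \<noteq> {}"
proof -
  have "(\<lambda>x. 0) \<in> test U" by (simp add: test_def)
  then show ?thesis by blast
qed

lemma test_mono: "U \<subseteq> V \<Longrightarrow> test U \<subseteq> test V"
  by (auto simp: test_def)

lemma nu_mono: "U \<subseteq> V \<Longrightarrow> nu U \<le> nu V"
  unfolding nu_def by (rule SUP_subset_mono) (auto dest: test_mono)

lemma nu_upper: "u \<in> test U \<Longrightarrow> ennreal (L u) \<le> nu U"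
  unfolding nu_def by (rule SUP_upper)

lemma nu_UNIV: "nu UNIV = 1"
proof (rule antisym)
  show "nu UNIV \<le> 1" unfolding nu_def
  proof (rule SUP_least)
    fix u assume "u \<in> test UNIV"
    then have "L u \<le> 1" using L_mono[of u "\<lambda>x. 1"] L_one by (simp add: test_def)
    then show "ennreal (L u) \<le> 1" by (simp add: ennreal_le_1)
  qed
  have "(\<lambda>x. 1) \<in> test UNIV" by (simp add: test_def)
  from nu_upper[OF this] show "1 \<le> nu UNIV" by (simp add: L_one)
qed

lemma nu_empty: "nu {} = 0"
proof -
  have "test {} = {\<lambda>x. 0}" by (auto simp: test_def)
  then show ?thesis by (simp add: nu_def L_const)
qed

text \<open>It suffices to bound truncations, since \<open>L u\<close> exceeds
  \<open>L (cut e u)\<close> by at most the arbitrary number \<open>e\<close>. Compactness enters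
  the estimates for \<open>nu\<close> through this reduction.\<close>

lemma nu_le_cut:
  assumes "\<And>u e. u \<in> test U \<Longrightarrow> e > 0 \<Longrightarrow> ennreal (L (cut e u)) \<le> B"
  shows "nu U \<le> B"
  unfolding nu_def
proof (rule SUP_least)
  fix u assume u: "u \<in> test U"
  show "ennreal (L u) \<le> B"
  proof (rule ennreal_le_epsilon)
    fix e :: real assume e: "e > 0"
    have c: "continuous_on UNIV u" using u by (simp add: test_def)
    have "ennreal (L u) \<le> ennreal (L (cut e u) + e)" using L_le_cut[OF c, of e] by (rule ennreal_leI)
    also have "\<dots> = ennreal (L (cut e u)) + ennreal e"
      using e c by (intro ennreal_plus L_nonneg cut_cont) (auto simp: cut_def)
    also have "\<dots> \<le> B + ennreal e" using assms[OF u e] by (intro add_right_mono)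
    finally show "ennreal (L u) \<le> B + ennreal e" .
  qed
qed

text \<open>Inside the compact set \<open>{x. u x \<ge> e}\<close> a Urysohn function
  \<open>w\<close> that is 0 off \<open>U\<close> and 1 off \<open>V\<close> splits the truncation
  of \<open>u\<close> into a test function for \<open>U\<close> and one for
  \<open>V\<close>.\<close>

lemma nu_Un:
  assumes "open U" "open V"
  shows "nu (U \<union> V) \<le> nu U + nu V"
proof (rule nu_le_cut)
  fix u and e :: real assume u: "u \<in> test (U \<union> V)" and e: "e > 0"
  have c: "continuous_on UNIV u" using u by (simp add: test_def)
  let ?K = "{x. u x \<ge> e}"
  have cl: "closed (?K - U)" "closed (?K - V)"
    using closed_superlevel[OF c] assms by (auto intro: closed_Diff)
  have "(?K - U) \<inter> (?K - V) = {}" using u e by (force simp: test_def)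
  then obtain w :: "'a \<Rightarrow> real" where w: "continuous_on UNIV w" "\<And>x. 0 \<le> w x \<and> w x \<le> 1"
    "\<And>x. x \<in> ?K - U \<Longrightarrow> w x = 0" "\<And>x. x \<in> ?K - V \<Longrightarrow> w x = 1"
    using urysohn_compact[OF cpt cl] by metis
  have ct: "continuous_on UNIV (cut e u)" by (rule cut_cont[OF c])
  have "cut e u \<in> test {x. u x > e}" using cut_test[OF u] e by simp
  then have r: "0 \<le> cut e u x" "cut e u x \<le> 1" for x by (auto simp: test_def)
  have z: "cut e u x = 0" if "x \<notin> ?K" for x using that by (simp add: cut_def)
  have 1: "(\<lambda>x. cut e u x * w x) \<in> test U" unfolding test_def
  proof (intro CollectI conjI allI impI)
    show "continuous_on UNIV (\<lambda>x. cut e u x * w x)" using ct w(1) by (intro continuous_intros)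
    show "0 \<le> cut e u x * w x" "cut e u x * w x \<le> 1" for x
      using r[of x] w(2)[of x] by (auto intro: mult_nonneg_nonneg mult_le_one)
    show "cut e u x * w x = 0" if "x \<notin> U" for x using that w(3)[of x] z[of x] by (cases "x \<in> ?K") auto
  qed
  have 2: "(\<lambda>x. cut e u x * (1 - w x)) \<in> test V" unfolding test_def
  proof (intro CollectI conjI allI impI)
    show "continuous_on UNIV (\<lambda>x. cut e u x * (1 - w x))" using ct w(1) by (intro continuous_intros)
    show "0 \<le> cut e u x * (1 - w x)" "cut e u x * (1 - w x) \<le> 1" for x
      using r[of x] w(2)[of x] by (auto intro: mult_nonneg_nonneg mult_le_one)
    show "cut e u x * (1 - w x) = 0" if "x \<notin> V" for x using that w(4)[of x] z[of x] by (cases "x \<in> ?K") auto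
  qed
  have "L (cut e u) = L (\<lambda>x. cut e u x * w x + cut e u x * (1 - w x))" by (simp add: algebra_simps)
  also have "\<dots> = L (\<lambda>x. cut e u x * w x) + L (\<lambda>x. cut e u x * (1 - w x))"
    using 1 2 by (intro L_add) (auto simp: test_def)
  also have "ennreal \<dots> = ennreal (L (\<lambda>x. cut e u x * w x)) + ennreal (L (\<lambda>x. cut e u x * (1 - w x)))"
    using 1 2 by (intro ennreal_plus L_nonneg) (auto simp: test_def)
  also have "\<dots> \<le> nu U + nu V" by (intro add_mono nu_upper 1 2)
  finally show "ennreal (L (cut e u)) \<le> nu U + nu V" .
qed

lemma nu_UN_finite:
  fixes U :: "nat \<Rightarrow> 'a set"
  assumes "\<And>i. open (U i)"
  shows "nu (\<Union>i<n. U i) \<le> (\<Sum>i<n. nu (U i))"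
proof (induction n)
  case (Suc n)
  have "nu (\<Union>i<Suc n. U i) \<le> nu (\<Union>i<n. U i) + nu (U n)"
    unfolding lessThan_Suc UN_insert Un_commute[of "U n"] using assms by (intro nu_Un) auto
  also have "\<dots> \<le> (\<Sum>i<n. nu (U i)) + nu (U n)" using Suc by (rule add_right_mono)
  finally show ?case by simp
qed (simp add: nu_empty)

text \<open>Compactness of the superlevel set of a test function replaces the countable cover by a
  finite one.\<close>

lemma nu_UN:
  fixes U :: "nat \<Rightarrow> 'a set"
  assumes "\<And>i. open (U i)"
  shows "nu (\<Union>i. U i) \<le> (\<Sum>i. nu (U i))"
proof (rule nu_le_cut)
  fix u and e :: real assume u: "u \<in> test (\<Union>i. U i)" and e: "e > 0"
  have c: "continuous_on UNIV u" using u by (simp add: test_def)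
  let ?K = "{x. u x \<ge> e}"
  have "compact ?K" using closed_superlevel[OF c] cpt by (metis compact_Int_closed inf_top_left)
  moreover have "?K \<subseteq> (\<Union>i. U i)" using u e by (force simp: test_def)
  ultimately obtain C where C: "finite C" "?K \<subseteq> (\<Union>i\<in>C. U i)"
    using compactE_image[of ?K UNIV U] assms by auto
  obtain n where "C \<subseteq> {..<n}" using C(1) finite_nat_bounded by blast
  then have K: "?K \<subseteq> (\<Union>i<n. U i)" using C by blast
  have "cut e u \<in> test {x. u x > e}" using cut_test[OF u] e by simp
  also have "\<dots> \<subseteq> test (\<Union>i<n. U i)" using K by (intro test_mono) fastforce
  finally have "ennreal (L (cut e u)) \<le> nu (\<Union>i<n. U i)" by (rule nu_upper)
  also have "\<dots> \<le> (\<Sum>i<n. nu (U i))" by (rule nu_UN_finite[OF assms])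
  also have "\<dots> \<le> (\<Sum>i. nu (U i))" by (rule sum_le_suminf) auto
  finally show "ennreal (L (cut e u)) \<le> (\<Sum>i. nu (U i))" .
qed

definition outer :: "'a set \<Rightarrow> ennreal" where
  "outer E = (INF U\<in>{U. open U \<and> E \<subseteq> U}. nu U)"

lemma outer_le: "open U \<Longrightarrow> E \<subseteq> U \<Longrightarrow> outer E \<le> nu U"
  unfolding outer_def by (intro INF_lower) auto

lemma outer_open: "open U \<Longrightarrow> outer U = nu U"
  unfolding outer_def by (intro antisym INF_lower INF_greatest) (auto intro: nu_mono)

lemma outer_mono: "E \<subseteq> F \<Longrightarrow> outer E \<le> outer F"
  unfolding outer_def by (rule INF_superset_mono) auto

lemma outer_le_1: "outer E \<le> 1"
  using outer_mono[of E UNIV] outer_open[of UNIV] nu_UNIV by simp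

lemma outer_UN:
  fixes A :: "nat \<Rightarrow> 'a set"
  shows "outer (\<Union>i. A i) \<le> (\<Sum>i. outer (A i))"
proof (rule ennreal_le_epsilon)
  fix e :: real assume e: "0 < e"
  have "\<exists>U. open U \<and> A n \<subseteq> U \<and> nu U \<le> outer (A n) + ennreal (e * (1/2)^Suc n)" for n
  proof -
    have "outer (A n) \<noteq> top" using outer_le_1[of "A n"] by (metis ennreal_one_neq_top top.extremum_unique)
    then have "outer (A n) < outer (A n) + ennreal (e * (1/2)^Suc n)" using e by simp
    then show ?thesis unfolding outer_def INF_less_iff by (auto intro: less_imp_le)
  qed
  then obtain U where U: "\<And>n. open (U n)" "\<And>n. A n \<subseteq> U n"
    "\<And>n. nu (U n) \<le> outer (A n) + ennreal (e * (1/2)^Suc n)" by metis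
  have "outer (\<Union>i. A i) \<le> nu (\<Union>i. U i)" using U by (intro outer_le) auto
  also have "\<dots> \<le> (\<Sum>i. nu (U i))" by (rule nu_UN[OF U(1)])
  also have "\<dots> \<le> (\<Sum>n. outer (A n) + ennreal (e * (1/2) ^ Suc n))"
    using U(3) by (intro suminf_le allI) auto
  also have "... = (\<Sum>n. outer (A n)) + (\<Sum>n. ennreal e * ennreal ((1/2) ^ Suc n))"
    using e by (subst suminf_add[symmetric])
               (auto simp del: ennreal_suminf_cmult simp add: ennreal_mult[symmetric])
  also have "\<dots> = (\<Sum>n. outer (A n)) + e"
    unfolding ennreal_suminf_cmult
    by (subst suminf_ennreal_eq[OF zero_le_power power_half_series]) auto
  finally show "outer (\<Union>i. A i) \<le> (\<Sum>i. outer (A i)) + ennreal e" by simp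
qed

lemma outer_measure_space_outer: "outer_measure_space (Pow UNIV) outer"
  unfolding outer_measure_space_def positive_def increasing_def countably_subadditive_def
  by (auto simp: outer_open nu_empty outer_mono outer_UN)

lemma outer_Un: "outer (A \<union> B) \<le> outer A + outer B"
proof -
  interpret ring_of_sets UNIV "Pow UNIV :: 'a set set" by (rule ring_of_sets_Pow)
  have "subadditive (Pow UNIV) outer"
    using outer_measure_space_outer unfolding outer_measure_space_def
    by (intro countably_subadditive_subadditive) auto
  then have "outer (A \<union> (B - A)) \<le> outer A + outer (B - A)" by (intro subadditiveD) auto
  also have "\<dots> \<le> outer A + outer B" by (intro add_left_mono outer_mono) auto
  finally show ?thesis by simp
qed

text \<open>This is Caratheodory measurability of open sets. A test function \<open>u\<close> nearly
  exhausts \<open>V \<inter> U\<close>, and removing its closed superlevel set from \<open>V\<close>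
  leaves an open set that still contains \<open>E - U\<close>. Test functions of the two pieces live
  on disjoint sets, so their sum is again a test function for \<open>V\<close>.\<close>

lemma outer_split:
  assumes U: "open U"
  shows "outer (E \<inter> U) + outer (E - U) \<le> outer E"
  unfolding outer_def[of E]
proof (safe intro!: INF_greatest)
  fix V assume V: "open V" "E \<subseteq> V"
  have key: "ennreal (L (cut e u)) + outer (E - U) \<le> nu V" if u: "u \<in> test (V \<inter> U)" and e: "e > 0" for u e
  proof -
    let ?K = "{x. u x \<ge> e}"
    have c: "continuous_on UNIV u" using u by (simp add: test_def)
    have KU: "?K \<subseteq> U" "?K \<subseteq> V" using u e by (force simp: test_def)+
    have "outer (E - U) \<le> nu (V - ?K)"
      using V KU closed_superlevel[OF c, of e] by (intro outer_le open_Diff) auto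
    then have "ennreal (L (cut e u)) + outer (E - U) \<le> ennreal (L (cut e u)) + nu (V - ?K)"
      by (rule add_left_mono)
    also have "\<dots> = (SUP v\<in>test (V - ?K). ennreal (L v) + ennreal (L (cut e u)))"
      unfolding nu_def add.commute[of "ennreal (L (cut e u))"] by (rule ennreal_SUP_add_left[OF test_ne, symmetric])
    also have "\<dots> \<le> nu V"
    proof (rule SUP_least)
      fix v assume v: "v \<in> test (V - ?K)"
      have ct: "cut e u \<in> test {x. u x > e}" using cut_test[OF u] e by simp
      have "ennreal (L v) + ennreal (L (cut e u)) = ennreal (L (cut e u) + L v)"
        using ct v by (subst add.commute, intro ennreal_plus[symmetric] L_nonneg) (auto simp: test_def)
      also have "L (cut e u) + L v = L (\<lambda>x. cut e u x + v x)"
        using ct v by (intro L_add[symmetric]) (auto simp: test_def)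
      also have "ennreal \<dots> \<le> nu V"
      proof (rule nu_upper, unfold test_def, intro CollectI conjI allI impI)
        show "continuous_on UNIV (\<lambda>x. cut e u x + v x)"
          using ct v by (intro continuous_on_add) (auto simp: test_def)
        fix x
        have cx: "0 \<le> cut e u x" "cut e u x \<le> 1" "\<not> u x > e \<Longrightarrow> cut e u x = 0"
          using ct by (auto simp: test_def)
        have vx: "0 \<le> v x" "v x \<le> 1" "u x \<ge> e \<Longrightarrow> v x = 0" "x \<notin> V \<Longrightarrow> v x = 0"
          using v by (auto simp: test_def)
        show "0 \<le> cut e u x + v x" using cx vx by simp
        show "cut e u x + v x \<le> 1" using cx vx by (cases "u x > e") auto
        show "cut e u x + v x = 0" if "x \<notin> V"
        proof -
          have "\<not> u x > e" using that KU(2) by (auto simp: subset_iff not_le)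
          then show ?thesis using that cx vx by simp
        qed
      qed
      finally show "ennreal (L v) + ennreal (L (cut e u)) \<le> nu V" .
    qed
    finally show ?thesis .
  qed
  have "outer (E \<inter> U) + outer (E - U) \<le> nu (V \<inter> U) + outer (E - U)"
    using U V by (intro add_right_mono outer_le) auto
  also have "\<dots> = (SUP u\<in>test (V \<inter> U). ennreal (L u) + outer (E - U))"
    unfolding nu_def by (rule ennreal_SUP_add_left[OF test_ne, symmetric])
  also have "\<dots> \<le> nu V"
  proof (rule SUP_least)
    fix u assume u: "u \<in> test (V \<inter> U)"
    show "ennreal (L u) + outer (E - U) \<le> nu V"
    proof (rule ennreal_le_epsilon)
      fix e :: real assume e: "e > 0"
      have c: "continuous_on UNIV u" using u by (simp add: test_def)
      have "ennreal (L u) \<le> ennreal (L (cut e u) + e)" using L_le_cut[OF c, of e] by (rule ennreal_leI)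
      also have "\<dots> = ennreal (L (cut e u)) + ennreal e"
        using e c by (intro ennreal_plus L_nonneg cut_cont) (auto simp: cut_def)
      finally have "ennreal (L u) + outer (E - U) \<le> (ennreal (L (cut e u)) + outer (E - U)) + ennreal e"
        by (metis (no_types, lifting) add.assoc add.commute add_right_mono)
      also have "\<dots> \<le> nu V + ennreal e" by (intro add_right_mono key u e)
      finally show "ennreal (L u) + outer (E - U) \<le> nu V + ennreal e" .
    qed
  qed
  finally show "outer (E \<inter> U) + outer (E - U) \<le> nu V" .
qed

lemma borel_subset_lambda: "sets borel \<subseteq> lambda_system UNIV (Pow UNIV) outer"
proof -
  interpret sigma_algebra UNIV "Pow UNIV :: 'a set set" by (rule sigma_algebra_Pow)
  have ms: "measure_space UNIV (lambda_system UNIV (Pow UNIV) outer) outer"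
    by (rule caratheodory_lemma[OF outer_measure_space_outer])
  then interpret sa: sigma_algebra UNIV "lambda_system UNIV (Pow UNIV) outer"
    by (simp add: measure_space_def)
  have "{S::'a set. open S} \<subseteq> lambda_system UNIV (Pow UNIV) outer"
  proof
    fix U :: "'a set" assume "U \<in> {S. open S}"
    then have U: "open U" by simp
    have "outer (E \<inter> U) + outer (E - U) = outer E" for E
      using outer_split[OF U, of E] outer_Un[of "E \<inter> U" "E - U"]
      by (intro antisym) (auto simp: Int_Diff_Un)
    then show "U \<in> lambda_system UNIV (Pow UNIV) outer"
      unfolding lambda_system_eq by auto
  qed
  then show ?thesis unfolding sets_borel by (rule sa.sigma_sets_subset)
qed

definition N :: "'a measure" where
  "N = measure_of UNIV (sets borel) outer"

lemma sets_N: "sets N = sets borel"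
  unfolding N_def using sets.sigma_sets_eq[of "borel::'a measure"] by (simp add: sets_measure_of)

lemma space_N: "space N = UNIV"
  unfolding N_def by (simp add: space_measure_of)

lemma emeasure_N: "B \<in> sets borel \<Longrightarrow> emeasure N B = outer B"
proof (rule emeasure_measure_of[OF N_def])
  interpret sigma_algebra UNIV "Pow UNIV :: 'a set set" by (rule sigma_algebra_Pow)
  have ms: "measure_space UNIV (lambda_system UNIV (Pow UNIV) outer) outer"
    by (rule caratheodory_lemma[OF outer_measure_space_outer])
  show "positive (sets N) outer" by (simp add: positive_def outer_open nu_empty)
  have "countably_additive (lambda_system UNIV (Pow UNIV) outer) outer"
    using ms by (simp add: measure_space_def)
  then show "countably_additive (sets N) outer"
    unfolding countably_additive_def sets_N using borel_subset_lambda by blast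
qed (auto simp: sets_N)

lemma prob_space_N: "prob_space N"
  by (rule prob_spaceI) (simp add: space_N emeasure_N outer_open nu_UNIV)

sublocale prob_N: prob_space N by (rule prob_space_N)

lemma regular_prob_N: "regular_prob N"
  unfolding regular_prob_def
proof (intro conjI ballI)
  show "prob_space N" by (rule prob_space_N)
  show "sets N = sets borel" by (rule sets_N)
  fix B :: "'a set" assume B: "B \<in> sets borel"
  show outer_reg: "emeasure N B = (INF U\<in>{U. open U \<and> B \<subseteq> U}. emeasure N U)"
    unfolding emeasure_N[OF B] outer_def by (rule INF_cong) (auto simp: emeasure_N outer_open)
  show "emeasure N B = (SUP K\<in>{K. compact K \<and> K \<subseteq> B}. emeasure N K)"
  proof (rule antisym)
    show "(SUP K\<in>{K. compact K \<and> K \<subseteq> B}. emeasure N K) \<le> emeasure N B"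
      by (intro SUP_least emeasure_mono) (auto simp: sets_N B)
    show "emeasure N B \<le> (SUP K\<in>{K. compact K \<and> K \<subseteq> B}. emeasure N K)"
    proof (rule ennreal_le_epsilon)
      fix e :: real assume e: "e > 0"
      \<comment> \<open>Inner regularity of \<open>B\<close> is outer regularity of its complement:
        the complement of an open set is compact, and the total mass is finite.\<close>
      have cB: "- B \<in> sets borel" using B by simp
      have "emeasure N (- B) < emeasure N (- B) + e" using e by simp
      then obtain U where U: "open U" "- B \<subseteq> U" "nu U < emeasure N (- B) + e"
        unfolding emeasure_N[OF cB] outer_def INF_less_iff by auto
      have "nu U = emeasure N U" using U by (simp add: emeasure_N outer_open)
      then have "measure N U < measure N (- B) + e"
        using U(3) e by (simp add: prob_N.emeasure_eq_measure ennreal_less_iff flip: ennreal_plus)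
      moreover have "measure N (- U) = 1 - measure N U" "measure N (- B) = 1 - measure N B"
        using prob_N.prob_compl[of U] prob_N.prob_compl[of B] U B
        by (auto simp: space_N sets_N Compl_eq_Diff_UNIV)
      ultimately have "measure N B \<le> measure N (- U) + e" by simp
      then have "emeasure N B \<le> emeasure N (- U) + ennreal e"
        using e by (simp add: prob_N.emeasure_eq_measure flip: ennreal_plus)
      also have "\<dots> \<le> (SUP K\<in>{K. compact K \<and> K \<subseteq> B}. emeasure N K) + ennreal e"
      proof (intro add_right_mono SUP_upper)
        have "compact (- U)" using U(1) cpt by (metis closed_Compl compact_Int_closed inf_top_left)
        then show "- U \<in> {K. compact K \<and> K \<subseteq> B}" using U by auto
      qed
      finally show "emeasure N B \<le> (SUP K\<in>{K. compact K \<and> K \<subseteq> B}. emeasure N K) + ennreal e" .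
    qed
  qed
qed

lemma integrable_N:
  fixes u :: "'a \<Rightarrow> real"
  assumes "continuous_on UNIV u"
  shows "integrable N u"
proof -
  have "bounded (u ` UNIV)" by (rule compact_imp_bounded[OF compact_continuous_image[OF assms cpt]])
  then obtain B where "\<And>x. \<bar>u x\<bar> \<le> B" unfolding bounded_iff by auto
  moreover have "u \<in> borel_measurable N"
    using borel_measurable_continuous_onI[OF assms] by (simp add: measurable_def space_N sets_N)
  ultimately show ?thesis by (intro prob_N.integrable_const_bound[where B = B]) auto
qed

text \<open>A layer-cake estimate. The function \<open>n * u\<close> is the sum of the slices
  \<open>w i\<close>, each a test function for the level set where \<open>n * u > i\<close>, so
  \<open>L (w i)\<close> is at most the measure of that set. Counting the levels below a point costs
  at most \<open>n * u + 1\<close>, and the surplus 1 disappears after division by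
  \<open>n\<close>.\<close>

lemma L_le_integral:
  assumes u: "continuous_on UNIV u" and r: "\<And>x. 0 \<le> u x \<and> u x \<le> 1"
  shows "L u \<le> (\<integral>x. u x \<partial>N)"
proof -
  have main: "real n * L u \<le> real n * (\<integral>x. u x \<partial>N) + 1" for n
  proof -
    define w where "w i x = min 1 (max 0 (real n * u x - real i))" for i x
    have wc: "continuous_on UNIV (w i)" for i unfolding w_def using u by (intro continuous_intros)
    have sum_w: "(\<Sum>i<m. min 1 (max 0 (t - real i))) = min (real m) t" if "t \<ge> 0" for m and t :: real
      using that by (induction m) (auto simp: min_def max_def)
    have "real n * u x \<le> real n" for x using r[of x] by (simp add: mult_left_le)
    then have "(\<lambda>x. \<Sum>i<n. w i x) = (\<lambda>x. real n * u x)"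
      unfolding w_def using r by (subst sum_w) (auto simp: min_absorb2)
    then have "real n * L u = (\<Sum>i<n. L (w i))"
      using L_cmult[OF u, of "real n"] L_sum[of "{..<n}" w] wc by simp
    also have "\<dots> \<le> (\<Sum>i<n. measure N {x. real n * u x > real i})"
    proof (rule sum_mono)
      fix i assume "i \<in> {..<n}"
      let ?S = "{x. real n * u x > real i}"
      have o: "open ?S" using u by (intro open_Collect_less continuous_intros)
      have "w i \<in> test ?S" using wc by (auto simp: test_def w_def)
      from nu_upper[OF this] have "ennreal (L (w i)) \<le> emeasure N ?S"
        using o by (simp add: emeasure_N outer_open)
      then show "L (w i) \<le> measure N ?S" by (simp add: prob_N.emeasure_eq_measure)
    qed
    also have "\<dots> = (\<Sum>i<n. \<integral>x. indicator {x. real n * u x > real i} x \<partial>N)"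
      by (simp add: space_N)
    also have "\<dots> = (\<integral>x. (\<Sum>i<n. indicator {x. real n * u x > real i} x) \<partial>N)"
    proof (rule Bochner_Integration.integral_sum[symmetric])
      fix i assume "i \<in> {..<n}"
      have o: "open {x. real n * u x > real i}" using u by (intro open_Collect_less continuous_intros)
      then show "integrable N (indicator {x. real n * u x > real i} :: 'a \<Rightarrow> real)"
        by (intro integrable_real_indicator) (auto simp: sets_N prob_N.emeasure_eq_measure)
    qed
    also have "\<dots> \<le> (\<integral>x. real n * u x + 1 \<partial>N)"
    proof (rule integral_mono)
      show "integrable N (\<lambda>x. \<Sum>i<n. indicator {x. real n * u x > real i} x :: real)"
      proof (rule Bochner_Integration.integrable_sum)
        fix i assume "i \<in> {..<n}"
        have o: "open {x. real n * u x > real i}" using u by (intro open_Collect_less continuous_intros)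
        then show "integrable N (indicator {x. real n * u x > real i} :: 'a \<Rightarrow> real)"
          by (intro integrable_real_indicator) (auto simp: sets_N prob_N.emeasure_eq_measure)
      qed
      show "integrable N (\<lambda>x. real n * u x + 1)" using integrable_N[OF u] by simp
      have count: "(\<Sum>i<m. if t > real i then 1 else 0) \<le> min (real m) (t + 1)" if "t \<ge> 0" for m and t :: real
        using that by (induction m) (auto simp: min_def split: if_splits)
      fix x
      have "(\<Sum>i<n. indicator {x. real n * u x > real i} x) = (\<Sum>i<n. if real n * u x > real i then 1 else 0 :: real)"
        by (rule sum.cong) auto
      also have "\<dots> \<le> min (real n) (real n * u x + 1)" using r by (intro count) auto
      finally show "(\<Sum>i<n. indicator {x. real n * u x > real i} x) \<le> real n * u x + 1" by simp
    qed
    also have "\<dots> = real n * (\<integral>x. u x \<partial>N) + 1"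
      using integrable_N[OF u] prob_N.prob_space by simp
    finally show ?thesis .
  qed
  show ?thesis
  proof (rule ccontr)
    assume "\<not> ?thesis"
    then have "0 < L u - (\<integral>x. u x \<partial>N)" by simp
    then obtain n where "1 < real n * (L u - (\<integral>x. u x \<partial>N))" using reals_Archimedean3 by blast
    then show False using main[of n] by (simp add: algebra_simps)
  qed
qed

text \<open>For values in the unit interval the reverse inequality is the previous lemma applied to
  \<open>1 - w\<close>; an affine rescaling reduces every continuous function to this case.\<close>

lemma L_eq_integral:
  assumes u: "continuous_on UNIV u"
  shows "L u = (\<integral>x. u x \<partial>N)"
proof -
  have unit: "L w = (\<integral>x. w x \<partial>N)" if w: "continuous_on UNIV w" "\<And>x. 0 \<le> w x \<and> w x \<le> 1" for w
  proof (rule antisym)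
    show "L w \<le> (\<integral>x. w x \<partial>N)" by (rule L_le_integral[OF w])
    have c: "continuous_on UNIV (\<lambda>x. 1 - w x)" using w by (intro continuous_intros)
    have "L (\<lambda>x. 1 - w x) \<le> (\<integral>x. 1 - w x \<partial>N)" using w c by (intro L_le_integral) auto
    moreover have "L (\<lambda>x. (1 - w x) + w x) = L (\<lambda>x. 1 - w x) + L w" using w c by (intro L_add)
    moreover have "(\<integral>x. 1 - w x \<partial>N) = 1 - (\<integral>x. w x \<partial>N)"
      using integrable_N[OF w(1)] prob_N.prob_space by simp
    ultimately show "(\<integral>x. w x \<partial>N) \<le> L w" using L_one by simp
  qed
  have "bounded (u ` UNIV)" by (rule compact_imp_bounded[OF compact_continuous_image[OF u cpt]])
  then obtain B where B: "B > 0" "\<And>x. \<bar>u x\<bar> \<le> B" unfolding bounded_pos by auto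
  define w where "w x = (u x + B) / (2 * B)" for x
  have wc: "continuous_on UNIV w" unfolding w_def using u B by (intro continuous_intros) auto
  have wr: "0 \<le> w x \<and> w x \<le> 1" for x using B(1) B(2)[of x] by (auto simp: w_def field_simps abs_le_iff)
  have uw: "u = (\<lambda>x. 2 * B * w x + (- B))" using B by (auto simp: w_def fun_eq_iff)
  have "L u = 2 * B * L w + (- B)"
    unfolding uw using L_add[of "\<lambda>x. 2 * B * w x" "\<lambda>x. - B"] L_cmult[OF wc] L_const wc
    by (auto simp: continuous_on_mult_left)
  also have "\<dots> = (\<integral>x. u x \<partial>N)"
    unfolding uw using integrable_N[OF wc] prob_N.prob_space by (simp add: unit[OF wc wr])
  finally show ?thesis .
qed

end

text \<open>\<open>V u\<close> collects admissible upper bounds for the integral of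
  \<open>u\<close>. Closure under sums and positive multiples makes \<open>Inf (V u)\<close>
  sublinear, and \<open>lower\<close> with \<open>upper\<close> keeps it finite. Since every
  constant above \<open>u\<close> is admissible, a linear functional below this infimum is positive
  and has mass 1. The lemma is the common source of Haar measure and of the measures for disc
  homomorphisms.\<close>

lemma regular_prob_below_upper_bounds:
  fixes V :: "('a::t2_space \<Rightarrow> real) \<Rightarrow> real set"
  assumes cpt: "compact (UNIV :: 'a set)"
    and lower: "\<And>u v c. v \<in> V u \<Longrightarrow> (\<And>x. c \<le> u x) \<Longrightarrow> c \<le> v"
    and upper: "\<And>u v. (\<And>x. u x \<le> v) \<Longrightarrow> v \<in> V u"
    and add: "\<And>u u' v v'. v \<in> V u \<Longrightarrow> v' \<in> V u' \<Longrightarrow> v + v' \<in> V (\<lambda>x. u x + u' x)"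
    and scale: "\<And>c u v. c > 0 \<Longrightarrow> v \<in> V u \<Longrightarrow> c * v \<in> V (\<lambda>x. c * u x)"
  obtains N where "regular_prob N" "\<And>u v. continuous_on UNIV u \<Longrightarrow> v \<in> V u \<Longrightarrow> (\<integral>x. u x \<partial>N) \<le> v"
proof -
  define q where "q u = Inf (V u)" for u
  have bounds: "bdd_below (V u)" "V u \<noteq> {}" if u: "continuous_on UNIV u" for u
  proof -
    obtain B where B: "B > 0" "\<And>x. norm (u x) \<le> B" using compact_continuous_bounded[OF cpt u] by blast
    show "bdd_below (V u)" by (rule bdd_belowI[of _ "- B"], erule lower) (use B(2) in \<open>simp add: abs_le_iff minus_le_iff\<close>)
    have "B \<in> V u" by (rule upper) (use B(2) in \<open>simp add: abs_le_iff\<close>)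
    then show "V u \<noteq> {}" by blast
  qed
  have q_le: "q u \<le> v" if "continuous_on UNIV u" "v \<in> V u" for u v
    unfolding q_def using bounds that by (intro cInf_lower)
  have q_ge: "c \<le> q u" if "continuous_on UNIV u" "\<And>v. v \<in> V u \<Longrightarrow> c \<le> v" for u c
    unfolding q_def using bounds that by (intro cInf_greatest)
  have sub: "q (\<lambda>x. u x + v x) \<le> q u + q v" if u: "continuous_on UNIV u" and v: "continuous_on UNIV v" for u v
  proof -
    have c: "continuous_on UNIV (\<lambda>x. u x + v x)" using u v by (rule continuous_on_add)
    have "q (\<lambda>x. u x + v x) - d \<le> q u" if d: "d \<in> V v" for d
    proof (rule q_ge[OF u])
      fix c assume "c \<in> V u"
      from q_le[OF c add[OF this d]] show "q (\<lambda>x. u x + v x) - d \<le> c" by simp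
    qed
    then have "q (\<lambda>x. u x + v x) - q u \<le> q v" by (intro q_ge[OF v]) (simp add: algebra_simps)
    then show ?thesis by simp
  qed
  have hom: "q (\<lambda>x. c * u x) \<le> c * q u" if c: "c > 0" and u: "continuous_on UNIV u" for c u
  proof -
    have cu: "continuous_on UNIV (\<lambda>x. c * u x)" using u by (rule continuous_on_mult_left)
    have "q (\<lambda>x. c * u x) / c \<le> q u"
    proof (rule q_ge[OF u])
      fix d assume "d \<in> V u"
      from q_le[OF cu scale[OF c this]] show "q (\<lambda>x. c * u x) / c \<le> d" using c by (simp add: field_simps)
    qed
    then show ?thesis using c by (simp add: field_simps)
  qed
  obtain L where L: "\<And>u v. continuous_on UNIV u \<Longrightarrow> continuous_on UNIV v \<Longrightarrow> L (\<lambda>x. u x + v x) = L u + L v"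
    "\<And>c u. continuous_on UNIV u \<Longrightarrow> L (\<lambda>x. c * u x) = c * L u"
    "\<And>u. continuous_on UNIV u \<Longrightarrow> L u \<le> q u"
    using hahn_banach_continuous[of q, OF cpt sub hom] by blast
  have bd: "L u \<le> c" if u: "continuous_on UNIV u" and c: "\<And>x. u x \<le> c" for u c
    using L(3)[OF u] q_le[OF u upper[OF c]] by simp
  interpret positive_functional L
  proof
    show "L u \<le> L v" if "continuous_on UNIV u" "continuous_on UNIV v" "\<And>x. u x \<le> v x" for u v
    proof -
      have "L (\<lambda>x. u x + (- 1) * v x) = L u + (- 1) * L v"
        using L(1)[of u "\<lambda>x. (- 1) * v x"] L(2)[of v "- 1"] that by (auto intro!: continuous_intros)
      moreover have "L (\<lambda>x. u x + (- 1) * v x) \<le> 0"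
        using that by (intro bd) (auto intro!: continuous_intros)
      ultimately show ?thesis by simp
    qed
    have "L (\<lambda>x. 1) \<le> 1" "L (\<lambda>x. (- 1) * 1) \<le> - 1" by (auto intro!: bd)
    then show "L (\<lambda>x. 1) = 1" using L(2)[of "\<lambda>x. 1" "- 1"] by simp
  qed (use cpt L in auto)
  show ?thesis
  proof (rule that[OF regular_prob_N])
    fix u v assume u: "continuous_on UNIV u" and v: "v \<in> V u"
    show "(\<integral>x. u x \<partial>N) \<le> v" using L(3)[OF u] q_le[OF u v] L_eq_integral[OF u] by simp
  qed
qed

section \<open>Haar measure\<close>

locale regular_prob_space =
  fixes N :: "'a::t2_space measure"
  assumes cpt: "compact (UNIV :: 'a set)" and reg: "regular_prob N"
begin

sublocale prob_space N using reg by (simp add: regular_prob_def)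

lemma sets_N: "sets N = sets borel" using reg by (simp add: regular_prob_def)

lemma space_N: "space N = UNIV" using sets_eq_imp_space_eq[OF sets_N] by simp

lemma measurable_N: "continuous_on UNIV f \<Longrightarrow> f \<in> borel_measurable N"
  for f :: "'a \<Rightarrow> 'b::topological_space"
  using borel_measurable_continuous_onI[of f] by (simp add: measurable_def space_N sets_N)

lemma integrable_continuous: "continuous_on UNIV f \<Longrightarrow> integrable N f"
  for f :: "'a \<Rightarrow> 'b::{banach, second_countable_topology}"
  by (rule compact_continuous_bounded[OF cpt, of f])
     (auto intro!: integrable_const_bound measurable_N)

lemma norm_integral_le:
  fixes f :: "'a \<Rightarrow> 'b::{banach, second_countable_topology}"
  assumes f: "continuous_on UNIV f" and "\<And>x. norm (f x) \<le> B"
  shows "norm (\<integral>x. f x \<partial>N) \<le> B"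
proof -
  have "norm (\<integral>x. f x \<partial>N) \<le> (\<integral>x. norm (f x) \<partial>N)" by simp
  also have "\<dots> \<le> (\<integral>x. B \<partial>N)"
    using assms by (intro integral_mono integrable_continuous continuous_on_norm) auto
  finally show ?thesis using prob_space by simp
qed

lemma norm_integral_diff_le:
  fixes f g :: "'a \<Rightarrow> 'b::{banach, second_countable_topology}"
  assumes "continuous_on UNIV f" "continuous_on UNIV g" "\<And>x. norm (f x - g x) \<le> B"
  shows "norm ((\<integral>x. f x \<partial>N) - (\<integral>x. g x \<partial>N)) \<le> B"
  using norm_integral_le[of "\<lambda>x. f x - g x" B] assms
  by (simp add: integrable_continuous continuous_on_diff)

lemma integral_uniform_limit:
  fixes f :: "nat \<Rightarrow> 'a \<Rightarrow> complex"
  assumes f: "\<And>n. continuous_on UNIV (f n)" and lim: "uniform_limit UNIV f g sequentially"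
  shows "(\<lambda>n. \<integral>x. f n x \<partial>N) \<longlonglongrightarrow> (\<integral>x. g x \<partial>N)"
proof (rule LIMSEQ_I)
  fix e :: real assume e: "e > 0"
  have g: "continuous_on UNIV g" by (rule uniform_limit_theorem[OF _ lim]) (use f in auto)
  have "\<forall>\<^sub>F n in sequentially. \<forall>x\<in>UNIV. dist (f n x) (g x) < e / 2"
    using lim e by (intro uniform_limitD) auto
  then obtain M where M: "\<And>n x. n \<ge> M \<Longrightarrow> dist (f n x) (g x) < e / 2"
    unfolding eventually_sequentially by blast
  have "norm ((\<integral>x. f n x \<partial>N) - (\<integral>x. g x \<partial>N)) \<le> e / 2" if "n \<ge> M" for n
    using M[OF that] by (intro norm_integral_diff_le f g less_imp_le) (auto simp: dist_norm)
  then show "\<exists>M. \<forall>n\<ge>M. norm ((\<integral>x. f n x \<partial>N) - (\<integral>x. g x \<partial>N)) < e"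
    using e by (intro exI[of _ M]) (auto intro: le_less_trans[of _ "e / 2"])
qed

end

text \<open>The set of \<open>((x, y), z)\<close> where \<open>F x (y + z)\<close> is within
  \<open>e\<close> of \<open>F x y\<close> is open and contains the compact slice
  \<open>z = 0\<close>; the tube lemma gives one neighbourhood of 0 that serves all \<open>x\<close>
  and \<open>y\<close>.\<close>

lemma uniformly_continuous_compact_group:
  fixes F :: "'x::topological_space \<Rightarrow> 'a::topological_ab_group_add \<Rightarrow> 'b::metric_space"
  assumes "compact (UNIV :: 'x set)" "compact (UNIV :: 'a set)"
    and F: "continuous_on UNIV (\<lambda>(x, y). F x y)" and e: "e > 0"
  obtains U where "open U" "0 \<in> U" "\<forall>x y y'. y - y' \<in> U \<longrightarrow> dist (F x y) (F x y') < e"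
proof -
  let ?W = "{p :: ('x \<times> 'a) \<times> 'a. dist (F (fst (fst p)) (snd (fst p) + snd p)) (F (fst (fst p)) (snd (fst p))) < e}"
  have F': "continuous_on S (\<lambda>z. F (f z) (g z))" if "continuous_on S f" "continuous_on S g"
    for S :: "'c::topological_space set" and f g
    using continuous_on_compose2[OF F continuous_on_Pair[OF that]] by simp
  have "open ?W"
    by (intro open_Collect_less continuous_on_dist F' continuous_intros)
  then have oW: "openin (prod_topology euclidean euclidean) ?W"
    by (simp add: open_openin[symmetric] euclidean_product_topology)
  have "compactin euclidean (UNIV :: ('x \<times> 'a) set)"
    using compact_Times[OF assms(1,2)] by simp
  moreover have "UNIV \<times> {0} \<subseteq> ?W" using e by auto
  ultimately obtain U' U where
    U: "open U" "UNIV \<subseteq> U'" "0 \<in> U" "U' \<times> U \<subseteq> ?W"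
    using tube_lemma_left[OF oW, of UNIV 0] by (auto simp: open_openin[symmetric])
  show ?thesis
  proof (rule that[OF U(1,3)], intro allI impI)
    fix x y y' assume "y - y' \<in> U"
    then have "((x, y'), y - y') \<in> ?W" using U by blast
    then show "dist (F x y) (F x y') < e" by simp
  qed
qed

lemma uniformly_continuous_compact_group1:
  fixes f :: "'a::topological_ab_group_add \<Rightarrow> 'b::metric_space"
  assumes "compact (UNIV :: 'a set)" and f: "continuous_on UNIV f" and e: "e > 0"
  obtains U where "open U" "0 \<in> U" "\<forall>y y'. y - y' \<in> U \<longrightarrow> dist (f y) (f y') < e"
proof -
  have "continuous_on UNIV (\<lambda>(x::'a, y). f y)"
    unfolding case_prod_beta' by (rule continuous_on_compose2[OF f continuous_on_snd[OF continuous_on_id]]) auto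
  then obtain U where "open U" "0 \<in> U" "\<forall>(x :: 'a) y y'. y - y' \<in> U \<longrightarrow> dist (f y) (f y') < e"
    by (rule uniformly_continuous_compact_group[OF assms(1,1) _ e])
  then show ?thesis using that by blast
qed

lemma continuous_from_uniform:
  fixes m :: "'a::topological_ab_group_add \<Rightarrow> 'b::metric_space"
  assumes "\<And>e. e > 0 \<Longrightarrow> \<exists>U. open U \<and> 0 \<in> U \<and> (\<forall>x x'. x - x' \<in> U \<longrightarrow> dist (m x) (m x') \<le> e)"
  shows "continuous_on UNIV m"
  unfolding continuous_on_def
proof (intro ballI tendstoI)
  fix x and e :: real assume e: "0 < e"
  obtain U where U: "open U" "0 \<in> U" "\<And>x x'. x - x' \<in> U \<Longrightarrow> dist (m x) (m x') \<le> e / 2"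
    using assms[of "e / 2"] e by auto
  have "open ((\<lambda>x'. x' - x) -` U)" by (intro open_vimage U continuous_intros)
  moreover have "x \<in> (\<lambda>x'. x' - x) -` U" using U by simp
  moreover have "dist (m x') (m x) < e" if "x' \<in> (\<lambda>x'. x' - x) -` U" for x'
    using U(3)[of x' x] that e by simp
  ultimately show "\<forall>\<^sub>F x' in at x within UNIV. dist (m x') (m x) < e"
    unfolding eventually_at_topological by blast
qed

lemma continuous_on_swap_args:
  assumes "continuous_on UNIV (\<lambda>(x, y). F x y)"
  shows "continuous_on UNIV (\<lambda>(y, x). F x y)"
proof -
  have "continuous_on UNIV (\<lambda>p. (\<lambda>(x, y). F x y) (snd p, fst p))"
    by (rule continuous_on_compose2[OF assms]) (auto intro!: continuous_intros)
  then show ?thesis by (simp add: case_prod_beta')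
qed

lemma continuous_on_slice:
  assumes "continuous_on UNIV (\<lambda>(x, y). F x y)"
  shows "continuous_on UNIV (F x)" "continuous_on UNIV (\<lambda>x. F x y)"
proof -
  have "continuous_on UNIV (\<lambda>y. (\<lambda>(x, y). F x y) (x, y))"
    by (rule continuous_on_compose2[OF assms]) (auto intro!: continuous_intros)
  then show "continuous_on UNIV (F x)" by simp
  have "continuous_on UNIV (\<lambda>x. (\<lambda>(x, y). F x y) (x, y))"
    by (rule continuous_on_compose2[OF assms]) (auto intro!: continuous_intros)
  then show "continuous_on UNIV (\<lambda>x. F x y)" by simp
qed

section \<open>Riemann sums and interchange of integrals\<close>

locale group_prob = regular_prob_space N for N :: "'a::{topological_ab_group_add, t2_space} measure"
begin

text \<open>Finitely many translates of \<open>U\<close> cover the group; they are made disjoint,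
  their measures are the weights and the translating points are the nodes. Weights and nodes depend
  on \<open>U\<close> alone, so one sum approximates a whole family of integrands with a common
  modulus. This uniformity is what the later uses need.\<close>

lemma quadrature:
  assumes U: "open U" "0 \<in> U"
  obtains n :: nat and p w where "\<And>i. 0 \<le> w i" "(\<Sum>i<n. w i) = 1"
    "\<forall>(u :: 'a \<Rightarrow> complex) e. continuous_on UNIV u \<longrightarrow> (\<forall>y y'. y - y' \<in> U \<longrightarrow> dist (u y) (u y') \<le> e) \<longrightarrow>
        norm ((\<integral>x. u x \<partial>N) - (\<Sum>i<n. complex_of_real (w i) * u (p i))) \<le> e"
proof -
  have oU: "open {x. x - t \<in> U}" for t
    using open_vimage[OF U(1), of "\<lambda>x. x - t"] by (simp add: vimage_def continuous_intros)
  have "UNIV \<subseteq> (\<Union>t\<in>UNIV. {x. x - t \<in> U})" using U by (auto intro: exI[of _ "x" for x])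
  from compactE_image[OF cpt oU this] obtain T where
    T: "finite T" "UNIV \<subseteq> (\<Union>t\<in>T. {x. x - t \<in> U})" by metis
  obtain p :: "nat \<Rightarrow> 'a" and n where p: "T = p ` {..<n}"
    using finite_imp_nat_seg_image_inj_on[OF T(1)] by (auto simp: lessThan_def)
  define A where "A i = {x. x - p i \<in> U}" for i
  define D where "D = disjointed A"
  define w where "w i = measure N (D i)" for i
  have AN: "range A \<subseteq> sets N" using oU by (auto simp: A_def sets_N)
  then have DN: "D i \<in> sets N" for i unfolding D_def using sets.range_disjointed_sets by blast
  have DA: "D i \<subseteq> A i" for i unfolding D_def by (rule disjointed_subset)
  have dj: "disjoint_family D" unfolding D_def by (rule disjoint_family_disjointed)
  have cov: "\<exists>i<n. x \<in> D i" for x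
  proof -
    have "x \<in> (\<Union>i\<in>{0..<n}. A i)" using T(2) unfolding p A_def by (force simp: lessThan_atLeast0)
    also have "\<dots> = (\<Union>i\<in>{0..<n}. D i)" unfolding D_def by (rule finite_UN_disjointed_eq[symmetric])
    finally show ?thesis by auto
  qed
  have one: "(\<Sum>i<n. indicator (D i) x *\<^sub>R c i) = c j" if "j < n" "x \<in> D j"
    for x j and c :: "nat \<Rightarrow> complex"
  proof -
    have "indicator (D i) x *\<^sub>R c i = (if i = j then c j else 0)" for i
      using dj that unfolding disjoint_family_on_def by (cases "i = j") (auto simp: indicator_def)
    then show ?thesis using that by simp
  qed
  have ii: "integrable N (\<lambda>x. indicator (D i) x *\<^sub>R c)" for i and c :: complex
    using DN[of i] by (intro integrable_scaleR_left integrable_real_indicator) (auto simp: emeasure_eq_measure)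
  have Iq: "(\<integral>x. (\<Sum>i<n. indicator (D i) x *\<^sub>R c i) \<partial>N) = (\<Sum>i<n. complex_of_real (w i) * c i)" for c
    by (subst Bochner_Integration.integral_sum[OF ii])
       (simp add: w_def scaleR_conv_of_real emeasure_eq_measure space_N)
  show ?thesis
  proof (rule that[of w n p])
    show "0 \<le> w i" for i by (simp add: w_def)
    have "(\<Sum>i<n. indicator (D i) x *\<^sub>R (1::complex)) = 1" for x
    proof -
      obtain j where "j < n" "x \<in> D j" using cov by blast
      from one[OF this, of "\<lambda>_. 1"] show ?thesis .
    qed
    then have "(\<Sum>i<n. complex_of_real (w i)) = 1" using Iq[of "\<lambda>_. 1"] by (simp add: prob_space)
    then show "(\<Sum>i<n. w i) = 1" by (simp flip: of_real_sum)
    show "\<forall>(u :: 'a \<Rightarrow> complex) e. continuous_on UNIV u \<longrightarrow> (\<forall>y y'. y - y' \<in> U \<longrightarrow> dist (u y) (u y') \<le> e) \<longrightarrow>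
        norm ((\<integral>x. u x \<partial>N) - (\<Sum>i<n. complex_of_real (w i) * u (p i))) \<le> e"
    proof (intro allI impI)
      fix u :: "'a \<Rightarrow> complex" and e
      assume u: "continuous_on UNIV u" and ue: "\<forall>y y'. y - y' \<in> U \<longrightarrow> dist (u y) (u y') \<le> e"
      let ?s = "\<lambda>x. \<Sum>i<n. indicator (D i) x *\<^sub>R u (p i)"
      have si: "integrable N ?s" by (intro Bochner_Integration.integrable_sum ii)
      have close: "norm (u x - ?s x) \<le> e" for x
      proof -
        obtain j where j: "j < n" "x \<in> D j" using cov by blast
        have "?s x = u (p j)" by (rule one[OF j])
        moreover have "x - p j \<in> U" using j DA[of j] by (auto simp: A_def)
        ultimately show ?thesis using ue by (simp add: dist_norm)
      qed
      have "norm ((\<integral>x. u x \<partial>N) - (\<Sum>i<n. complex_of_real (w i) * u (p i))) = norm (\<integral>x. u x - ?s x \<partial>N)"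
        using si integrable_continuous[OF u] by (simp only: Iq Bochner_Integration.integral_diff)
      also have "\<dots> \<le> (\<integral>x. norm (u x - ?s x) \<partial>N)" by simp
      also have "\<dots> \<le> (\<integral>x. e \<partial>N)" using si integrable_continuous[OF u] close
        by (intro integral_mono integrable_norm Bochner_Integration.integrable_diff) auto
      finally show "norm ((\<integral>x. u x \<partial>N) - (\<Sum>i<n. complex_of_real (w i) * u (p i))) \<le> e"
        by (simp add: prob_space)
    qed
  qed
qed

lemma continuous_parameter_integral:
  fixes F :: "'a \<Rightarrow> 'a \<Rightarrow> complex"
  assumes F: "continuous_on UNIV (\<lambda>(y, x). F x y)"
  shows "continuous_on UNIV (\<lambda>x. \<integral>y. F x y \<partial>N)"
proof (rule continuous_from_uniform)
  fix e :: real assume e: "e > 0"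
  obtain U where U: "open U" "0 \<in> U" "\<forall>x y y'. y - y' \<in> U \<longrightarrow> dist (F y x) (F y' x) < e"
    by (rule uniformly_continuous_compact_group[OF cpt cpt F e])
  have c: "continuous_on UNIV (F x)" for x by (rule continuous_on_slice(2)[OF F])
  have "dist (\<integral>y. F x y \<partial>N) (\<integral>y. F x' y \<partial>N) \<le> e" if "x - x' \<in> U" for x x'
    unfolding dist_norm using U(3) that by (intro norm_integral_diff_le c) (auto simp: dist_norm less_imp_le)
  then show "\<exists>U. open U \<and> 0 \<in> U \<and> (\<forall>x x'. x - x' \<in> U \<longrightarrow> dist (\<integral>y. F x y \<partial>N) (\<integral>y. F x' y \<partial>N) \<le> e)"
    using U by blast
qed

end

text \<open>A jointly continuous function need not be measurable for the product of the Borel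
  \<sigma>-algebras when the group is large. The integral in \<open>y\<close> is instead replaced by
  a Riemann sum, uniformly in \<open>x\<close>; for a finite sum the interchange is
  linearity.\<close>

lemma fubini_continuous:
  fixes F :: "'a::{topological_ab_group_add, t2_space} \<Rightarrow> 'a \<Rightarrow> complex"
  assumes "group_prob M" "group_prob N" and F: "continuous_on UNIV (\<lambda>(x, y). F x y)"
  shows "(\<integral>x. (\<integral>y. F x y \<partial>N) \<partial>M) = (\<integral>y. (\<integral>x. F x y \<partial>M) \<partial>N)"
proof -
  interpret M: group_prob M by fact
  interpret N: group_prob N by fact
  let ?l = "\<lambda>x. \<integral>y. F x y \<partial>N" and ?m = "\<lambda>y. \<integral>x. F x y \<partial>M"
  have lc: "continuous_on UNIV ?l" using F by (intro N.continuous_parameter_integral) (rule continuous_on_swap_args)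
  have mc: "continuous_on UNIV ?m" using F by (rule M.continuous_parameter_integral)
  have "norm ((\<integral>x. ?l x \<partial>M) - (\<integral>y. ?m y \<partial>N)) \<le> 0"
  proof (rule field_le_epsilon)
    fix e :: real assume "e > 0"
    then have e: "e / 2 > 0" by simp
    obtain U where U: "open U" "0 \<in> U" "\<forall>x y y'. y - y' \<in> U \<longrightarrow> dist (F x y) (F x y') < e / 2"
      by (rule uniformly_continuous_compact_group[OF M.cpt M.cpt F e])
    obtain n :: nat and p w where q': "\<forall>(u :: 'a \<Rightarrow> complex) e. continuous_on UNIV u \<longrightarrow>
        (\<forall>y y'. y - y' \<in> U \<longrightarrow> dist (u y) (u y') \<le> e) \<longrightarrow>
        norm ((\<integral>x. u x \<partial>N) - (\<Sum>i<n. complex_of_real (w i) * u (p i))) \<le> e"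
      by (rule N.quadrature[OF U(1,2)])
    have q: "norm ((\<integral>x. u x \<partial>N) - (\<Sum>i<n. complex_of_real (w i) * u (p i))) \<le> e"
      if "continuous_on UNIV u" "\<And>y y'. y - y' \<in> U \<Longrightarrow> dist (u y) (u y') \<le> e" for u e
      using q' that by blast
    have 1: "norm (?l x - (\<Sum>i<n. complex_of_real (w i) * F x (p i))) \<le> e / 2" for x
      using U(3) by (intro q[OF continuous_on_slice(1)[OF F]] less_imp_le) auto
    have 2: "norm ((\<integral>x. ?l x \<partial>M) - (\<integral>x. (\<Sum>i<n. complex_of_real (w i) * F x (p i)) \<partial>M)) \<le> e / 2"
      using 1 by (intro M.norm_integral_diff_le[OF lc] continuous_on_sum continuous_on_mult_left
        continuous_on_slice(2)[OF F])
    have "(\<integral>x. (\<Sum>i<n. complex_of_real (w i) * F x (p i)) \<partial>M) =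
        (\<Sum>i<n. \<integral>x. complex_of_real (w i) * F x (p i) \<partial>M)"
      by (rule Bochner_Integration.integral_sum)
         (rule M.integrable_continuous[OF continuous_on_mult_left[OF continuous_on_slice(2)[OF F]]])
    then have 3: "(\<integral>x. (\<Sum>i<n. complex_of_real (w i) * F x (p i)) \<partial>M) = (\<Sum>i<n. complex_of_real (w i) * ?m (p i))"
      by simp
    \<comment> \<open>Integration over \<open>M\<close> preserves the modulus of continuity in
      \<open>y\<close>, so the same weights and nodes serve \<open>?m\<close>.\<close>
    have 4: "norm ((\<integral>y. ?m y \<partial>N) - (\<Sum>i<n. complex_of_real (w i) * ?m (p i))) \<le> e / 2"
    proof (rule q[OF mc])
      fix y y' assume y: "y - y' \<in> U"
      show "dist (?m y) (?m y') \<le> e / 2" unfolding dist_norm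
        using U(3) y
        by (intro M.norm_integral_diff_le[OF continuous_on_slice(2)[OF F] continuous_on_slice(2)[OF F]])
           (auto simp: dist_norm less_imp_le)
    qed
    from norm_triangle_ineq4[of "(\<integral>x. ?l x \<partial>M) - (\<Sum>i<n. complex_of_real (w i) * ?m (p i))"
        "(\<integral>y. ?m y \<partial>N) - (\<Sum>i<n. complex_of_real (w i) * ?m (p i))"]
    show "norm ((\<integral>x. ?l x \<partial>M) - (\<integral>y. ?m y \<partial>N)) \<le> 0 + e" using 2 4 unfolding 3 by simp
  qed
  then show ?thesis by simp
qed

text \<open>\<open>S u\<close> consists of the numbers that dominate some finite average of
  translates of \<open>u\<close> everywhere. Averages are indexed by sets of naturals, which permits
  repeated translates. The dominated measure is not invariant by construction; invariance follows
  because averages of \<open>u (x + t) - u x\<close> can be made arbitrarily small.\<close>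

lemma invariant_mean_exists:
  assumes cpt: "compact (UNIV :: 'a::{topological_ab_group_add, t2_space} set)"
  obtains H :: "'a::{topological_ab_group_add, t2_space} measure" where "regular_prob H"
    "\<And>(u :: 'a \<Rightarrow> real) t. continuous_on UNIV u \<Longrightarrow> (\<integral>x. u (x + t) \<partial>H) = (\<integral>x. u x \<partial>H)"
proof -
  define S where "S u = {c::real. \<exists>(I::nat set) a. finite I \<and> I \<noteq> {} \<and>
      (\<forall>x::'a. (\<Sum>i\<in>I. u (x + a i)) \<le> real (card I) * c)}" for u :: "'a \<Rightarrow> real"
  have S_lower: "c \<le> v" if v: "v \<in> S u" and c: "\<And>x. c \<le> u x" for c v u
  proof -
    obtain I :: "nat set" and a where I: "finite I" "I \<noteq> {}"
      "(\<Sum>i\<in>I. u (0 + a i)) \<le> real (card I) * v" using v unfolding S_def by blast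
    have "real (card I) * c \<le> (\<Sum>i\<in>I. u (0 + a i))" using c by (intro sum_bounded_below) auto
    then have "real (card I) * c \<le> real (card I) * v" using I by simp
    moreover have "real (card I) > 0" using I by (simp add: card_gt_0_iff)
    ultimately show ?thesis by (metis mult_le_cancel_left_pos)
  qed
  have S_upper: "c \<in> S u" if "\<And>x. u x \<le> c" for u c
    unfolding S_def using that by (intro CollectI exI[of _ "{0}"] exI[of _ "\<lambda>_. 0"]) auto
  have S_add: "c + d \<in> S (\<lambda>x. u x + v x)" if c: "c \<in> S u" and d: "d \<in> S v" for c d u v
  proof -
    obtain I :: "nat set" and a where I: "finite I" "I \<noteq> {}"
      "\<And>x. (\<Sum>i\<in>I. u (x + a i)) \<le> real (card I) * c" using c by (auto simp: S_def)
    obtain J :: "nat set" and b where J: "finite J" "J \<noteq> {}"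
      "\<And>x. (\<Sum>i\<in>J. v (x + b i)) \<le> real (card J) * d" using d by (auto simp: S_def)
    \<comment> \<open>All sums \<open>a i + b j\<close> are used, with multiplicity. Averaging over
      one family does not spoil a bound already obtained from the other, and commutativity lets
      either family be summed first.\<close>
    define K where "K = prod_encode ` (I \<times> J)"
    define k where "k m = (case prod_decode m of (i, j) \<Rightarrow> a i + b j)" for m
    have cK: "card K = card I * card J" unfolding K_def
      by (subst card_image) (auto simp: inj_on_def card_cartesian_product)
    have "(\<Sum>m\<in>K. u (x + k m) + v (x + k m)) \<le> real (card K) * (c + d)" for x
    proof -
      have "(\<Sum>m\<in>K. u (x + k m) + v (x + k m)) = (\<Sum>(i, j)\<in>I \<times> J. u (x + (a i + b j)) + v (x + (a i + b j)))"
        unfolding K_def by (subst sum.reindex) (auto simp: inj_on_def k_def intro!: sum.cong)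
      also have "\<dots> = (\<Sum>i\<in>I. \<Sum>j\<in>J. u (x + (a i + b j)) + v (x + (a i + b j)))"
        by (simp add: sum.cartesian_product)
      also have "\<dots> = (\<Sum>j\<in>J. \<Sum>i\<in>I. u ((x + b j) + a i)) + (\<Sum>i\<in>I. \<Sum>j\<in>J. v ((x + a i) + b j))"
        by (simp add: sum.distrib add_ac sum.swap[of _ J I])
      also have "\<dots> \<le> (\<Sum>j\<in>J. real (card I) * c) + (\<Sum>i\<in>I. real (card J) * d)"
        by (intro add_mono sum_mono I J)
      finally show ?thesis by (simp add: cK algebra_simps)
    qed
    then show ?thesis unfolding S_def using I J by (intro CollectI exI[of _ K] exI[of _ k]) (auto simp: K_def)
  qed
  have S_scale: "c * v \<in> S (\<lambda>x. c * u x)" if "c > 0" "v \<in> S u" for c v u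
    using that unfolding S_def by (auto simp: sum_distrib_left[symmetric] mult.left_commute[of _ c])
  obtain H where H: "regular_prob H"
    "\<And>u v. continuous_on UNIV u \<Longrightarrow> v \<in> S u \<Longrightarrow> (\<integral>x. u x \<partial>H) \<le> v"
  proof (rule regular_prob_below_upper_bounds[of S, OF cpt])
    show "b \<le> v" if "v \<in> S u" "\<And>x. b \<le> u x" for u v b using that by (rule S_lower)
    show "v \<in> S u" if "\<And>x. u x \<le> v" for u v using that by (rule S_upper)
    show "v + v' \<in> S (\<lambda>x. u x + u' x)" if "v \<in> S u" "v' \<in> S u'" for u u' v v' using that by (rule S_add)
    show "b * v \<in> S (\<lambda>x. b * u x)" if "b > 0" "v \<in> S u" for b u v using that by (rule S_scale)
  qed blast
  interpret regular_prob_space H using cpt H by unfold_locales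
  have le: "(\<integral>x. u (x + t) \<partial>H) \<le> (\<integral>x. u x \<partial>H)" if u: "continuous_on UNIV u" for u :: "'a \<Rightarrow> real" and t
  proof -
    obtain B where B: "B > 0" "\<And>x. norm (u x) \<le> B" using compact_continuous_bounded[OF cpt u] by blast
    have ut: "continuous_on UNIV (\<lambda>x. u (x + t))"
      by (intro continuous_on_compose2[OF u] continuous_intros) auto
    have vc: "continuous_on UNIV (\<lambda>x. u (x + t) - u x)" using u ut by (rule continuous_on_diff[rotated])
    let ?d = "(\<integral>x. u (x + t) \<partial>H) - (\<integral>x. u x \<partial>H)"
    have d: "real n * ?d \<le> 2 * B" for n
    proof (cases "n = 0")
      case False
      \<comment> \<open>The points 0, \<open>t\<close>, \<open>2 t\<close>, ... make the average of
        \<open>u (x + t) - u x\<close> telescope to at most \<open>2 * B / n\<close>.\<close>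
      define a where "a i = ((+) t ^^ i) 0" for i
      have "(\<Sum>i<n. u (x + a i + t) - u (x + a i)) \<le> real (card {..<n}) * (2 * B / real n)" for x
      proof -
        have "(\<Sum>i<n. u (x + a i + t) - u (x + a i)) = (\<Sum>i<n. u (x + a (Suc i)) - u (x + a i))"
          by (simp add: a_def add_ac)
        also have "\<dots> = u (x + a n) - u (x + a 0)" by (rule sum_lessThan_telescope)
        also have "\<dots> \<le> 2 * B" using B(2)[of "x + a n"] B(2)[of "x + a 0"] by (simp add: abs_le_iff)
        finally show ?thesis using False by simp
      qed
      then have "2 * B / real n \<in> S (\<lambda>x. u (x + t) - u x)"
        unfolding S_def using False by (intro CollectI exI[of _ "{..<n}"] exI[of _ a]) auto
      from H(2)[OF vc this] have "?d \<le> 2 * B / real n"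
        using integrable_continuous[OF u] integrable_continuous[OF ut] by simp
      then show ?thesis using False by (simp add: field_simps)
    qed (use B in simp)
    have "?d \<le> 0"
    proof (rule ccontr)
      assume "\<not> ?d \<le> 0"
      then obtain n where "2 * B < real n * ?d" using reals_Archimedean3 by (metis not_le)
      then show False using d[of n] by simp
    qed
    then show ?thesis by simp
  qed
  show ?thesis
  proof (rule that[OF H(1)], rule antisym)
    fix u :: "'a \<Rightarrow> real" and t assume u: "continuous_on UNIV u"
    show "(\<integral>x. u (x + t) \<partial>H) \<le> (\<integral>x. u x \<partial>H)" by (rule le[OF u])
    have ut: "continuous_on UNIV (\<lambda>x. u (x + t))"
      by (intro continuous_on_compose2[OF u] continuous_intros) auto
    show "(\<integral>x. u x \<partial>H) \<le> (\<integral>x. u (x + t) \<partial>H)" using le[OF ut, of "- t"] by simp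
  qed
qed

section \<open>Invariance, reflection and strict positivity of Haar measure\<close>

locale haar = group_prob H for H :: "'a::{topological_ab_group_add, t2_space} measure" +
  assumes real_invariant: "\<And>(u :: 'a \<Rightarrow> real) t. continuous_on UNIV u \<Longrightarrow> (\<integral>x. u (x + t) \<partial>H) = (\<integral>x. u x \<partial>H)"
begin

lemma continuous_translate: "continuous_on UNIV f \<Longrightarrow> continuous_on UNIV (\<lambda>x. f (x + t))"
  for f :: "'a \<Rightarrow> 'b::topological_space"
  by (erule continuous_on_compose2) (auto intro!: continuous_intros)

lemma continuous_reflect: "continuous_on UNIV f \<Longrightarrow> continuous_on UNIV (\<lambda>x. f (- x))"
  for f :: "'a \<Rightarrow> 'b::topological_space"
  by (erule continuous_on_compose2) (auto intro!: continuous_intros)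

lemma integral_Re_Im:
  assumes "continuous_on UNIV f"
  shows "(\<integral>x. f x \<partial>H) = Complex (\<integral>x. Re (f x) \<partial>H) (\<integral>x. Im (f x) \<partial>H)"
  using integral_bounded_linear[OF bounded_linear_Re integrable_continuous[OF assms]]
    integral_bounded_linear[OF bounded_linear_Im integrable_continuous[OF assms]]
  by (simp add: complex_eq_iff)

lemma invariant:
  fixes f :: "'a \<Rightarrow> complex"
  assumes f: "continuous_on UNIV f"
  shows "(\<integral>x. f (x + t) \<partial>H) = (\<integral>x. f x \<partial>H)"
  using real_invariant[of "\<lambda>x. Re (f x)" t] real_invariant[of "\<lambda>x. Im (f x)" t] f
  by (simp add: integral_Re_Im continuous_translate continuous_on_Re continuous_on_Im)

lemma fubini:
  fixes F :: "'a \<Rightarrow> 'a \<Rightarrow> complex"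
  assumes "continuous_on UNIV (\<lambda>(x, y). F x y)"
  shows "(\<integral>x. (\<integral>y. F x y \<partial>H) \<partial>H) = (\<integral>y. (\<integral>x. F x y \<partial>H) \<partial>H)"
  by (rule fubini_continuous[OF _ _ assms]) unfold_locales

text \<open>The double integral of \<open>f (x - y)\<close> equals the integral of \<open>f\<close>
  when \<open>x\<close> is integrated first and that of \<open>f (- y)\<close> when \<open>y\<close>
  is.\<close>

lemma reflect:
  fixes f :: "'a \<Rightarrow> complex"
  assumes f: "continuous_on UNIV f"
  shows "(\<integral>x. f (- x) \<partial>H) = (\<integral>x. f x \<partial>H)"
proof -
  have c: "continuous_on UNIV (\<lambda>(x, y). f (x - y))"
    unfolding case_prod_beta' by (intro continuous_on_compose2[OF f] continuous_intros) auto
  have 1: "(\<integral>y. f (x - y) \<partial>H) = (\<integral>y. f (- y) \<partial>H)" for x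
    using invariant[OF continuous_reflect[OF f], of "- x"] by (simp add: algebra_simps)
  have 2: "(\<integral>x. f (x - y) \<partial>H) = (\<integral>x. f x \<partial>H)" for y
    using invariant[OF f, of "- y"] by simp
  show ?thesis using fubini[OF c] by (simp add: 1 2 prob_space)
qed

text \<open>If \<open>u\<close> exceeds \<open>d > 0\<close> somewhere, finitely many translates of
  \<open>{y. u y > d}\<close> cover the group, so the sum of the corresponding translates of
  \<open>u\<close> is at least \<open>d\<close> everywhere although its integral vanishes.\<close>

lemma strictly_positive:
  fixes u :: "'a \<Rightarrow> real"
  assumes u: "continuous_on UNIV u" "\<And>x. 0 \<le> u x" and z: "(\<integral>x. u x \<partial>H) = 0"
  shows "u x = 0"
proof (rule ccontr)
  assume "u x \<noteq> 0"
  define d where "d = u x / 2"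
  have d: "d > 0" "u x > d" using \<open>u x \<noteq> 0\<close> u(2)[of x] by (auto simp: d_def)
  have o: "open {y. u (y + t) > d}" for t
    by (intro open_Collect_less continuous_intros continuous_translate u)
  have "y \<in> {y. u (y + (x - y)) > d}" for y using d by simp
  then have "UNIV \<subseteq> (\<Union>t\<in>UNIV. {y. u (y + t) > d})" by blast
  from compactE_image[OF cpt o this] obtain T where
    T: "finite T" "UNIV \<subseteq> (\<Union>t\<in>T. {y. u (y + t) > d})" by metis
  have "(\<integral>y. d \<partial>H) \<le> (\<integral>y. (\<Sum>t\<in>T. u (y + t)) \<partial>H)"
  proof (rule integral_mono)
    show "integrable H (\<lambda>y. \<Sum>t\<in>T. u (y + t))"
      by (intro integrable_continuous continuous_on_sum continuous_translate u)
    fix y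
    obtain t where t: "t \<in> T" "u (y + t) > d" using T(2) by auto
    have "u (y + t) \<le> (\<Sum>t\<in>T. u (y + t))" using T(1) t(1) u(2) by (intro member_le_sum) auto
    then show "d \<le> (\<Sum>t\<in>T. u (y + t))" using t by simp
  qed simp
  also have "\<dots> = (\<Sum>t\<in>T. \<integral>y. u (y + t) \<partial>H)"
    by (intro Bochner_Integration.integral_sum integrable_continuous continuous_translate u)
  also have "\<dots> = 0" using real_invariant[OF u(1)] z by simp
  finally show False using d by (simp add: prob_space)
qed

end

lemma haar_exists:
  assumes "compact (UNIV :: 'a::{topological_ab_group_add, t2_space} set)"
  obtains H :: "'a::{topological_ab_group_add, t2_space} measure" where "haar H"
proof -
  obtain H :: "'a measure" where H: "regular_prob H"
    "\<And>(u :: 'a \<Rightarrow> real) t. continuous_on UNIV u \<Longrightarrow> (\<integral>x. u (x + t) \<partial>H) = (\<integral>x. u x \<partial>H)"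
    using invariant_mean_exists[OF assms] by blast
  have "haar H" using H assms by unfold_locales auto
  then show ?thesis by (rule that)
qed

lemma continuous_on_comp: "continuous_on UNIV f \<Longrightarrow> continuous_on S g \<Longrightarrow> continuous_on S (\<lambda>x. f (g x))"
  by (rule continuous_on_compose2[of UNIV f]) auto

section \<open>Characters separate points\<close>

text \<open>The group may have no countable dense subset. Equicontinuity provides for each accuracy
  \<open>1 / (m + 1)\<close> a finite net \<open>T m\<close>, and the countable union of these nets
  takes the place of a dense sequence in the diagonal argument.\<close>

lemma arzela_ascoli_group:
  fixes f :: "nat \<Rightarrow> 'a::topological_ab_group_add \<Rightarrow> complex"
  assumes cpt: "compact (UNIV :: 'a set)" and bd: "\<And>n x. cmod (f n x) \<le> B"
    and eq: "\<And>e. e > 0 \<Longrightarrow> \<exists>U. open U \<and> 0 \<in> U \<and> (\<forall>n x x'. x - x' \<in> U \<longrightarrow> dist (f n x) (f n x') \<le> e)"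
  obtains r g where "strict_mono (r :: nat \<Rightarrow> nat)" "uniform_limit UNIV (\<lambda>n. f (r n)) g sequentially"
    "continuous_on UNIV g"
proof -
  have "\<exists>U. open U \<and> 0 \<in> U \<and> (\<forall>n x x'. x - x' \<in> U \<longrightarrow> dist (f n x) (f n x') \<le> inverse (real (Suc m)))" for m
    by (rule eq) simp
  then obtain U where U: "\<And>m. open (U m)" "\<And>m. 0 \<in> U m"
    "\<And>m n x x'. x - x' \<in> U m \<Longrightarrow> dist (f n x) (f n x') \<le> inverse (real (Suc m))" by metis
  have "\<exists>T. finite T \<and> (\<forall>x. \<exists>t\<in>T. x - t \<in> U m)" for m
  proof -
    have oU: "open {x. x - t \<in> U m}" for t
      using open_vimage[OF U(1)[of m], of "\<lambda>x. x - t"] by (simp add: vimage_def continuous_intros)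
    have "UNIV \<subseteq> (\<Union>t\<in>UNIV. {x. x - t \<in> U m})"
    proof
      fix x show "x \<in> (\<Union>t\<in>UNIV. {x. x - t \<in> U m})" using U(2)[of m] by (intro UN_I[of x]) auto
    qed
    from compactE_image[OF cpt oU this] obtain T where
      "finite T" "UNIV \<subseteq> (\<Union>t\<in>T. {x. x - t \<in> U m})" by metis
    then show ?thesis by (intro exI[of _ T]) auto
  qed
  then obtain T where T: "\<And>m. finite (T m)" "\<And>m x. \<exists>t\<in>T m. x - t \<in> U m" by metis
  have "countable (\<Union>m. T m)" using T(1) by (auto intro: countable_finite)
  then obtain r where r: "strict_mono (r :: nat \<Rightarrow> nat)" "\<And>x. x \<in> (\<Union>m. T m) \<Longrightarrow> \<exists>l. (\<lambda>n. f (r n) x) \<longlonglongrightarrow> l"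
    by (rule function_convergent_subsequence[of _ f B]) (auto simp: bd)
  have "uniformly_Cauchy_on UNIV (\<lambda>n. f (r n))"
    unfolding uniformly_Cauchy_on_def
  proof (intro allI impI)
    fix e :: real assume e: "e > 0"
    obtain m where m: "inverse (real (Suc m)) < e / 3" using reals_Archimedean[of "e / 3"] e by auto
    have "\<exists>M. \<forall>i\<ge>M. \<forall>j\<ge>M. dist (f (r i) t) (f (r j) t) < e / 3" if "t \<in> T m" for t
    proof -
      have "t \<in> (\<Union>m. T m)" using that by blast
      then obtain l where "(\<lambda>n. f (r n) t) \<longlonglongrightarrow> l" using r(2) by blast
      then have "Cauchy (\<lambda>n. f (r n) t)" by (rule LIMSEQ_imp_Cauchy)
      then show ?thesis using e by (intro metric_CauchyD) auto
    qed
    then obtain M where M: "\<And>t i j. t \<in> T m \<Longrightarrow> i \<ge> M t \<Longrightarrow> j \<ge> M t \<Longrightarrow> dist (f (r i) t) (f (r j) t) < e / 3"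
      by metis
    show "\<exists>M. \<forall>x\<in>UNIV. \<forall>i\<ge>M. \<forall>j\<ge>M. dist (f (r i) x) (f (r j) x) < e"
    proof (intro exI ballI allI impI)
      \<comment> \<open>The sum of the thresholds \<open>M t\<close> over the finite net is a
        threshold common to all its points.\<close>
      fix x i j assume ij: "i \<ge> (\<Sum>t\<in>T m. M t)" "j \<ge> (\<Sum>t\<in>T m. M t)"
      obtain t where t: "t \<in> T m" "x - t \<in> U m" using T(2) by blast
      have "M t \<le> (\<Sum>t\<in>T m. M t)" using T(1) t by (intro member_le_sum) auto
      then have "dist (f (r i) t) (f (r j) t) < e / 3" using ij t by (intro M) auto
      moreover have "dist (f (r i) x) (f (r i) t) < e / 3" "dist (f (r j) x) (f (r j) t) < e / 3"
        using U(3)[OF t(2)] m by (meson le_less_trans)+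
      ultimately show "dist (f (r i) x) (f (r j) x) < e"
        using dist_triangle[of "f (r i) x" "f (r j) x" "f (r i) t"]
          dist_triangle[of "f (r i) t" "f (r j) x" "f (r j) t"] by (simp add: dist_commute)
    qed
  qed
  then have "uniformly_convergent_on UNIV (\<lambda>n. f (r n))" by (rule Cauchy_uniformly_convergent)
  then obtain g where g: "uniform_limit UNIV (\<lambda>n. f (r n)) g sequentially"
    unfolding uniformly_convergent_on_def by (elim exE)
  have "continuous_on UNIV (f n)" for n
  proof (rule continuous_from_uniform)
    fix e :: real assume "e > 0"
    from eq[OF this] show "\<exists>U. open U \<and> 0 \<in> U \<and> (\<forall>x x'. x - x' \<in> U \<longrightarrow> dist (f n x) (f n x') \<le> e)"
      by (elim ex_forward) simp
  qed
  then have "continuous_on UNIV g" by (intro uniform_limit_theorem[OF _ g]) auto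
  show ?thesis by (rule that[OF r(1) g]) fact
qed

section \<open>Convolution operators and their eigenfunctions\<close>

context haar begin

lemma real_reflect:
  fixes u :: "'a \<Rightarrow> real"
  assumes u: "continuous_on UNIV u"
  shows "(\<integral>x. u (- x) \<partial>H) = (\<integral>x. u x \<partial>H)"
  using reflect[of "\<lambda>x. complex_of_real (u x)"] u by (simp add: continuous_on_of_real)

lemma real_sub_invariant:
  fixes u :: "'a \<Rightarrow> real"
  assumes u: "continuous_on UNIV u"
  shows "(\<integral>y. u (x - y) \<partial>H) = (\<integral>y. u y \<partial>H)"
  using real_invariant[OF continuous_reflect[OF u], of "- x"] real_reflect[OF u] by (simp add: algebra_simps)

definition n2 :: "('a \<Rightarrow> complex) \<Rightarrow> real" where
  "n2 f = (\<integral>x. (cmod (f x))\<^sup>2 \<partial>H)"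

lemma n2_eq: "complex_of_real (n2 f) = (\<integral>x. f x * cnj (f x) \<partial>H)"
  unfolding n2_def by (simp add: complex_norm_square[symmetric] flip: integral_complex_of_real)

lemma n2_nonneg: "n2 f \<ge> 0"
  unfolding n2_def by simp

lemma n2_eq_0: "continuous_on UNIV f \<Longrightarrow> n2 f = 0 \<Longrightarrow> f x = 0"
  using strictly_positive[of "\<lambda>x. (cmod (f x))\<^sup>2" x] unfolding n2_def
  by (simp add: continuous_on_norm continuous_on_power)

lemma n2_scale: "n2 (\<lambda>x. c * f x) = (cmod c)\<^sup>2 * n2 f"
  unfolding n2_def by (simp add: norm_mult power_mult_distrib)

lemma n2_le: "continuous_on UNIV f \<Longrightarrow> (\<And>x. cmod (f x) \<le> B) \<Longrightarrow> n2 f \<le> B\<^sup>2"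
proof -
  assume f: "continuous_on UNIV f" and B: "\<And>x. cmod (f x) \<le> B"
  have "norm (\<integral>x. (cmod (f x))\<^sup>2 \<partial>H) \<le> B\<^sup>2"
    using B by (intro norm_integral_le continuous_intros f) (auto intro: power_mono)
  then show ?thesis unfolding n2_def by simp
qed

lemma n2_limit:
  assumes f: "\<And>n. continuous_on UNIV (f n)" and lim: "uniform_limit UNIV f g sequentially"
  shows "(\<lambda>n. n2 (f n)) \<longlonglongrightarrow> n2 g"
proof -
  have g: "continuous_on UNIV g" by (rule uniform_limit_theorem[OF _ lim]) (use f in auto)
  obtain B where "\<And>x. norm (g x) \<le> B" using compact_continuous_bounded[OF cpt g] by blast
  then have bg: "bounded (g ` UNIV)" "bounded ((\<lambda>x. cnj (g x)) ` UNIV)" by (auto simp: bounded_iff)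
  have "uniform_limit UNIV (\<lambda>n x. cnj (f n x)) (\<lambda>x. cnj (g x)) sequentially"
    by (rule bounded_linear.uniform_limit[OF bounded_linear_cnj lim])
  then have "uniform_limit UNIV (\<lambda>n x. f n x * cnj (f n x)) (\<lambda>x. g x * cnj (g x)) sequentially"
    using lim bg by (intro uniform_lim_mult)
  then have "(\<lambda>n. \<integral>x. f n x * cnj (f n x) \<partial>H) \<longlonglongrightarrow> (\<integral>x. g x * cnj (g x) \<partial>H)"
    by (intro integral_uniform_limit continuous_intros f)
  then have "(\<lambda>n. complex_of_real (n2 (f n))) \<longlonglongrightarrow> complex_of_real (n2 g)" by (simp add: n2_eq)
  then show ?thesis by (simp add: tendsto_of_real_iff)
qed

definition conv :: "('a \<Rightarrow> complex) \<Rightarrow> ('a \<Rightarrow> complex) \<Rightarrow> 'a \<Rightarrow> complex" where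
  "conv k f x = (\<integral>y. k y * f (x - y) \<partial>H)"

lemma conv_cont: "continuous_on UNIV k \<Longrightarrow> continuous_on UNIV f \<Longrightarrow> continuous_on UNIV (conv k f)"
  unfolding conv_def[abs_def]
  by (rule continuous_parameter_integral)
     (auto simp: case_prod_beta' intro!: continuous_intros intro: continuous_on_comp)

lemma conv_bound:
  assumes "continuous_on UNIV k" "continuous_on UNIV f" "\<And>x. cmod (k x) \<le> K" "\<And>x. cmod (f x) \<le> B"
  shows "cmod (conv k f x) \<le> K * B"
proof -
  have "0 \<le> K" using assms(3)[of 0] norm_ge_zero order_trans by blast
  then show ?thesis unfolding conv_def
    using assms by (intro norm_integral_le) (auto simp: norm_mult intro!: continuous_intros mult_mono intro: continuous_on_comp)
qed

text \<open>The inequality \<open>t \<le> (1 + t^2) / 2\<close> stands in for Cauchy-Schwarz: with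
  \<open>n2 f = 1\<close> it bounds the mean of \<open>cmod f\<close> by 1.\<close>

lemma conv_bound_n2:
  assumes k: "continuous_on UNIV k" "\<And>x. cmod (k x) \<le> K" and f: "continuous_on UNIV f" "n2 f = 1"
  shows "cmod (conv k f x) \<le> K"
proof -
  have K: "0 \<le> K" using k(2)[of 0] norm_ge_zero order_trans by blast
  have c: "continuous_on UNIV (\<lambda>y. f (x - y))" by (intro continuous_on_comp[OF f(1)] continuous_intros)
  have "cmod (conv k f x) \<le> (\<integral>y. cmod (k y * f (x - y)) \<partial>H)" unfolding conv_def by simp
  also have "\<dots> \<le> (\<integral>y. K * ((1 + (cmod (f (x - y)))\<^sup>2) / 2) \<partial>H)"
  proof (rule integral_mono)
    show "integrable H (\<lambda>y. cmod (k y * f (x - y)))" "integrable H (\<lambda>y. K * ((1 + (cmod (f (x - y)))\<^sup>2) / 2))"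
      by (intro integrable_continuous continuous_intros k c; simp)+
    fix y
    have "cmod (f (x - y)) \<le> (1 + (cmod (f (x - y)))\<^sup>2) / 2"
      using zero_le_power2[of "1 - cmod (f (x - y))"] by (simp add: power2_eq_square algebra_simps)
    then show "cmod (k y * f (x - y)) \<le> K * ((1 + (cmod (f (x - y)))\<^sup>2) / 2)"
      unfolding norm_mult using k K by (intro mult_mono) auto
  qed
  also have "\<dots> = K * ((1 + (\<integral>y. (cmod (f (x - y)))\<^sup>2 \<partial>H)) / 2)"
    using integrable_continuous[OF continuous_on_power[OF continuous_on_norm[OF c]], of 2] prob_space by simp
  also have "(\<integral>y. (cmod (f (x - y)))\<^sup>2 \<partial>H) = n2 f"
    unfolding n2_def by (rule real_sub_invariant) (intro continuous_intros f)
  finally show ?thesis using f by simp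
qed

lemma conv_alt:
  assumes "continuous_on UNIV k" "continuous_on UNIV f"
  shows "conv k f x = (\<integral>y. k (x + y) * f (- y) \<partial>H)"
proof -
  have "continuous_on UNIV (\<lambda>y. k y * f (x - y))"
    using assms by (auto intro!: continuous_intros intro: continuous_on_comp)
  from invariant[OF this, of x] show ?thesis unfolding conv_def by (simp add: add.commute)
qed

text \<open>After the substitution in \<open>conv_alt\<close> the variable \<open>x\<close> occurs
  only in the kernel, so the modulus of \<open>k\<close> serves all functions with a common bound.
  This is the compactness of the convolution operator.\<close>

lemma conv_equicontinuous:
  assumes k: "continuous_on UNIV k" and e: "e > 0"
  shows "\<exists>U. open U \<and> 0 \<in> U \<and> (\<forall>f B x x'. continuous_on UNIV f \<longrightarrow> (\<forall>x. cmod (f x) \<le> B) \<longrightarrow> x - x' \<in> U \<longrightarrow>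
     dist (conv k f x) (conv k f x') \<le> e * B)"
proof -
  obtain U where U: "open U" "0 \<in> U" "\<forall>y y'. y - y' \<in> U \<longrightarrow> dist (k y) (k y') < e"
    by (rule uniformly_continuous_compact_group1[OF cpt k e])
  have "dist (conv k f x) (conv k f x') \<le> e * B"
    if f: "continuous_on UNIV f" and B: "\<forall>x. cmod (f x) \<le> B" and x: "x - x' \<in> U" for f B x x'
    unfolding dist_norm conv_alt[OF k f]
  proof (rule norm_integral_diff_le)
    show "continuous_on UNIV (\<lambda>y. k (x + y) * f (- y))" for x
      using k f by (auto intro!: continuous_intros intro: continuous_on_comp)
    then show "continuous_on UNIV (\<lambda>y. k (x' + y) * f (- y))" .
    fix y
    have "(x + y) - (x' + y) \<in> U" using x by simp
    then have "cmod (k (x + y) - k (x' + y)) \<le> e" using U(3) unfolding dist_norm by (auto intro: less_imp_le)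
    then show "cmod (k (x + y) * f (- y) - k (x' + y) * f (- y)) \<le> e * B"
      using B e by (auto simp: left_diff_distrib[symmetric] norm_mult intro!: mult_mono)
  qed
  with U show ?thesis by blast
qed

lemma conv_scale: "conv k (\<lambda>x. c * f x) = (\<lambda>x. c * conv k f x)"
  unfolding conv_def[abs_def] by (simp add: mult.left_commute[of _ c])

lemma conv_diff:
  assumes "continuous_on UNIV k" "continuous_on UNIV f" "continuous_on UNIV g"
  shows "conv k (\<lambda>x. f x - g x) = (\<lambda>x. conv k f x - conv k g x)"
  unfolding conv_def[abs_def] right_diff_distrib
  using assms by (intro ext Bochner_Integration.integral_diff integrable_continuous)
    (auto intro!: continuous_intros intro: continuous_on_comp)

lemma conv_add:
  assumes "continuous_on UNIV k" "continuous_on UNIV f" "continuous_on UNIV g"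
  shows "conv k (\<lambda>x. f x + g x) = (\<lambda>x. conv k f x + conv k g x)"
  unfolding conv_def[abs_def] distrib_left
  using assms by (intro ext Bochner_Integration.integral_add integrable_continuous)
    (auto intro!: continuous_intros intro: continuous_on_comp)

lemma conv_translate: "conv k (\<lambda>x. f (x + a)) = (\<lambda>x. conv k f (x + a))"
  unfolding conv_def[abs_def] by (simp add: algebra_simps)

lemma conv_uniform_limit:
  assumes k: "continuous_on UNIV k" and f: "\<And>n. continuous_on UNIV (f n)"
    and lim: "uniform_limit UNIV f g sequentially"
  shows "uniform_limit UNIV (\<lambda>n. conv k (f n)) (conv k g) sequentially"
proof (rule uniform_limitI)
  fix e :: real assume e: "e > 0"
  obtain K where K: "K > 0" "\<And>x. cmod (k x) \<le> K" using compact_continuous_bounded[OF cpt k] by blast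
  have g: "continuous_on UNIV g" by (rule uniform_limit_theorem[OF _ lim]) (use f in auto)
  have "\<forall>\<^sub>F n in sequentially. \<forall>x\<in>UNIV. dist (f n x) (g x) < e / (2 * K)"
    using lim e K by (intro uniform_limitD) auto
  then show "\<forall>\<^sub>F n in sequentially. \<forall>x\<in>UNIV. dist (conv k (f n) x) (conv k g x) < e"
  proof (rule eventually_mono, intro ballI)
    fix n x assume n: "\<forall>x\<in>UNIV. dist (f n x) (g x) < e / (2 * K)"
    have "cmod (conv k (\<lambda>x. f n x - g x) x) \<le> K * (e / (2 * K))"
      using n by (intro conv_bound k K continuous_on_diff f g) (auto simp: dist_norm less_imp_le)
    then show "dist (conv k (f n) x) (conv k g x) < e"
      using e K by (simp add: conv_diff[OF k f g] dist_norm)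
  qed
qed

text \<open>After Fubini a shift of \<open>x\<close> by \<open>y\<close> moves the translation onto
  \<open>g\<close>; reflecting \<open>y\<close> then turns the kernel into its conjugate.\<close>

lemma conv_selfadjoint:
  assumes k: "continuous_on UNIV k" "\<And>x. k (- x) = cnj (k x)"
    and f: "continuous_on UNIV f" and g: "continuous_on UNIV g"
  shows "(\<integral>x. conv k f x * cnj (g x) \<partial>H) = (\<integral>x. f x * cnj (conv k g x) \<partial>H)"
proof -
  have c1: "continuous_on UNIV (\<lambda>(x, y). k y * f (x - y) * cnj (g x))"
    unfolding case_prod_beta'
    by (intro continuous_intros continuous_on_comp[OF k(1)] continuous_on_comp[OF f] continuous_on_comp[OF g])
  have c2: "continuous_on UNIV (\<lambda>(y, x). k y * f x * cnj (g (x + y)))"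
    unfolding case_prod_beta'
    by (intro continuous_intros continuous_on_comp[OF k(1)] continuous_on_comp[OF f] continuous_on_comp[OF g])
  have "(\<integral>x. conv k f x * cnj (g x) \<partial>H) = (\<integral>x. (\<integral>y. k y * f (x - y) * cnj (g x) \<partial>H) \<partial>H)"
    by (simp add: conv_def)
  also have "\<dots> = (\<integral>y. (\<integral>x. k y * f (x - y) * cnj (g x) \<partial>H) \<partial>H)" by (rule fubini[OF c1])
  also have "\<dots> = (\<integral>y. (\<integral>x. k y * f x * cnj (g (x + y)) \<partial>H) \<partial>H)"
  proof (rule Bochner_Integration.integral_cong[OF refl])
    fix y
    have "continuous_on UNIV (\<lambda>x. k y * f (x - y) * cnj (g x))" by (rule continuous_on_slice(2)[OF c1])
    from invariant[OF this, of y] show "(\<integral>x. k y * f (x - y) * cnj (g x) \<partial>H) = (\<integral>x. k y * f x * cnj (g (x + y)) \<partial>H)"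
      by simp
  qed
  also have "\<dots> = (\<integral>x. (\<integral>y. k y * f x * cnj (g (x + y)) \<partial>H) \<partial>H)" by (rule fubini[OF c2])
  also have "\<dots> = (\<integral>x. f x * cnj (conv k g x) \<partial>H)"
  proof (rule Bochner_Integration.integral_cong[OF refl])
    fix x
    have "continuous_on UNIV (\<lambda>y. k y * f x * cnj (g (x + y)))" by (rule continuous_on_slice(2)[OF c2])
    from reflect[OF this, symmetric] have "(\<integral>y. k y * f x * cnj (g (x + y)) \<partial>H) = (\<integral>y. f x * cnj (k y * g (x - y)) \<partial>H)"
      by (simp add: k(2) mult_ac)
    also have "\<dots> = f x * cnj (conv k g x)"
      unfolding conv_def by (simp del: complex_cnj_mult flip: integral_cnj)
    finally show "(\<integral>y. k y * f x * cnj (g (x + y)) \<partial>H) = f x * cnj (conv k g x)" .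
  qed
  finally show ?thesis .
qed

text \<open>In the expansion of the square both cross terms reduce, by self-adjointness, to the
  square of \<open>n2 (conv k h)\<close>, and the last term equals it because
  \<open>n2 h = 1\<close>.\<close>

lemma conv_iterate_step:
  assumes k: "continuous_on UNIV k" "\<And>x. k (- x) = cnj (k x)"
    and h: "continuous_on UNIV h" "n2 h = 1"
  shows "n2 (\<lambda>x. conv k (conv k h) x - of_real (n2 (conv k h)) * h x) = n2 (conv k (conv k h)) - (n2 (conv k h))\<^sup>2"
proof -
  let ?T = "conv k" and ?s = "n2 (conv k h)"
  have c: "continuous_on UNIV (?T h)" "continuous_on UNIV (?T (?T h))" using k h by (simp_all add: conv_cont)
  have i1: "(\<integral>x. ?T (?T h) x * cnj (h x) \<partial>H) = of_real ?s"
    using conv_selfadjoint[OF k c(1) h(1)] by (simp add: n2_eq)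
  have i2: "(\<integral>x. h x * cnj (?T (?T h) x) \<partial>H) = of_real ?s"
    using conv_selfadjoint[OF k h(1) c(1)] by (simp add: n2_eq)
  have "complex_of_real (n2 (\<lambda>x. ?T (?T h) x - of_real ?s * h x)) =
     (\<integral>x. (?T (?T h) x * cnj (?T (?T h) x) + of_real ?s * of_real ?s * (h x * cnj (h x)))
        - (of_real ?s * (?T (?T h) x * cnj (h x)) + of_real ?s * (h x * cnj (?T (?T h) x))) \<partial>H)"
    unfolding n2_eq[of "\<lambda>x. ?T (?T h) x - of_real ?s * h x"] by (simp add: algebra_simps)
  also have "\<dots> = of_real (n2 (?T (?T h))) + of_real ?s * of_real ?s * of_real (n2 h)
        - (of_real ?s * of_real ?s + of_real ?s * of_real ?s)"
    unfolding i1[symmetric] n2_eq[of "?T (?T h)"] n2_eq[of h]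
    by (subst Bochner_Integration.integral_diff Bochner_Integration.integral_add
        | intro integrable_continuous continuous_intros c h | simp add: i1 i2)+
  also have "\<dots> = complex_of_real (n2 (?T (?T h)) - ?s\<^sup>2)" by (simp add: h power2_eq_square)
  finally show ?thesis by (simp only: of_real_eq_iff)
qed

text \<open>
  Power iteration: with \<open>h\<^sub>n\<close> the normalised iterates of \<open>k\<close> under the convolution operator \<open>T\<close> and
  \<open>s\<^sub>n = \<parallel>T h\<^sub>n\<parallel>\<^sup>2\<close>, one has \<open>\<parallel>T\<^sup>2 h\<^sub>n - s\<^sub>n h\<^sub>n\<parallel>\<^sup>2 = s\<^sub>n (s\<^bsub>n+1\<^esub> - s\<^sub>n)\<close>. Hence \<open>s\<^sub>n\<close> increases to some
  \<open>m\<close>, and uniform cluster points of \<open>h\<^sub>n\<close> are eigenfunctions of \<open>T\<^sup>2\<close>.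
\<close>

lemma conv_eigenfunction:
  assumes k: "continuous_on UNIV k" "\<And>x. k (- x) = cnj (k x)" and ne: "k z \<noteq> 0"
  obtains g m where "continuous_on UNIV g" "n2 g = 1" "m > 0" "\<And>x. conv k (conv k g) x = of_real m * g x"
proof -
  let ?T = "conv k"
  obtain K where K: "K > 0" "\<And>x. cmod (k x) \<le> K" using compact_continuous_bounded[OF cpt k(1)] by blast
  have n2k: "n2 k > 0" using n2_eq_0[OF k(1)] ne n2_nonneg[of k] by force
  \<comment> \<open>The iteration starts from the kernel itself. Its limit is an eigenfunction of
    the square of the operator only, because eigenvalues of equal modulus and opposite sign may make
    the iterates oscillate.\<close>
  define h where "h = rec_nat (\<lambda>x. of_real (1 / sqrt (n2 k)) * k x) (\<lambda>_ u x. of_real (1 / sqrt (n2 (?T u))) * ?T u x)"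
  have h0: "h 0 = (\<lambda>x. of_real (1 / sqrt (n2 k)) * k x)"
    and hS: "h (Suc n) = (\<lambda>x. of_real (1 / sqrt (n2 (?T (h n)))) * ?T (h n) x)" for n
    by (simp_all add: h_def)
  define s where "s n = n2 (?T (h n))" for n
  have nrm: "n2 (\<lambda>x. of_real (1 / sqrt (n2 u)) * u x) = 1" if "n2 u > 0" for u
    unfolding n2_scale using that by (simp add: power_divide norm_divide)
  have step: "continuous_on UNIV (h (Suc n)) \<and> n2 (h (Suc n)) = 1 \<and> s n \<le> s (Suc n)"
    and en: "n2 (\<lambda>x. ?T (?T (h n)) x - of_real (s n) * h n x) = s n * (s (Suc n) - s n)"
    if h: "continuous_on UNIV (h n)" "n2 (h n) = 1" and s: "s n > 0" for n
  proof -
    have cT: "continuous_on UNIV (?T (h n))" by (rule conv_cont[OF k(1) h(1)])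
    have c: "continuous_on UNIV (h (Suc n))" unfolding hS by (intro continuous_intros cT)
    have n: "n2 (h (Suc n)) = 1" unfolding hS using s by (intro nrm) (simp add: s_def)
    have "?T (h (Suc n)) = (\<lambda>x. of_real (1 / sqrt (s n)) * ?T (?T (h n)) x)"
      unfolding hS conv_scale by (simp add: s_def)
    then have "s (Suc n) = (cmod (of_real (1 / sqrt (s n))))\<^sup>2 * n2 (?T (?T (h n)))"
      by (simp only: s_def[of "Suc n"] n2_scale)
    then have "s (Suc n) = n2 (?T (?T (h n))) / s n"
      using s by (simp add: power_divide norm_divide)
    then have TT: "n2 (?T (?T (h n))) = s n * s (Suc n)" using s by (simp add: field_simps)
    have e: "n2 (\<lambda>x. ?T (?T (h n)) x - of_real (s n) * h n x) = s n * s (Suc n) - (s n)\<^sup>2"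
      using conv_iterate_step[OF k h] by (simp add: TT flip: s_def)
    then show "n2 (\<lambda>x. ?T (?T (h n)) x - of_real (s n) * h n x) = s n * (s (Suc n) - s n)"
      by (simp add: power2_eq_square algebra_simps)
    have "0 \<le> s n * (s (Suc n) - s n)"
      using n2_nonneg[of "\<lambda>x. ?T (?T (h n)) x - of_real (s n) * h n x"] e by (simp add: power2_eq_square algebra_simps)
    then have "s n \<le> s (Suc n)" using s by (simp add: zero_le_mult_iff)
    with c n show "continuous_on UNIV (h (Suc n)) \<and> n2 (h (Suc n)) = 1 \<and> s n \<le> s (Suc n)" by blast
  qed
  have s0: "s 0 > 0"
  proof -
    \<comment> \<open>The kernel is Hermitian, so its convolution with itself has the value
      \<open>n2 k > 0\<close> at 0, and the iteration does not die at the start.\<close>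
    have "?T k 0 = (\<integral>y. k y * cnj (k y) \<partial>H)" by (simp add: conv_def k(2))
    also have "\<dots> = of_real (n2 k)" by (rule n2_eq[symmetric])
    finally have "?T k 0 \<noteq> 0" using n2k by simp
    then have "n2 (?T k) \<noteq> 0" using n2_eq_0[OF conv_cont[OF k(1) k(1)]] by blast
    then have "n2 (?T k) > 0" using n2_nonneg[of "?T k"] by simp
    then show ?thesis unfolding s_def h0 conv_scale n2_scale using n2k by simp
  qed
  have inv: "continuous_on UNIV (h n) \<and> n2 (h n) = 1 \<and> s n \<ge> s 0" for n
  proof (induction n)
    case 0
    have "continuous_on UNIV (h 0)" unfolding h0 by (intro continuous_intros k)
    moreover have "n2 (h 0) = 1" unfolding h0 by (rule nrm[OF n2k])
    ultimately show ?case by simp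
  next
    case (Suc n) then show ?case using step[of n] s0 by force
  qed
  then have hc: "continuous_on UNIV (h n)" and hn: "n2 (h n) = 1" and sp: "s n > 0" for n
    using s0 by (auto intro: less_le_trans)
  have s_le: "s n \<le> K\<^sup>2" for n unfolding s_def
    by (intro n2_le conv_cont k hc conv_bound_n2 K hn)
  have "incseq s" using step hc hn sp by (auto intro: incseq_SucI)
  then obtain m where m: "s \<longlonglongrightarrow> m" "\<And>n. s n \<le> m"
    using incseq_convergent[of s "K\<^sup>2"] s_le by auto
  have mp: "m > 0" using m(2)[of 0] s0 by simp
  define c where "c = 1 / sqrt (s 0)"
  have c0: "c > 0" using s0 by (simp add: c_def)
  have c_ge: "1 / sqrt (s n) \<le> c" for n unfolding c_def using inv[of n] s0 by (intro divide_left_mono) auto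
  have hb: "cmod (h (Suc n) x) \<le> c * K" for n x
  proof -
    have "cmod (h (Suc n) x) = 1 / sqrt (s n) * cmod (?T (h n) x)"
      unfolding hS using sp[of n] by (simp add: norm_mult norm_divide s_def)
    also have "\<dots> \<le> c * K"
      using c_ge[of n] c0 sp[of n] by (intro mult_mono conv_bound_n2 k K hc hn) auto
    finally show ?thesis .
  qed
  \<comment> \<open>One application of the operator makes the normalised iterates uniformly bounded
    by \<open>c * K\<close>, and a second makes them equicontinuous; hence only the iterates from
    index 2 on are used. The factor \<open>c\<close> dominates all normalising constants, since the
    \<open>s n\<close> increase.\<close>
  have eq: "\<exists>U. open U \<and> 0 \<in> U \<and> (\<forall>n x x'. x - x' \<in> U \<longrightarrow> dist (h (Suc (Suc n)) x) (h (Suc (Suc n)) x') \<le> e)"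
    if e: "e > 0" for e
  proof -
    have "e / (c * (c * K)) > 0" using e c0 K by simp
    from conv_equicontinuous[OF k(1) this] obtain U where U: "open U" "0 \<in> U"
      "\<forall>f B x x'. continuous_on UNIV f \<longrightarrow> (\<forall>x. cmod (f x) \<le> B) \<longrightarrow> x - x' \<in> U \<longrightarrow>
         dist (?T f x) (?T f x') \<le> e / (c * (c * K)) * B" by blast
    have "dist (h (Suc (Suc n)) x) (h (Suc (Suc n)) x') \<le> e" if x: "x - x' \<in> U" for n x x'
    proof -
      have "dist (?T (h (Suc n)) x) (?T (h (Suc n)) x') \<le> e / (c * (c * K)) * (c * K)"
        using U(3) hc[of "Suc n"] hb[of n] x by blast
      then have *: "cmod (?T (h (Suc n)) x - ?T (h (Suc n)) x') \<le> e / c"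
        using c0 K by (simp add: dist_norm)
      have "dist (h (Suc (Suc n)) x) (h (Suc (Suc n)) x') =
          1 / sqrt (s (Suc n)) * cmod (?T (h (Suc n)) x - ?T (h (Suc n)) x')"
        unfolding hS[of "Suc n"] dist_norm right_diff_distrib[symmetric] norm_mult s_def[symmetric]
        using sp[of "Suc n"] by (simp add: norm_divide)
      also have "\<dots> \<le> c * (e / c)" using * c_ge[of "Suc n"] c0 by (intro mult_mono) auto
      finally show ?thesis using c0 by simp
    qed
    with U(1,2) show ?thesis by blast
  qed
  obtain r g where rg: "strict_mono (r :: nat \<Rightarrow> nat)"
    "uniform_limit UNIV (\<lambda>n. h (Suc (Suc (r n)))) g sequentially" "continuous_on UNIV g"
    by (rule arzela_ascoli_group[of "\<lambda>n. h (Suc (Suc n))", OF cpt hb eq])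
  define t where "t n = Suc (Suc (r n))" for n
  have t: "strict_mono t" using rg(1) by (auto simp: t_def strict_mono_def)
  have lim: "uniform_limit UNIV (\<lambda>n. h (t n)) g sequentially" using rg(2) by (simp add: t_def)
  have sl: "(\<lambda>n. s (t n)) \<longlonglongrightarrow> m" using LIMSEQ_subseq_LIMSEQ[OF m(1) t] by (simp add: o_def)
  have "(\<lambda>n. s (Suc n)) \<longlonglongrightarrow> m" using m(1) by (rule LIMSEQ_Suc)
  then have sl': "(\<lambda>n. s (Suc (t n))) \<longlonglongrightarrow> m" using LIMSEQ_subseq_LIMSEQ[OF _ t] by (force simp: o_def)
  have n2g: "n2 g = 1"
    using n2_limit[OF hc lim] by (simp add: hn LIMSEQ_const_iff)
  obtain B where B: "\<And>x. norm (g x) \<le> B" using compact_continuous_bounded[OF cpt rg(3)] by blast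
  have "uniform_limit UNIV (\<lambda>n x. complex_of_real (s (t n))) (\<lambda>x. of_real m) sequentially"
    using sl unfolding uniform_limit_iff tendsto_iff by simp
  then have l1: "uniform_limit UNIV (\<lambda>n x. of_real (s (t n)) * h (t n) x) (\<lambda>x. of_real m * g x) sequentially"
    using lim by (intro uniform_lim_mult) (use B in \<open>auto simp: bounded_iff\<close>)
  have "uniform_limit UNIV (\<lambda>n. ?T (?T (h (t n)))) (?T (?T g)) sequentially"
    by (intro conv_uniform_limit conv_cont k hc lim)
  from uniform_limit_minus[OF this l1]
  have "(\<lambda>n. n2 (\<lambda>x. ?T (?T (h (t n))) x - of_real (s (t n)) * h (t n) x)) \<longlonglongrightarrow>
      n2 (\<lambda>x. ?T (?T g) x - of_real m * g x)"
    by (intro n2_limit continuous_intros conv_cont k hc) simp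
  moreover have "(\<lambda>n. s (t n) * (s (Suc (t n)) - s (t n))) \<longlonglongrightarrow> m * (m - m)"
    by (intro tendsto_intros sl sl')
  ultimately have "n2 (\<lambda>x. ?T (?T g) x - of_real m * g x) = 0"
    using LIMSEQ_unique by (fastforce simp: en[OF hc hn sp])
  moreover have "continuous_on UNIV (\<lambda>x. ?T (?T g) x - of_real m * g x)"
    by (intro continuous_intros conv_cont k rg)
  ultimately have "?T (?T g) x - of_real m * g x = 0" for x using n2_eq_0 by blast
  then show ?thesis using that[OF rg(3) n2g mp] by simp
qed

end

section \<open>Positive definite functions\<close>

definition form :: "('a::ab_group_add \<Rightarrow> complex) \<Rightarrow> ('a \<times> complex) list \<Rightarrow> ('a \<times> complex) list \<Rightarrow> complex" where
  "form q xs ys = (\<Sum>p\<leftarrow>xs. \<Sum>r\<leftarrow>ys. snd p * cnj (snd r) * q (fst p - fst r))"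

text \<open>Combinations of point masses are lists in which points may repeat. Adding two of them is
  concatenation and translating one is a \<open>map\<close>, so equal points never have to be
  merged.\<close>

definition posdef :: "('a::ab_group_add \<Rightarrow> complex) \<Rightarrow> bool" where
  "posdef q \<longleftrightarrow> (\<forall>xs. form q xs xs \<in> \<real>\<^sub>\<ge>\<^sub>0)"

lemma form_append: "form q (xs @ xs') ys = form q xs ys + form q xs' ys"
  "form q xs (ys @ ys') = form q xs ys + form q xs ys'"
  by (simp_all add: form_def sum_list_addf)

lemma form_shift_left: "form q (map (\<lambda>p. (fst p + a, e * snd p)) xs) ys = e * form (\<lambda>z. q (z + a)) xs ys"
  by (simp add: form_def o_def sum_list_const_mult[symmetric] algebra_simps)

lemma form_shift_right: "form q xs (map (\<lambda>p. (fst p + a, e * snd p)) ys) = cnj e * form (\<lambda>z. q (z - a)) xs ys"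
  by (simp add: form_def o_def sum_list_const_mult[symmetric] algebra_simps)

lemma form_add: "form (\<lambda>z. p z + q z) xs ys = form p xs ys + form q xs ys"
  by (simp add: form_def distrib_left sum_list_addf)

lemma form_scale: "form (\<lambda>z. c * q z) xs ys = c * form q xs ys"
  by (simp add: form_def sum_list_const_mult[symmetric] mult_ac)

lemma posdef_scale: "posdef q \<Longrightarrow> c \<ge> 0 \<Longrightarrow> posdef (\<lambda>z. complex_of_real c * q z)"
  unfolding posdef_def form_scale by (auto intro: nonneg_Reals_mult_I)

text \<open>The form is evaluated on a combination together with its copy shifted by
  \<open>a\<close> and multiplied by \<open>e\<close>. The two diagonal blocks give
  \<open>2 * q z\<close>, the two mixed blocks the twisted translates.\<close>

lemma posdef_twist:
  assumes q: "posdef q" and e: "cmod e = 1"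
  shows "posdef (\<lambda>z. 2 * q z + (e * q (z + a) + cnj e * q (z - a)))"
  unfolding posdef_def
proof
  fix xs
  let ?ys = "map (\<lambda>p. (fst p + a, e * snd p)) xs"
  have ee: "e * cnj e = 1" using e by (simp add: complex_norm_square[symmetric])
  have "form q (xs @ ?ys) (xs @ ?ys) =
      form q xs xs + cnj e * form (\<lambda>z. q (z - a)) xs xs + (e * form (\<lambda>z. q (z + a)) xs xs + (e * cnj e) * form q xs xs)"
    by (simp add: form_append form_shift_left form_shift_right) (simp add: algebra_simps)
  also have "\<dots> = form (\<lambda>z. 2 * q z + (e * q (z + a) + cnj e * q (z - a))) xs xs"
    by (simp add: ee form_add form_scale)
  finally have eq: "form q (xs @ ?ys) (xs @ ?ys) = form (\<lambda>z. 2 * q z + (e * q (z + a) + cnj e * q (z - a))) xs xs" .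
  have "form q (xs @ ?ys) (xs @ ?ys) \<in> \<real>\<^sub>\<ge>\<^sub>0" using q unfolding posdef_def by (rule spec)
  then show "form (\<lambda>z. 2 * q z + (e * q (z + a) + cnj e * q (z - a))) xs xs \<in> \<real>\<^sub>\<ge>\<^sub>0"
    by (simp only: eq)
qed

lemma posdef_props:
  assumes q: "posdef q"
  shows "Im (q 0) = 0" "Re (q 0) \<ge> 0" "q (- x) = cnj (q x)" "cmod (q x) \<le> Re (q 0)"
proof -
  have nn: "0 \<le> Re (form q xs xs)" "Im (form q xs xs) = 0" for xs
    using q by (auto simp: posdef_def complex_nonneg_Reals_iff)
  show z: "Im (q 0) = 0" "Re (q 0) \<ge> 0" using nn[of "[(0, 1)]"] by (auto simp: form_def)
  have two: "form q [(x, e), (0, 1)] [(x, e), (0, 1)] = (e * cnj e) * q 0 + e * q x + cnj e * q (- x) + q 0" for e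
    by (simp add: form_def)
  \<comment> \<open>The two-point form is real; coefficient 1 fixes the imaginary part of
    \<open>q (- x)\<close> and coefficient \<i> its real part.\<close>
  show r: "q (- x) = cnj (q x)"
    using nn(2)[of "[(x, 1), (0, 1)]"] nn(2)[of "[(x, \<i>), (0, 1)]"] z unfolding two
    by (auto simp: complex_eq_iff)
  show "cmod (q x) \<le> Re (q 0)"
  proof (cases "q x = 0")
    case True then show ?thesis using z by simp
  next
    case False
    \<comment> \<open>The phase that rotates \<open>q x\<close> to minus its modulus, which makes
      the nonnegative two-point form as small as possible.\<close>
    define e where "e = - cnj (q x) / of_real (cmod (q x))"
    have "cmod e = 1" using False by (simp add: e_def norm_divide)
    then have ee: "e * cnj e = 1" by (simp add: complex_norm_square[symmetric])
    have eq: "e * q x = - of_real (cmod (q x))"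
      using False complex_norm_square[of "q x"] by (simp add: e_def field_simps power2_eq_square)
    then have "cnj e * cnj (q x) = - of_real (cmod (q x))" by (metis complex_cnj_complex_of_real complex_cnj_minus complex_cnj_mult)
    then have "form q [(x, e), (0, 1)] [(x, e), (0, 1)] = q 0 - of_real (cmod (q x)) - of_real (cmod (q x)) + q 0"
      unfolding two ee eq r by simp
    then show ?thesis using nn(1)[of "[(x, e), (0, 1)]"] by simp
  qed
qed

lemma posdef_limit:
  assumes "\<And>n. posdef (f n)" "\<And>x. (\<lambda>n. f n x) \<longlonglongrightarrow> g x"
  shows "posdef g"
  unfolding posdef_def
proof
  fix xs
  have s: "(\<lambda>n. \<Sum>r\<leftarrow>ys. c * cnj (snd r) * f n (y - fst r)) \<longlonglongrightarrow> (\<Sum>r\<leftarrow>ys. c * cnj (snd r) * g (y - fst r))" for ys y c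
    by (induction ys) (auto intro!: tendsto_intros assms)
  have "(\<lambda>n. form (f n) xs ys) \<longlonglongrightarrow> form g xs ys" for ys
    unfolding form_def by (induction xs) (auto intro!: tendsto_intros s)
  then show "form g xs xs \<in> \<real>\<^sub>\<ge>\<^sub>0"
    by (rule closed_sequentially[OF closed_nonneg_Reals_complex, rotated]) (use assms(1) in \<open>auto simp: posdef_def\<close>)
qed

section \<open>Correlation functions and extremal characters\<close>

context haar begin

definition corr :: "('a \<Rightarrow> complex) \<Rightarrow> ('a \<Rightarrow> complex) \<Rightarrow> 'a \<Rightarrow> complex" where
  "corr f g x = (\<integral>z. f (x + z) * cnj (g z) \<partial>H)"

definition coef :: "('a \<Rightarrow> complex) \<Rightarrow> ('a \<Rightarrow> complex) \<Rightarrow> complex" where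
  "coef f \<gamma> = (\<integral>x. f x * cnj (\<gamma> x) \<partial>H)"

lemma corr_cont: "continuous_on UNIV f \<Longrightarrow> continuous_on UNIV g \<Longrightarrow> continuous_on UNIV (corr f g)"
  unfolding corr_def[abs_def]
  by (rule continuous_parameter_integral)
     (auto simp: case_prod_beta' intro!: continuous_intros intro: continuous_on_comp)

lemma corr_0: "corr g g 0 = of_real (n2 g)"
  by (simp add: corr_def n2_eq)

lemma corr_scale: "corr (\<lambda>x. c * f x) g = (\<lambda>x. c * corr f g x)"
  unfolding corr_def[abs_def] by (simp add: mult.assoc)

text \<open>Convolution acts on the first factor alone, so the correlation of an eigenfunction with
  itself is an eigenfunction for the same eigenvalue and moreover positive definite.\<close>

lemma conv_corr:
  assumes "continuous_on UNIV k" "continuous_on UNIV f" "continuous_on UNIV g"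
  shows "conv k (corr f g) = corr (conv k f) g"
proof
  fix x
  have c: "continuous_on UNIV (\<lambda>(y, z). k y * (f (x - y + z) * cnj (g z)))"
    unfolding case_prod_beta'
    by (intro continuous_intros continuous_on_comp[OF assms(1)] continuous_on_comp[OF assms(2)] continuous_on_comp[OF assms(3)])
  have "conv k (corr f g) x = (\<integral>y. (\<integral>z. k y * (f (x - y + z) * cnj (g z)) \<partial>H) \<partial>H)"
    unfolding conv_def corr_def by simp
  also have "\<dots> = (\<integral>z. (\<integral>y. k y * (f (x - y + z) * cnj (g z)) \<partial>H) \<partial>H)" by (rule fubini[OF c])
  also have "\<dots> = (\<integral>z. (\<integral>y. (k y * f (x + z - y)) * cnj (g z) \<partial>H) \<partial>H)"
    by (simp add: algebra_simps)
  also have "\<dots> = corr (conv k f) g x"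
    unfolding corr_def conv_def by simp
  finally show "conv k (corr f g) x = corr (conv k f) g x" .
qed

text \<open>With \<open>P xs\<close> the corresponding combination of translates of
  \<open>g\<close>, invariance turns the form into the integral of the squared modulus of
  \<open>P xs\<close>.\<close>

lemma corr_posdef:
  assumes g: "continuous_on UNIV g"
  shows "posdef (corr g g)"
  unfolding posdef_def
proof
  fix xs
  define P where "P xs z = (\<Sum>p\<leftarrow>xs. snd p * g (fst p + z))" for xs :: "('a \<times> complex) list" and z
  have Pc: "continuous_on UNIV (P xs)" for xs
    unfolding P_def[abs_def] by (induction xs) (auto intro!: continuous_intros intro: continuous_on_comp[OF g])
  have inner: "(\<Sum>r\<leftarrow>ys. c * cnj (snd r) * corr g g (y - fst r)) = (\<integral>z. (c * g (y + z)) * cnj (P ys z) \<partial>H)" for ys y c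
  proof (induction ys)
    case (Cons r ys)
    have cc: "continuous_on UNIV (\<lambda>z. g (y - fst r + z) * cnj (g z))"
      by (intro continuous_intros continuous_on_comp[OF g])
    have i1: "integrable H (\<lambda>z. (c * g (y + z)) * cnj (snd r * g (fst r + z)))"
      by (intro integrable_continuous continuous_intros continuous_on_comp[OF g])
    have i2: "integrable H (\<lambda>z. (c * g (y + z)) * cnj (P ys z))"
      by (intro integrable_continuous continuous_intros continuous_on_comp[OF g] Pc)
    have "corr g g (y - fst r) = (\<integral>z. g (y + z) * cnj (g (fst r + z)) \<partial>H)"
      using invariant[OF cc, of "fst r"] unfolding corr_def by (simp add: algebra_simps)
    then have "c * cnj (snd r) * corr g g (y - fst r) = c * cnj (snd r) * (\<integral>z. g (y + z) * cnj (g (fst r + z)) \<partial>H)" by simp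
    also have "\<dots> = (\<integral>z. c * cnj (snd r) * (g (y + z) * cnj (g (fst r + z))) \<partial>H)" by simp
    also have "\<dots> = (\<integral>z. (c * g (y + z)) * cnj (snd r * g (fst r + z)) \<partial>H)" by (simp only: complex_cnj_mult mult_ac)
    finally show ?case
      using Bochner_Integration.integral_add[OF i1 i2] Cons.IH by (simp add: P_def distrib_left)
  qed (simp add: P_def)
  have outer: "form (corr g g) xs ys = (\<integral>z. P xs z * cnj (P ys z) \<partial>H)" for ys
    unfolding form_def inner
  proof (induction xs)
    case (Cons p xs)
    have i1: "integrable H (\<lambda>z. (snd p * g (fst p + z)) * cnj (P ys z))"
      by (intro integrable_continuous continuous_intros continuous_on_comp[OF g] Pc)
    have i2: "integrable H (\<lambda>z. P xs z * cnj (P ys z))"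
      by (intro integrable_continuous continuous_intros Pc)
    have "(\<lambda>z. P (p # xs) z * cnj (P ys z)) = (\<lambda>z. (snd p * g (fst p + z)) * cnj (P ys z) + P xs z * cnj (P ys z))"
      by (simp add: P_def distrib_right)
    then show ?case using Bochner_Integration.integral_add[OF i1 i2] Cons.IH by simp
  qed (simp add: P_def)
  show "form (corr g g) xs xs \<in> \<real>\<^sub>\<ge>\<^sub>0"
    unfolding outer n2_eq[symmetric] using n2_nonneg by (simp add: complex_nonneg_Reals_iff)
qed

text \<open>The parallelogram identity in weighted form; its last term quantifies the strict
  convexity of the squared norm.\<close>

lemma n2_convex_split:
  assumes u: "continuous_on UNIV u" and v: "continuous_on UNIV v"
  shows "n2 (\<lambda>x. of_real t * u x + of_real (1 - t) * v x) =
     t * n2 u + (1 - t) * n2 v - t * (1 - t) * n2 (\<lambda>x. u x - v x)"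
proof -
  have pt: "(cmod (of_real t * a + of_real (1 - t) * b))\<^sup>2 =
      t * (cmod a)\<^sup>2 + (1 - t) * (cmod b)\<^sup>2 - t * (1 - t) * (cmod (a - b))\<^sup>2" for a b
    unfolding cmod_power2 by (simp add: power2_eq_square algebra_simps)
  have i: "integrable H (\<lambda>x. (cmod (u x))\<^sup>2)" "integrable H (\<lambda>x. (cmod (v x))\<^sup>2)"
    "integrable H (\<lambda>x. (cmod (u x - v x))\<^sup>2)"
    by (intro integrable_continuous continuous_intros u v)+
  show ?thesis unfolding n2_def pt using i by simp
qed

text \<open>
  A normalised positive definite eigenfunction \<open>q\<close> of maximal \<open>L\<^sup>2\<close>-norm exists by compactness, and it is
  extreme by strict convexity. Splitting \<open>q\<close> with \<open>posdef_twist\<close> then makes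
  \<open>e q(x + a) + cnj e q(x - a)\<close> a multiple of \<open>q(x)\<close> whenever \<open>\<bar>e\<bar> = 1\<close>; the cases
  \<open>e = 1\<close> and \<open>e = \<i>\<close> combine to the multiplicativity of \<open>q\<close>.
\<close>

lemma extremal_character:
  assumes k: "continuous_on UNIV k" and g: "continuous_on UNIV g" "n2 g = 1" and m: "m > 0"
    and eig: "\<And>x. conv k (conv k g) x = of_real m * g x"
  obtains \<gamma> where "\<gamma> \<in> characters" "\<And>x. conv k (conv k \<gamma>) x = of_real m * \<gamma> x"
proof -
  let ?T = "conv k"
  obtain K where K: "K > 0" "\<And>x. cmod (k x) \<le> K" using compact_continuous_bounded[OF cpt k] by blast
  define E where "E = {q. continuous_on UNIV q \<and> posdef q \<and> (\<forall>x. ?T (?T q) x = of_real m * q x)}"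
  define P where "P = {q \<in> E. q 0 = 1}"
  have E_scale: "(\<lambda>x. of_real c * q x) \<in> E" if "q \<in> E" "c \<ge> 0" for c q
    using that by (auto simp: E_def conv_scale posdef_scale intro!: continuous_intros)
  have Pb: "cmod (q x) \<le> 1" if "q \<in> P" for q x
    using that posdef_props(4)[of q x] by (simp add: P_def E_def)
  have Pn2: "n2 q \<le> 1" if "q \<in> P" for q
    using n2_le[of q 1] Pb[OF that] that by (simp add: P_def E_def)
  have "corr g g \<in> P"
  proof -
    have "?T (?T (corr g g)) = corr (?T (?T g)) g" using k g by (simp add: conv_corr conv_cont)
    also have "?T (?T g) = (\<lambda>x. of_real m * g x)" using eig by auto
    finally show ?thesis using g by (simp add: P_def E_def corr_cont corr_posdef corr_0 corr_scale)
  qed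
  then have Pne: "P \<noteq> {}" by blast
  have bdd: "bdd_above (n2 ` P)" using Pn2 by (intro bdd_aboveI2[of _ _ 1])
  define S where "S = (SUP q\<in>P. n2 q)"
  have S_ge: "n2 q \<le> S" if "q \<in> P" for q unfolding S_def using that bdd by (rule cSUP_upper)
  have "\<exists>q\<in>P. S - inverse (real (Suc n)) < n2 q" for n
    unfolding S_def less_cSUP_iff[OF Pne bdd, symmetric] by simp
  then obtain f where f: "\<And>n. f n \<in> P" "\<And>n. S - inverse (real (Suc n)) < n2 (f n)" by metis
  have fc: "continuous_on UNIV (f n)" for n using f(1)[of n] by (simp add: P_def E_def)
  \<comment> \<open>Members of \<open>P\<close> equal \<open>1 / m\<close> times the operator
    applied twice to themselves, and after one application they are bounded by \<open>K\<close>. The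
    smoothing of the kernel therefore makes \<open>P\<close> equicontinuous, with
    \<open>m * e / K\<close> chosen to undo both constants.\<close>
  have eq: "\<exists>U. open U \<and> 0 \<in> U \<and> (\<forall>n x x'. x - x' \<in> U \<longrightarrow> dist (f n x) (f n x') \<le> e)" if e: "e > 0" for e
  proof -
    have "m * e / K > 0" using e m K by simp
    from conv_equicontinuous[OF k(1) this] obtain U where U: "open U" "0 \<in> U"
      "\<forall>f B x x'. continuous_on UNIV f \<longrightarrow> (\<forall>x. cmod (f x) \<le> B) \<longrightarrow> x - x' \<in> U \<longrightarrow>
         dist (?T f x) (?T f x') \<le> m * e / K * B" by blast
    have "dist (f n x) (f n x') \<le> e" if x: "x - x' \<in> U" for n x x'
    proof -
      have b: "\<forall>x. cmod (?T (f n) x) \<le> K"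
      proof
        fix x show "cmod (?T (f n) x) \<le> K" using conv_bound[OF k fc K(2) Pb[OF f(1)]] by simp
      qed
      have "dist (?T (?T (f n)) x) (?T (?T (f n)) x') \<le> m * e / K * K"
        using U(3) conv_cont[OF k fc[of n]] b x by blast
      then have "cmod (of_real m * f n x - of_real m * f n x') \<le> m * e"
        using f(1)[of n] K by (simp add: P_def E_def dist_norm)
      then have "m * cmod (f n x - f n x') \<le> m * e"
        using m by (simp add: norm_mult flip: right_diff_distrib)
      then show ?thesis using m by (simp add: dist_norm)
    qed
    with U(1,2) show ?thesis by blast
  qed
  obtain r q where rq: "strict_mono (r :: nat \<Rightarrow> nat)"
    "uniform_limit UNIV (\<lambda>n. f (r n)) q sequentially" "continuous_on UNIV q"
    by (rule arzela_ascoli_group[of f, OF cpt Pb[OF f(1)] eq])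
  have pt: "(\<lambda>n. f (r n) x) \<longlonglongrightarrow> q x" for x by (rule tendsto_uniform_limitI[OF rq(2)]) simp
  have q1: "q 0 = 1"
    using pt[of 0] f(1) by (simp add: P_def LIMSEQ_const_iff)
  have qE: "q \<in> E" unfolding E_def
  proof (intro CollectI conjI allI)
    show "continuous_on UNIV q" by fact
    show "posdef q" using f(1) by (intro posdef_limit[OF _ pt]) (simp add: P_def E_def)
    fix x
    have "uniform_limit UNIV (\<lambda>n. ?T (?T (f (r n)))) (?T (?T q)) sequentially"
      by (intro conv_uniform_limit conv_cont k fc rq)
    then have "(\<lambda>n. ?T (?T (f (r n))) x) \<longlonglongrightarrow> ?T (?T q) x" by (rule tendsto_uniform_limitI) simp
    moreover have "(\<lambda>n. of_real m * f (r n) x) \<longlonglongrightarrow> of_real m * q x" by (intro tendsto_intros pt)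
    moreover have "?T (?T (f (r n))) x = of_real m * f (r n) x" for n using f(1) by (simp add: P_def E_def)
    ultimately show "?T (?T q) x = of_real m * q x" using LIMSEQ_unique by simp
  qed
  have n2q: "n2 q = S"
  proof (rule antisym)
    show "n2 q \<le> S" using qE q1 by (intro S_ge) (simp add: P_def)
    have "(\<lambda>n. S - inverse (real (Suc (r n)))) \<longlonglongrightarrow> S - 0"
      using LIMSEQ_subseq_LIMSEQ[OF LIMSEQ_inverse_real_of_nat rq(1)] by (intro tendsto_intros) (simp add: o_def)
    moreover have "(\<lambda>n. n2 (f (r n))) \<longlonglongrightarrow> n2 q" by (intro n2_limit fc rq)
    ultimately show "S \<le> n2 q" using f(2) by (intro LIMSEQ_le[of _ "S" _ "n2 q"]) (auto intro: less_imp_le)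
  qed
  \<comment> \<open>Unless one part vanishes, the parts are \<open>t\<close> and
    \<open>1 - t\<close> times members \<open>u\<close>, \<open>v\<close> of \<open>P\<close>. Since
    \<open>n2 q = S\<close> is maximal while \<open>n2 u\<close> and \<open>n2 v\<close> are at most
    \<open>S\<close>, the convexity defect is zero, so \<open>u\<close>, \<open>v\<close> and
    \<open>q\<close> coincide.\<close>
  have extreme: "p1 x = p1 0 * q x" if p: "p1 \<in> E" "p2 \<in> E" "\<And>x. p1 x + p2 x = q x" for p1 p2 x
  proof -
    have pd: "posdef p1" "posdef p2" and pc: "continuous_on UNIV p1" "continuous_on UNIV p2"
      using p by (simp_all add: E_def)
    define t where "t = Re (p1 0)"
    have p10: "p1 0 = of_real t" using posdef_props(1)[OF pd(1)] by (simp add: t_def complex_eq_iff)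
    have p20: "p2 0 = of_real (1 - t)" using p(3)[of 0] q1 p10 by (simp add: algebra_simps)
    have t: "0 \<le> t" "t \<le> 1" using posdef_props(2)[OF pd(1)] posdef_props(2)[OF pd(2)] p10 p20 by auto
    consider "t = 0" | "t = 1" | "0 < t" "t < 1" using t by linarith
    then show ?thesis
    proof cases
      case 1 then show ?thesis using posdef_props(4)[OF pd(1), of x] p10 by simp
    next
      case 2 then show ?thesis using posdef_props(4)[OF pd(2), of x] p10 p20 p(3)[of x] by simp
    next
      case 3
      define u where "u x = of_real (1 / t) * p1 x" for x
      define v where "v x = of_real (1 / (1 - t)) * p2 x" for x
      have uP: "u \<in> P" and vP: "v \<in> P"
        unfolding P_def u_def[abs_def] v_def[abs_def]
        using E_scale[OF p(1), of "1 / t"] E_scale[OF p(2), of "1 / (1 - t)"] 3 p10 p20 by auto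
      have uv: "continuous_on UNIV u" "continuous_on UNIV v" using uP vP by (simp_all add: P_def E_def)
      have p1u: "p1 x = of_real t * u x" and p2v: "p2 x = of_real (1 - t) * v x" for x
        using 3 by (simp_all add: u_def v_def)
      have "q = (\<lambda>x. of_real t * u x + of_real (1 - t) * v x)"
        using p(3) p1u p2v by auto
      then have "S = t * n2 u + (1 - t) * n2 v - t * (1 - t) * n2 (\<lambda>x. u x - v x)"
        using n2_convex_split[OF uv, of t] n2q by simp
      moreover have "t * n2 u \<le> t * S" "(1 - t) * n2 v \<le> (1 - t) * S"
        using S_ge[OF uP] S_ge[OF vP] t by (auto intro: mult_left_mono)
      ultimately have "t * (1 - t) * n2 (\<lambda>x. u x - v x) \<le> 0" by (simp add: algebra_simps)
      then have "n2 (\<lambda>x. u x - v x) = 0"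
        using 3 n2_nonneg[of "\<lambda>x. u x - v x"] by (simp add: mult_le_0_iff)
      then have "u x - v x = 0" by (rule n2_eq_0[rotated]) (intro continuous_intros uv)
      then have "q x = u x" using p(3)[of x] p1u[of x] p2v[of x] by (simp add: algebra_simps)
      then show ?thesis using p1u p10 by simp
    qed
  qed
  have qc: "continuous_on UNIV q" and qp: "posdef q" and qT: "\<And>x. ?T (?T q) x = of_real m * q x"
    using qE by (simp_all add: E_def)
  have twist: "e * q (x + a) + cnj e * q (x - a) = (e * q a + cnj e * q (- a)) * q x" if e: "cmod e = 1" for e a x
  proof -
    \<comment> \<open>The twists by \<open>e\<close> and \<open>- e\<close> cancel in
      \<open>A e + A (- e)\<close>, and the factor 1/4 makes this sum equal to
      \<open>q\<close>.\<close>
    define A where "A e z = (1/4) * (2 * q z + (e * q (z + a) + cnj e * q (z - a)))" for e z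
    have AE: "A e \<in> E" if e: "cmod e = 1" for e
    proof -
      define c where "c = (\<lambda>z. 2 * q z + (e * q (z + a) + cnj e * q (z - a)))"
      have cc: "continuous_on UNIV c" unfolding c_def by (intro continuous_intros continuous_on_comp[OF qc])
      have t1: "?T (\<lambda>z. q (z + a)) = (\<lambda>z. ?T q (z + a))" by (rule conv_translate)
      have t2: "?T (\<lambda>z. q (z - a)) = (\<lambda>z. ?T q (z - a))" using conv_translate[of k q "- a"] by simp
      have t3: "?T (\<lambda>z. ?T q (z + a)) = (\<lambda>z. ?T (?T q) (z + a))" by (rule conv_translate)
      have t4: "?T (\<lambda>z. ?T q (z - a)) = (\<lambda>z. ?T (?T q) (z - a))" using conv_translate[of k "?T q" "- a"] by simp
      have c1: "continuous_on UNIV (\<lambda>z. q (z + a))" "continuous_on UNIV (\<lambda>z. q (z - a))"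
        by (intro continuous_intros continuous_on_comp[OF qc])+
      have Tq: "continuous_on UNIV (?T q)" by (rule conv_cont[OF k qc])
      have c2: "continuous_on UNIV (\<lambda>z. ?T q (z + a))" "continuous_on UNIV (\<lambda>z. ?T q (z - a))"
        by (intro continuous_intros continuous_on_comp[OF Tq])+
      have "?T c = (\<lambda>z. 2 * ?T q z + (e * ?T q (z + a) + cnj e * ?T q (z - a)))"
        unfolding c_def
        by (simp add: conv_add[OF k] conv_scale t1 t2 continuous_on_mult_left continuous_on_add qc c1)
      then have "?T (?T c) = (\<lambda>z. 2 * ?T (?T q) z + (e * ?T (?T q) (z + a) + cnj e * ?T (?T q) (z - a)))"
        by (simp add: conv_add[OF k] conv_scale t3 t4 continuous_on_mult_left continuous_on_add Tq c2)
      then have "?T (?T c) x = of_real m * c x" for x unfolding qT by (simp add: c_def algebra_simps)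
      then have "c \<in> E" using cc posdef_twist[OF qp e, of a] by (simp add: E_def c_def)
      from E_scale[OF this, of "1/4"] show ?thesis by (simp add: A_def[abs_def] c_def)
    qed
    have "A e x = A e 0 * q x"
    proof (rule extreme[of "A e" "A (- e)"])
      show "A e \<in> E" "A (- e) \<in> E" using AE e by simp_all
      show "A e x + A (- e) x = q x" for x by (simp add: A_def field_simps)
    qed
    then have "4 * A e x = (4 * A e 0) * q x" by simp
    moreover have A4: "4 * A e z = 2 * q z + (e * q (z + a) + cnj e * q (z - a))" for z by (simp add: A_def)
    ultimately have "2 * q x + (e * q (x + a) + cnj e * q (x - a)) =
        (2 * q 0 + (e * q (0 + a) + cnj e * q (0 - a))) * q x"
      unfolding A4 by simp
    then show ?thesis by (simp add: q1 algebra_simps)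
  qed
  have mult: "q (x + a) = q a * q x" for x a
  proof -
    have 1: "q (x + a) + q (x - a) = (q a + q (- a)) * q x" using twist[of 1 x a] by simp
    have "\<i> * (q (x + a) - q (x - a)) = \<i> * ((q a - q (- a)) * q x)"
      using twist[of \<i> x a] by (simp add: algebra_simps)
    then have 2: "q (x + a) - q (x - a) = (q a - q (- a)) * q x" by simp
    have "2 * q (x + a) = (q (x + a) + q (x - a)) + (q (x + a) - q (x - a))" by simp
    also have "\<dots> = 2 * (q a * q x)" unfolding 1 2 by (simp add: algebra_simps)
    finally show ?thesis by simp
  qed
  have unit: "cmod (q x) = 1" for x
  proof -
    have "q x * q (- x) = 1" using mult[of "- x" x] q1 by simp
    then have "cmod (q x * cnj (q x)) = 1" by (simp add: posdef_props(3)[OF qp])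
    then have "(cmod (q x))\<^sup>2 = 1" by (simp add: norm_mult power2_eq_square)
    then show ?thesis using norm_ge_zero[of "q x"] by (auto simp: power2_eq_1_iff simp del: norm_ge_zero)
  qed
  have "q \<in> characters" unfolding characters_def
    using qc unit mult by (auto simp: mult.commute)
  then show ?thesis using qT by (rule that)
qed

lemma characterD:
  assumes "\<gamma> \<in> characters"
  shows "continuous_on UNIV \<gamma>" "cmod (\<gamma> x) = 1" "\<gamma> (x + y) = \<gamma> x * \<gamma> y" "\<gamma> 0 = 1"
    "\<gamma> (- x) = cnj (\<gamma> x)" "\<gamma> (x - y) = \<gamma> x * cnj (\<gamma> y)"
proof -
  have c: "continuous_on UNIV \<gamma>" and n: "\<And>x. cmod (\<gamma> x) = 1" and m: "\<And>x y. \<gamma> (x + y) = \<gamma> x * \<gamma> y"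
    using assms by (auto simp: characters_def)
  have "\<gamma> 0 = \<gamma> 0 * \<gamma> 0" using m[of 0 0] by simp
  moreover have "\<gamma> 0 \<noteq> 0" using n[of 0] by auto
  ultimately have z: "\<gamma> 0 = 1" by simp
  have i: "\<gamma> (- x) = cnj (\<gamma> x)" for x
  proof -
    have "\<gamma> x * \<gamma> (- x) = 1" using m[of x "- x"] z by simp
    moreover have "\<gamma> x * cnj (\<gamma> x) = 1" using n[of x] by (simp add: complex_norm_square[symmetric])
    moreover have "\<gamma> x \<noteq> 0" using n[of x] by auto
    ultimately show ?thesis by (metis mult_left_cancel)
  qed
  show "continuous_on UNIV \<gamma>" "cmod (\<gamma> x) = 1" "\<gamma> (x + y) = \<gamma> x * \<gamma> y" "\<gamma> 0 = 1"
    "\<gamma> (- x) = cnj (\<gamma> x)" by (fact c n m z i)+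
  show "\<gamma> (x - y) = \<gamma> x * cnj (\<gamma> y)" using m[of x "- y"] i by simp
qed

lemma conv_character: "\<gamma> \<in> characters \<Longrightarrow> conv k \<gamma> = (\<lambda>x. coef k \<gamma> * \<gamma> x)"
  unfolding conv_def[abs_def] coef_def by (simp add: characterD mult.left_commute mult.commute)

text \<open>A character is an eigenfunction of convolution by \<open>k\<close> with its Fourier
  coefficient as eigenvalue. The character found in the eigenspace of the square with eigenvalue
  \<open>m > 0\<close> thus has nonzero coefficient.\<close>

lemma hermitian_coef:
  assumes k: "continuous_on UNIV k" "\<And>x. k (- x) = cnj (k x)" and ne: "k z \<noteq> 0"
  obtains \<gamma> where "\<gamma> \<in> characters" "coef k \<gamma> \<noteq> 0"
proof -
  obtain g m where g: "continuous_on UNIV g" "n2 g = 1" "m > 0" "\<And>x. conv k (conv k g) x = of_real m * g x"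
    using conv_eigenfunction[OF k ne] by metis
  obtain \<gamma> where chi: "\<gamma> \<in> characters" "\<And>x. conv k (conv k \<gamma>) x = of_real m * \<gamma> x"
    using extremal_character[OF k(1) g] by metis
  have "coef k \<gamma> \<noteq> 0"
  proof
    assume "coef k \<gamma> = 0"
    then have "conv k (conv k \<gamma>) 0 = 0" by (simp add: conv_character[OF chi(1)] conv_def[of _ "\<lambda>_. 0"])
    then show False using chi(2)[of 0] characterD(4)[OF chi(1)] g(3) by simp
  qed
  then show ?thesis using that chi(1) by blast
qed

lemma coef_translate:
  assumes f: "continuous_on UNIV f" and chi: "\<gamma> \<in> characters"
  shows "coef (\<lambda>x. f (x + z)) \<gamma> = \<gamma> z * coef f \<gamma>"
proof -
  have "continuous_on UNIV (\<lambda>x. f x * cnj (\<gamma> (x - z)))"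
    by (intro continuous_intros continuous_on_comp[OF f] continuous_on_comp[OF characterD(1)[OF chi]])
  from invariant[OF this, of z] have "coef (\<lambda>x. f (x + z)) \<gamma> = (\<integral>x. f x * cnj (\<gamma> (x - z)) \<partial>H)"
    by (simp add: coef_def)
  also have "\<dots> = (\<integral>x. \<gamma> z * (f x * cnj (\<gamma> x)) \<partial>H)" by (simp add: characterD(6)[OF chi] mult_ac)
  finally show ?thesis by (simp add: coef_def)
qed

text \<open>The eigenfunction argument needs a Hermitian kernel, so \<open>f\<close> is replaced by
  its autocorrelation, which is Hermitian and nonzero at 0. Its coefficient at \<gamma> is the
  squared modulus of that of \<open>f\<close>.\<close>

lemma coef_nonzero:
  assumes f: "continuous_on UNIV f" and ne: "f z \<noteq> 0"
  obtains \<gamma> where "\<gamma> \<in> characters" "coef f \<gamma> \<noteq> 0"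
proof -
  have herm: "corr f f (- x) = cnj (corr f f x)" for x
    using posdef_props(3)[OF corr_posdef[OF f]] .
  have "n2 f \<noteq> 0" using n2_eq_0[OF f, of z] ne by blast
  then have ne0: "corr f f 0 \<noteq> 0" by (simp add: corr_0)
  obtain \<gamma> where chi: "\<gamma> \<in> characters" "coef (corr f f) \<gamma> \<noteq> 0"
    using hermitian_coef[OF corr_cont[OF f f] herm ne0] by metis
  have c: "continuous_on UNIV (\<lambda>(x, z). f (x + z) * cnj (f z) * cnj (\<gamma> x))"
    unfolding case_prod_beta'
    by (intro continuous_intros continuous_on_comp[OF f] continuous_on_comp[OF characterD(1)[OF chi(1)]])
  have "coef (corr f f) \<gamma> = (\<integral>x. (\<integral>z. f (x + z) * cnj (f z) * cnj (\<gamma> x) \<partial>H) \<partial>H)"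
    unfolding coef_def corr_def by simp
  also have "\<dots> = (\<integral>z. (\<integral>x. f (x + z) * cnj (f z) * cnj (\<gamma> x) \<partial>H) \<partial>H)" by (rule fubini[OF c])
  also have "\<dots> = (\<integral>z. cnj (f z) * coef (\<lambda>x. f (x + z)) \<gamma> \<partial>H)"
    unfolding coef_def by (simp add: mult_ac flip: integral_mult_right_zero)
  also have "\<dots> = (\<integral>z. coef f \<gamma> * cnj (f z * cnj (\<gamma> z)) \<partial>H)"
    by (simp add: coef_translate[OF f chi(1)] mult_ac)
  also have "\<dots> = coef f \<gamma> * cnj (coef f \<gamma>)"
    unfolding coef_def by (simp del: complex_cnj_mult flip: integral_cnj)
  finally show ?thesis using that chi by auto
qed

end

section \<open>Invariant algebras are spanned by their characters\<close>

definition trig :: "('a \<Rightarrow> complex) set \<Rightarrow> ('a \<Rightarrow> complex) set" where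
  "trig S = {p. \<exists>F c. finite F \<and> F \<subseteq> S \<and> p = (\<lambda>x. \<Sum>\<gamma>\<in>F. c \<gamma> * \<gamma> x)}"

text \<open>Coefficient functions are arbitrary off their frequency sets, so each is cut to its own
  set before the two are added on the union.\<close>

lemma merge_combinations:
  fixes c d :: "'b \<Rightarrow> 'c::comm_ring_1"
  assumes "finite F" "finite G"
  shows "(\<Sum>\<gamma>\<in>F \<union> G. ((if \<gamma> \<in> F then c \<gamma> else 0) + (if \<gamma> \<in> G then d \<gamma> else 0)) * g \<gamma>) =
    (\<Sum>\<gamma>\<in>F. c \<gamma> * g \<gamma>) + (\<Sum>\<gamma>\<in>G. d \<gamma> * g \<gamma>)"
proof -
  have 1: "(\<Sum>\<gamma>\<in>F \<union> G. (if \<gamma> \<in> F then c \<gamma> else 0) * g \<gamma>) = (\<Sum>\<gamma>\<in>F. c \<gamma> * g \<gamma>)"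
    using assms by (intro sum.mono_neutral_cong_right) auto
  have 2: "(\<Sum>\<gamma>\<in>F \<union> G. (if \<gamma> \<in> G then d \<gamma> else 0) * g \<gamma>) = (\<Sum>\<gamma>\<in>G. d \<gamma> * g \<gamma>)"
    using assms by (intro sum.mono_neutral_cong_right) auto
  show ?thesis by (simp add: distrib_right sum.distrib 1 2)
qed

lemma trig_zero: "(\<lambda>x. 0) \<in> trig S"
  unfolding trig_def by (intro CollectI exI[of _ "{}"]) auto

lemma trig_base: "\<gamma> \<in> S \<Longrightarrow> (\<lambda>x. c * \<gamma> x) \<in> trig S"
  unfolding trig_def by (intro CollectI exI[of _ "{\<gamma>}"] exI[of _ "\<lambda>_. c"]) auto

lemma trig_add:
  assumes "p \<in> trig S" "q \<in> trig S"
  shows "(\<lambda>x. p x + q x) \<in> trig S"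
proof -
  obtain F c G d where F: "finite F" "F \<subseteq> S" "p = (\<lambda>x. \<Sum>\<gamma>\<in>F. c \<gamma> * \<gamma> x)"
    and G: "finite G" "G \<subseteq> S" "q = (\<lambda>x. \<Sum>\<gamma>\<in>G. d \<gamma> * \<gamma> x)"
    using assms by (auto simp: trig_def)
  show ?thesis unfolding trig_def
    by (intro CollectI exI[of _ "F \<union> G"] exI[of _ "\<lambda>\<gamma>. (if \<gamma> \<in> F then c \<gamma> else 0) + (if \<gamma> \<in> G then d \<gamma> else 0)"])
       (use F G in \<open>auto simp: merge_combinations\<close>)
qed

lemma trig_sum: "finite I \<Longrightarrow> (\<And>i. i \<in> I \<Longrightarrow> p i \<in> trig S) \<Longrightarrow> (\<lambda>x. \<Sum>i\<in>I. p i x) \<in> trig S"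
  by (induction I rule: finite_induct) (auto intro: trig_zero trig_add)

lemma trig_scale:
  assumes "p \<in> trig S"
  shows "(\<lambda>x. c * p x) \<in> trig S"
proof -
  obtain F d where F: "finite F" "F \<subseteq> S" "p = (\<lambda>x. \<Sum>\<gamma>\<in>F. d \<gamma> * \<gamma> x)"
    using assms by (auto simp: trig_def)
  show ?thesis unfolding trig_def
    by (intro CollectI exI[of _ F] exI[of _ "\<lambda>\<gamma>. c * d \<gamma>"]) (use F in \<open>auto simp: sum_distrib_left mult.assoc\<close>)
qed

lemma trig_mult:
  assumes "p \<in> trig S" "q \<in> trig S" and S: "\<And>\<gamma> \<delta>. \<gamma> \<in> S \<Longrightarrow> \<delta> \<in> S \<Longrightarrow> (\<lambda>x. \<gamma> x * \<delta> x) \<in> S"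
  shows "(\<lambda>x. p x * q x) \<in> trig S"
proof -
  obtain F c G d where F: "finite F" "F \<subseteq> S" "p = (\<lambda>x. \<Sum>\<gamma>\<in>F. c \<gamma> * \<gamma> x)"
    and G: "finite G" "G \<subseteq> S" "q = (\<lambda>x. \<Sum>\<gamma>\<in>G. d \<gamma> * \<gamma> x)"
    using assms(1,2) by (auto simp: trig_def)
  have "(\<lambda>x. \<Sum>\<gamma>\<in>F. \<Sum>\<delta>\<in>G. (c \<gamma> * d \<delta>) * (\<gamma> x * \<delta> x)) \<in> trig S"
    using F G S by (intro trig_sum trig_base[where \<gamma> = "\<lambda>x. _ x * _ x"]) auto
  then show ?thesis by (simp add: F(3) G(3) sum_product mult_ac)
qed

lemma characters_mult: "\<gamma> \<in> characters \<Longrightarrow> \<delta> \<in> characters \<Longrightarrow> (\<lambda>x. \<gamma> x * \<delta> x) \<in> characters"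
  by (auto simp: characters_def norm_mult intro: continuous_on_mult)

lemma characters_cnj: "\<gamma> \<in> characters \<Longrightarrow> (\<lambda>x. cnj (\<gamma> x)) \<in> characters"
  by (auto simp: characters_def intro: continuous_on_cnj)

lemma characters_one: "(\<lambda>x. 1) \<in> characters"
  by (auto simp: characters_def)

section \<open>Closure properties of invariant algebras\<close>

lemma invariant_algebraD:
  assumes "invariant_algebra A"
  shows "f \<in> A \<Longrightarrow> continuous_on UNIV f" "(\<lambda>x. c) \<in> A" "f \<in> A \<Longrightarrow> g \<in> A \<Longrightarrow> (\<lambda>x. f x + g x) \<in> A"
    "f \<in> A \<Longrightarrow> g \<in> A \<Longrightarrow> (\<lambda>x. f x * g x) \<in> A" "f \<in> A \<Longrightarrow> (\<lambda>x. c * f x) \<in> A"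
    "f \<in> A \<Longrightarrow> (\<lambda>x. f (x + a)) \<in> A"
  using assms by (auto simp: invariant_algebra_def)

lemma invariant_algebra_sum:
  assumes "invariant_algebra A"
  shows "finite I \<Longrightarrow> (\<And>i. i \<in> I \<Longrightarrow> f i \<in> A) \<Longrightarrow> (\<lambda>x. \<Sum>i\<in>I. f i x) \<in> A"
  by (induction I rule: finite_induct) (auto intro: invariant_algebraD[OF assms])

lemma uniform_limit_inverse:
  fixes g :: "nat \<Rightarrow> 'a \<Rightarrow> complex"
  assumes g: "\<And>n x. cmod (f x - g n x) \<le> inverse (real (Suc n))"
  shows "uniform_limit UNIV g f sequentially"
proof (rule uniform_limitI)
  fix e :: real assume "e > 0"
  then have "\<forall>\<^sub>F n in sequentially. inverse (real (Suc n)) < e"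
    by (rule order_tendstoD(2)[OF LIMSEQ_inverse_real_of_nat])
  then show "\<forall>\<^sub>F n in sequentially. \<forall>x\<in>UNIV. dist (g n x) (f x) < e"
  proof (rule eventually_mono, intro ballI)
    fix n x assume "inverse (real (Suc n)) < e"
    with g[of x n] show "dist (g n x) (f x) < e" by (simp add: dist_norm norm_minus_commute)
  qed
qed

text \<open>Closedness is postulated in the type of bounded continuous functions; this is its form
  for plain functions. Continuity of \<open>f\<close> is a consequence of the approximation.\<close>

lemma invariant_algebra_closed:
  fixes A :: "('a::topological_ab_group_add \<Rightarrow> complex) set"
  assumes cpt: "compact (UNIV :: 'a set)" and A: "invariant_algebra A"
    and approx: "\<And>e. e > 0 \<Longrightarrow> \<exists>g\<in>A. \<forall>x. cmod (f x - g x) \<le> e"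
  shows "f \<in> A"
proof -
  have "\<exists>g\<in>A. \<forall>x. cmod (f x - g x) \<le> inverse (real (Suc n))" for n by (rule approx) simp
  then obtain g where g: "\<And>n. g n \<in> A" "\<And>n x. cmod (f x - g n x) \<le> inverse (real (Suc n))" by metis
  have inv0: "(\<lambda>n. inverse (real (Suc n))) \<longlonglongrightarrow> 0" by (rule LIMSEQ_inverse_real_of_nat)
  have lim: "uniform_limit UNIV g f sequentially" by (rule uniform_limit_inverse) (rule g)
  have gc: "continuous_on UNIV (g n)" for n using g(1) by (rule invariant_algebraD[OF A])
  have fc: "continuous_on UNIV f" by (rule uniform_limit_theorem[OF _ lim]) (use gc in auto)
  have bc: "u \<in> bcontfun" if "continuous_on UNIV u" for u :: "'a \<Rightarrow> complex"
    using that compact_imp_bounded[OF compact_continuous_image[OF that cpt]]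
    by (simp add: bcontfun_def)
  have ap: "apply_bcontfun (Bcontfun u) = u" if "continuous_on UNIV u" for u :: "'a \<Rightarrow> complex"
    using bc[OF that] by (rule Bcontfun_inverse)
  have lim': "(\<lambda>n. Bcontfun (g n)) \<longlonglongrightarrow> Bcontfun f"
  proof (rule metric_LIMSEQ_I)
    fix e :: real assume "e > 0"
    then have "\<forall>\<^sub>F n in sequentially. inverse (real (Suc n)) < e" by (rule order_tendstoD(2)[OF inv0])
    then obtain M where M: "\<And>n. n \<ge> M \<Longrightarrow> inverse (real (Suc n)) < e" unfolding eventually_sequentially by blast
    have d: "dist (Bcontfun (g n)) (Bcontfun f) \<le> inverse (real (Suc n))" for n
      using g(2)[of _ n] by (intro dist_bound) (simp add: ap gc fc dist_norm norm_minus_commute)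
    show "\<exists>M. \<forall>n\<ge>M. dist (Bcontfun (g n)) (Bcontfun f) < e"
      by (intro exI[of _ M] allI impI le_less_trans[OF d M])
  qed
  have cl: "closed (apply_bcontfun -` A :: ('a \<Rightarrow>\<^sub>C complex) set)" using A by (simp add: invariant_algebra_def)
  have "Bcontfun (g n) \<in> apply_bcontfun -` A" for n using g(1) ap[OF gc] by simp
  then have "Bcontfun f \<in> apply_bcontfun -` A" by (rule closed_sequentially[OF cl _ lim'])
  then show ?thesis using ap[OF fc] by simp
qed

lemma Sp_mult: "invariant_algebra A \<Longrightarrow> \<gamma> \<in> Sp A \<Longrightarrow> \<delta> \<in> Sp A \<Longrightarrow> (\<lambda>x. \<gamma> x * \<delta> x) \<in> Sp A"
  by (auto simp: Sp_def characters_mult invariant_algebraD)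

lemma Sp_one: "invariant_algebra A \<Longrightarrow> (\<lambda>x. 1) \<in> Sp A"
  by (auto simp: Sp_def characters_one invariant_algebraD)

lemma trig_subset_algebra:
  assumes A: "invariant_algebra A"
  shows "trig (Sp A) \<subseteq> A"
  by (auto simp: trig_def Sp_def intro!: invariant_algebra_sum[OF A] invariant_algebraD(5)[OF A])

section \<open>Fourier approximation inside the algebra\<close>

context haar begin

lemma trig_continuous: "p \<in> trig characters \<Longrightarrow> continuous_on UNIV p"
  by (auto simp: trig_def intro!: continuous_intros intro: characterD(1))

lemma coef_diff:
  assumes "continuous_on UNIV f" "continuous_on UNIV g" "\<gamma> \<in> characters"
  shows "coef (\<lambda>x. f x - g x) \<gamma> = coef f \<gamma> - coef g \<gamma>"
  unfolding coef_def left_diff_distrib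
  by (intro Bochner_Integration.integral_diff integrable_continuous continuous_intros assms characterD)

text \<open>For a continuous \<open>f\<close> with different values at 0 and \<open>a\<close>, the
  difference \<open>f (x + a) - f x\<close> has a nonzero coefficient at some \<gamma>, and that
  coefficient carries the factor \<open>\<gamma> a - 1\<close>.\<close>

lemma characters_separate:
  fixes a :: 'a
  assumes "a \<noteq> 0"
  obtains \<gamma> where "\<gamma> \<in> characters" "\<gamma> a \<noteq> 1"
proof -
  obtain f :: "'a \<Rightarrow> real" where f: "continuous_on UNIV f" "f 0 = 0" "f a = 1"
    using urysohn_compact[OF cpt, of "{0}" "{a}"] assms by auto
  let ?f = "\<lambda>x. complex_of_real (f x)"
  have c: "continuous_on UNIV ?f" using f by (intro continuous_intros)
  define d where "d = (\<lambda>x. ?f (x + a) - ?f x)"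
  have dc: "continuous_on UNIV d" unfolding d_def by (intro continuous_on_diff continuous_translate c)
  have "d 0 \<noteq> 0" using f by (simp add: d_def)
  then obtain \<gamma> where "\<gamma> \<in> characters" "coef d \<gamma> \<noteq> 0" by (rule coef_nonzero[OF dc])
  then have g: "\<gamma> \<in> characters" "coef (\<lambda>x. ?f (x + a) - ?f x) \<gamma> \<noteq> 0" by (simp_all add: d_def)
  have "coef (\<lambda>x. ?f (x + a) - ?f x) \<gamma> = (\<gamma> a - 1) * coef ?f \<gamma>"
    by (simp only: coef_diff[OF continuous_translate[OF c] c g(1)] coef_translate[OF c g(1)] left_diff_distrib mult_1)
  with g(2) have "\<gamma> a \<noteq> 1" by auto
  with g(1) show ?thesis by (rule that)
qed

text \<open>Real Stone-Weierstrass for the real-valued trigonometric polynomials: conjugates of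
  characters are characters, so real and imaginary parts belong to the ring and inherit point
  separation.\<close>

lemma trig_dense_real:
  fixes f :: "'a \<Rightarrow> real"
  assumes f: "continuous_on UNIV f" and e: "e > 0"
  shows "\<exists>p\<in>trig characters. \<forall>x. cmod (of_real (f x) - p x) \<le> e"
proof -
  define R where "R = {u :: 'a \<Rightarrow> real. (\<lambda>x. complex_of_real (u x)) \<in> trig characters}"
  have cR: "(\<lambda>x. c) \<in> R" for c
    using trig_base[OF characters_one, of "of_real c"] by (simp add: R_def)
  have ReIm: "(\<lambda>x. Re (\<gamma> x)) \<in> R" "(\<lambda>x. Im (\<gamma> x)) \<in> R" if "\<gamma> \<in> characters" for \<gamma> :: "'a \<Rightarrow> complex"
  proof -
    have "(\<lambda>x. (1/2) * \<gamma> x + (1/2) * cnj (\<gamma> x)) \<in> trig characters"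
      using that characters_cnj[OF that] by (intro trig_add trig_base)
    moreover have "(\<lambda>x. (1/2) * \<gamma> x + (1/2) * cnj (\<gamma> x)) = (\<lambda>x. of_real (Re (\<gamma> x)))"
      by (auto simp: complex_eq_iff)
    ultimately show "(\<lambda>x. Re (\<gamma> x)) \<in> R" by (simp add: R_def)
    have "(\<lambda>x. (- \<i> / 2) * \<gamma> x + (\<i> / 2) * cnj (\<gamma> x)) \<in> trig characters"
      using that characters_cnj[OF that] by (intro trig_add trig_base)
    moreover have "(\<lambda>x. (- \<i> / 2) * \<gamma> x + (\<i> / 2) * cnj (\<gamma> x)) = (\<lambda>x. of_real (Im (\<gamma> x)))"
      by (auto simp: complex_eq_iff)
    ultimately show "(\<lambda>x. Im (\<gamma> x)) \<in> R" by (simp add: R_def)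
  qed
  interpret function_ring_on R "UNIV :: 'a set"
  proof
    show "compact (UNIV :: 'a set)" by (rule cpt)
    fix u assume u: "u \<in> R"
    then have "continuous_on UNIV (\<lambda>x. Re (complex_of_real (u x)))"
      by (intro continuous_intros trig_continuous) (simp add: R_def)
    then show "continuous_on UNIV u" by simp
    fix v assume v: "v \<in> R"
    show "(\<lambda>x. u x + v x) \<in> R" using u v trig_add by (fastforce simp: R_def)
    show "(\<lambda>x. u x * v x) \<in> R" using u v trig_mult[OF _ _ characters_mult] by (fastforce simp: R_def)
  next
    fix x y :: 'a assume "x \<noteq> y"
    then have "x - y \<noteq> 0" by simp
    then obtain \<gamma> :: "'a \<Rightarrow> complex" where g: "\<gamma> \<in> characters" "\<gamma> (x - y) \<noteq> 1" by (rule characters_separate)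
    have "\<gamma> x \<noteq> \<gamma> y"
    proof
      assume "\<gamma> x = \<gamma> y"
      then have "\<gamma> (x - y) = \<gamma> y * cnj (\<gamma> y)" using characterD(6)[OF g(1)] by simp
      also have "\<dots> = 1" using characterD(2)[OF g(1)] by (simp add: complex_norm_square[symmetric])
      finally show False using g by simp
    qed
    then have "Re (\<gamma> x) \<noteq> Re (\<gamma> y) \<or> Im (\<gamma> x) \<noteq> Im (\<gamma> y)" by (simp add: complex_eq_iff)
    then show "\<exists>u\<in>R. u x \<noteq> u y"
    proof
      assume "Re (\<gamma> x) \<noteq> Re (\<gamma> y)" then show ?thesis by (intro bexI[OF _ ReIm(1)[OF g(1)]])
    next
      assume "Im (\<gamma> x) \<noteq> Im (\<gamma> y)" then show ?thesis by (intro bexI[OF _ ReIm(2)[OF g(1)]])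
    qed
  qed (rule cR)
  obtain u where u: "u \<in> R" "\<forall>x\<in>UNIV. \<bar>f x - u x\<bar> < e"
    using Stone_Weierstrass_basic[OF f e] by blast
  then show ?thesis
    by (intro bexI[of _ "\<lambda>x. complex_of_real (u x)"])
       (auto simp: R_def less_imp_le simp flip: of_real_diff)
qed

text \<open>The function \<open>coef f \<gamma> * \<gamma> x\<close> is the integral over
  \<open>y\<close> of \<open>f (x + y) * cnj (\<gamma> y)\<close>. Its Riemann sums, uniform in
  \<open>x\<close>, are combinations of translates of \<open>f\<close>, so invariance and closedness
  of the algebra apply.\<close>

lemma coef_nonzero_mem:
  fixes A :: "('a \<Rightarrow> complex) set"
  assumes A: "invariant_algebra A" and f: "f \<in> A" and g: "\<gamma> \<in> characters" and ne: "coef f \<gamma> \<noteq> 0"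
  shows "\<gamma> \<in> A"
proof -
  have fc: "continuous_on UNIV f" by (rule invariant_algebraD(1)[OF A f])
  have F: "continuous_on UNIV (\<lambda>(x, y). f (x + y) * cnj (\<gamma> y))"
    unfolding case_prod_beta'
    by (intro continuous_intros continuous_on_comp[OF fc] continuous_on_comp[OF characterD(1)[OF g]])
  have eq: "coef f \<gamma> * \<gamma> x = (\<integral>y. f (x + y) * cnj (\<gamma> y) \<partial>H)" for x
    using coef_translate[OF fc g, of x] by (simp add: coef_def mult.commute add.commute[of x])
  have "(\<lambda>x. coef f \<gamma> * \<gamma> x) \<in> A"
  proof (rule invariant_algebra_closed[OF cpt A])
    fix e :: real assume e: "e > 0"
    obtain U where U: "open U" "0 \<in> U"
      "\<forall>x y y'. y - y' \<in> U \<longrightarrow> dist (f (x + y) * cnj (\<gamma> y)) (f (x + y') * cnj (\<gamma> y')) < e"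
      by (rule uniformly_continuous_compact_group[OF cpt cpt F e])
    obtain n :: nat and p w where q: "\<forall>(u :: 'a \<Rightarrow> complex) e. continuous_on UNIV u \<longrightarrow>
        (\<forall>y y'. y - y' \<in> U \<longrightarrow> dist (u y) (u y') \<le> e) \<longrightarrow>
        norm ((\<integral>x. u x \<partial>H) - (\<Sum>i<n. complex_of_real (w i) * u (p i))) \<le> e"
      by (rule quadrature[OF U(1,2)])
    have "cmod ((\<integral>y. f (x + y) * cnj (\<gamma> y) \<partial>H) -
        (\<Sum>i<n. complex_of_real (w i) * (f (x + p i) * cnj (\<gamma> (p i))))) \<le> e" for x
    proof -
      have "\<forall>y y'. y - y' \<in> U \<longrightarrow> dist (f (x + y) * cnj (\<gamma> y)) (f (x + y') * cnj (\<gamma> y')) \<le> e"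
        using U(3) by (auto intro: less_imp_le)
      then show ?thesis
        using q[THEN spec, of "\<lambda>y. f (x + y) * cnj (\<gamma> y)", THEN spec, of e] continuous_on_slice(1)[OF F, of x]
        by (elim impE) auto
    qed
    then have bd: "cmod (coef f \<gamma> * \<gamma> x -
        (\<Sum>i<n. (complex_of_real (w i) * cnj (\<gamma> (p i))) * f (x + p i))) \<le> e" for x
      unfolding eq by (simp add: mult_ac)
    have "(\<lambda>x. \<Sum>i<n. (complex_of_real (w i) * cnj (\<gamma> (p i))) * f (x + p i)) \<in> A"
      by (intro invariant_algebra_sum[OF A] invariant_algebraD(5)[OF A] invariant_algebraD(6)[OF A] f) simp
    then show "\<exists>g\<in>A. \<forall>x. cmod (coef f \<gamma> * \<gamma> x - g x) \<le> e" by (rule bexI[rotated]) (intro allI bd)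
  qed
  from invariant_algebraD(5)[OF A this, of "1 / coef f \<gamma>"] show ?thesis using ne by simp
qed

lemma trig_dense:
  fixes A :: "('a \<Rightarrow> complex) set"
  assumes A: "invariant_algebra A" and f: "f \<in> A" and e: "e > 0"
  shows "\<exists>p\<in>trig (Sp A). \<forall>x. cmod (f x - p x) \<le> e"
proof -
  have fc: "continuous_on UNIV f" by (rule invariant_algebraD(1)[OF A f])
  obtain B where B: "B > 0" "\<And>x. cmod (f x) \<le> B" using compact_continuous_bounded[OF cpt fc] by blast
  have e2: "e / 2 > 0" using e by simp
  obtain U where U: "open U" "0 \<in> U" "\<forall>y y'. y - y' \<in> U \<longrightarrow> dist (f y) (f y') < e / 2"
    by (rule uniformly_continuous_compact_group1[OF cpt fc e2])
  \<comment> \<open>The approximate identity is a bump supported in the neighbourhood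
    \<open>U\<close> on which \<open>f\<close> varies by less than \<open>e / 2\<close>, divided by
    its integral; strict positivity of Haar measure makes this possible.\<close>
  obtain b :: "'a \<Rightarrow> real" where b: "continuous_on UNIV b" "\<And>x. 0 \<le> b x \<and> b x \<le> 1"
    "\<And>x. x \<in> - U \<Longrightarrow> b x = 0" "\<And>x. x \<in> {0} \<Longrightarrow> b x = 1"
    using urysohn_compact[OF cpt, of "- U" "{0}"] U by auto
  define M where "M = (\<integral>x. b x \<partial>H)"
  have "M \<noteq> 0" using strictly_positive[OF b(1), of 0] b by (auto simp: M_def)
  moreover have "M \<ge> 0" unfolding M_def using b(2) by (intro Bochner_Integration.integral_nonneg) auto
  ultimately have M: "M > 0" by simp
  define K where "K x = b x / M" for x
  have Kc: "continuous_on UNIV K" unfolding K_def using b(1) M by (intro continuous_intros) auto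
  have K0: "K x \<ge> 0" for x using b(2) M by (simp add: K_def)
  have K1: "(\<integral>x. K x \<partial>H) = 1" using M by (simp add: K_def M_def)
  \<comment> \<open>Replacing \<open>K\<close> by a trigonometric polynomial within
    \<open>e / (2 * B)\<close> costs a second \<open>e / 2\<close>, because \<open>f\<close> is
    bounded by \<open>B\<close>.\<close>
  have "e / (2 * B) > 0" using e B by simp
  from trig_dense_real[OF Kc this] obtain P where
    P: "P \<in> trig characters" "\<And>x. cmod (of_real (K x) - P x) \<le> e / (2 * B)" by blast
  obtain F c where F: "finite F" "F \<subseteq> characters" "P = (\<lambda>x. \<Sum>\<gamma>\<in>F. c \<gamma> * \<gamma> x)"
    using P(1) by (auto simp: trig_def)
  have Pc: "continuous_on UNIV P" by (rule trig_continuous[OF P(1)])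
  have ft: "continuous_on UNIV (\<lambda>y. f (y + x))" for x by (rule continuous_translate[OF fc])
  define p where "p x = (\<integral>y. f (y + x) * P y \<partial>H)" for x
  have cmp: "cmod (f x - p x) \<le> e" for x
  proof -
    have iK: "integrable H (\<lambda>y. f (y + x) * of_real (K y))" "integrable H (\<lambda>y. f x * of_real (K y))"
      by (intro integrable_continuous continuous_intros ft Kc)+
    have "f x = (\<integral>y. f x * of_real (K y) \<partial>H)" by (simp add: K1)
    then have "cmod (f x - (\<integral>y. f (y + x) * of_real (K y) \<partial>H)) = cmod (\<integral>y. f x * of_real (K y) - f (y + x) * of_real (K y) \<partial>H)"
      by (simp only: Bochner_Integration.integral_diff[OF iK(2,1)])
    also have "\<dots> \<le> (\<integral>y. cmod (f x * of_real (K y) - f (y + x) * of_real (K y)) \<partial>H)" by simp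
    also have "\<dots> \<le> (\<integral>y. e / 2 * K y \<partial>H)"
    proof (rule integral_mono)
      show "integrable H (\<lambda>y. cmod (f x * of_real (K y) - f (y + x) * of_real (K y)))" "integrable H (\<lambda>y. e / 2 * K y)"
        by (intro integrable_continuous continuous_intros ft Kc)+
      fix y
      have "cmod (f x - f (y + x)) * K y \<le> e / 2 * K y"
      proof (cases "y \<in> U")
        case True
        then have "(y + x) - x \<in> U" by simp
        then have "dist (f (y + x)) (f x) < e / 2" using U(3) by blast
        then show ?thesis using K0[of y] by (intro mult_right_mono) (auto simp: dist_norm norm_minus_commute)
      next
        case False then show ?thesis using b(3)[of y] by (simp add: K_def)
      qed
      then show "cmod (f x * of_real (K y) - f (y + x) * of_real (K y)) \<le> e / 2 * K y"
        using K0[of y] by (simp add: left_diff_distrib[symmetric] norm_mult)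
    qed
    also have "\<dots> = e / 2" by (simp add: K1)
    finally have 1: "cmod (f x - (\<integral>y. f (y + x) * of_real (K y) \<partial>H)) \<le> e / 2" .
    have 2: "cmod ((\<integral>y. f (y + x) * of_real (K y) \<partial>H) - p x) \<le> e / 2"
      unfolding p_def
    proof (rule norm_integral_diff_le)
      show "continuous_on UNIV (\<lambda>y. f (y + x) * of_real (K y))" "continuous_on UNIV (\<lambda>y. f (y + x) * P y)"
        by (intro continuous_intros ft Kc Pc)+
      fix y
      have "cmod (f (y + x) * of_real (K y) - f (y + x) * P y) = cmod (f (y + x)) * cmod (of_real (K y) - P y)"
        by (simp add: right_diff_distrib[symmetric] norm_mult)
      also have "\<dots> \<le> B * (e / (2 * B))" using B P(2) by (intro mult_mono) auto
      finally show "cmod (f (y + x) * of_real (K y) - f (y + x) * P y) \<le> e / 2" using B by simp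
    qed
    show ?thesis using norm_triangle_ineq[of "f x - (\<integral>y. f (y + x) * of_real (K y) \<partial>H)" "(\<integral>y. f (y + x) * of_real (K y) \<partial>H) - p x"] 1 2
      by simp
  qed
  have tm: "(\<integral>y. f (y + x) * \<gamma> y \<partial>H) = coef f (\<lambda>x. cnj (\<gamma> x)) * cnj (\<gamma> x)" if "\<gamma> \<in> F" for \<gamma> x
  proof -
    have "(\<lambda>x. cnj (\<gamma> x)) \<in> characters" using F that by (intro characters_cnj) auto
    from coef_translate[OF fc this, of x] show ?thesis by (simp add: coef_def mult.commute)
  qed
  have "p x = (\<Sum>\<gamma>\<in>F. c \<gamma> * (coef f (\<lambda>x. cnj (\<gamma> x)) * cnj (\<gamma> x)))" for x
  proof -
    have "p x = (\<integral>y. (\<Sum>\<gamma>\<in>F. c \<gamma> * (f (y + x) * \<gamma> y)) \<partial>H)"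
      unfolding p_def F(3) by (simp add: sum_distrib_left mult_ac)
    also have "\<dots> = (\<Sum>\<gamma>\<in>F. \<integral>y. c \<gamma> * (f (y + x) * \<gamma> y) \<partial>H)"
      using F(2) by (intro Bochner_Integration.integral_sum integrable_continuous continuous_intros ft characterD(1)) auto
    also have "\<dots> = (\<Sum>\<gamma>\<in>F. c \<gamma> * (coef f (\<lambda>x. cnj (\<gamma> x)) * cnj (\<gamma> x)))" by (simp add: tm)
    finally show ?thesis .
  qed
  then have pe: "p = (\<lambda>x. \<Sum>\<gamma>\<in>F. c \<gamma> * (coef f (\<lambda>x. cnj (\<gamma> x)) * cnj (\<gamma> x)))" by auto
  have "p \<in> trig (Sp A)" unfolding pe
  proof (rule trig_sum[OF F(1)])
    fix \<gamma> assume g: "\<gamma> \<in> F"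
    \<comment> \<open>Integration against a frequency \<gamma> of \<open>P\<close> yields the
      conjugate character weighted by a coefficient of \<open>f\<close>: either the term vanishes or
      the character lies in the algebra.\<close>
    have "(\<lambda>x. coef f (\<lambda>x. cnj (\<gamma> x)) * cnj (\<gamma> x)) \<in> trig (Sp A)"
    proof (cases "coef f (\<lambda>x. cnj (\<gamma> x)) = 0")
      case True then show ?thesis by (simp add: trig_zero)
    next
      case False
      have "(\<lambda>x. cnj (\<gamma> x)) \<in> characters" using F g by (intro characters_cnj) auto
      with coef_nonzero_mem[OF A f this False] show ?thesis by (intro trig_base) (simp add: Sp_def)
    qed
    then show "(\<lambda>x. c \<gamma> * (coef f (\<lambda>x. cnj (\<gamma> x)) * cnj (\<gamma> x))) \<in> trig (Sp A)" by (rule trig_scale)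
  qed
  with cmp show ?thesis by (intro bexI[of _ p]) auto
qed

end

section \<open>Homomorphisms into the disc are given by measures\<close>

lemma polynomial_dominates_power:
  fixes r :: real
  assumes "\<And>n::nat. r ^ n \<le> (real n + 1) ^ m"
  shows "r \<le> 1"
proof (rule ccontr)
  assume "\<not> r \<le> 1"
  then have r: "r > 1" by simp
  have "(\<lambda>n::nat. (real n + 1) ^ m / r ^ n) \<longlonglongrightarrow> 0" using r by real_asymp
  then have "\<forall>\<^sub>F n in sequentially. (real n + 1) ^ m / r ^ n < 1" by (rule order_tendstoD(2)) simp
  then obtain n :: nat where "(real n + 1) ^ m / r ^ n < 1" by (auto simp: eventually_sequentially)
  then have "(real n + 1) ^ m < r ^ n" using r by (simp add: field_simps)
  with assms[of n] show False by simp
qed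

text \<open>Each exponent is bounded by \<open>n\<close> separately instead of the total degree,
  which gives the count \<open>(n + 1) ^ card F\<close> at once. The monomials are collected as
  functions, so coinciding products are identified, as orthogonality of characters requires.\<close>

definition monomials :: "('a \<Rightarrow> complex) set \<Rightarrow> nat \<Rightarrow> ('a \<Rightarrow> complex) set" where
  "monomials F n = (\<lambda>k x. \<Prod>\<gamma>\<in>F. \<gamma> x ^ k \<gamma>) ` (F \<rightarrow>\<^sub>E {..n})"

lemma finite_monomials: "finite F \<Longrightarrow> finite (monomials F n)"
  unfolding monomials_def by (intro finite_imageI finite_PiE) auto

lemma card_monomials: "finite F \<Longrightarrow> card (monomials F n) \<le> (n + 1) ^ card F"
  unfolding monomials_def by (rule order_trans[OF card_image_le]) (auto intro!: finite_PiE simp: card_PiE)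

lemma monomials_one:
  assumes "finite F"
  shows "(\<lambda>x. 1) \<in> monomials F n"
  unfolding monomials_def
  by (rule image_eqI[of _ _ "\<lambda>\<gamma>\<in>F. 0"]) auto

lemma monomials_mult:
  assumes F: "finite F" and g: "\<gamma> \<in> F" and d: "\<delta> \<in> monomials F n"
  shows "(\<lambda>x. \<gamma> x * \<delta> x) \<in> monomials F (Suc n)"
proof -
  obtain k where k: "k \<in> F \<rightarrow>\<^sub>E {..n}" "\<delta> = (\<lambda>x. \<Prod>\<eta>\<in>F. \<eta> x ^ k \<eta>)" using d by (auto simp: monomials_def)
  define k' where "k' = k(\<gamma> := Suc (k \<gamma>))"
  have "k' \<in> F \<rightarrow>\<^sub>E {..Suc n}"
  proof (rule PiE_I)
    fix \<eta> assume e: "\<eta> \<in> F"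
    then have "k \<eta> \<le> n" using k(1) by (auto dest: PiE_mem)
    then show "k' \<eta> \<in> {..Suc n}" by (auto simp: k'_def)
  next
    fix \<eta> assume e: "\<eta> \<notin> F"
    then have "\<eta> \<noteq> \<gamma>" using g by blast
    then show "k' \<eta> = undefined" using PiE_arb[OF k(1) e] by (simp add: k'_def)
  qed
  moreover have "(\<lambda>x. \<gamma> x * \<delta> x) = (\<lambda>x. \<Prod>\<eta>\<in>F. \<eta> x ^ k' \<eta>)"
  proof
    fix x
    have "(\<Prod>\<eta>\<in>F. \<eta> x ^ k' \<eta>) = \<gamma> x ^ Suc (k \<gamma>) * (\<Prod>\<eta>\<in>F - {\<gamma>}. \<eta> x ^ k \<eta>)"
      using F g by (subst prod.remove[of F \<gamma>]) (auto simp: k'_def intro!: prod.cong)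
    also have "\<dots> = \<gamma> x * \<delta> x"
      unfolding k(2) using F g by (subst prod.remove[of F \<gamma>]) (auto simp: mult_ac)
    finally show "\<gamma> x * \<delta> x = (\<Prod>\<eta>\<in>F. \<eta> x ^ k' \<eta>)" by simp
  qed
  ultimately show ?thesis unfolding monomials_def by (intro image_eqI)
qed

lemma monomials_subset:
  assumes F: "finite F" "F \<subseteq> S" and one: "(\<lambda>x. 1) \<in> S"
    and mult: "\<And>\<gamma> \<delta>. \<gamma> \<in> S \<Longrightarrow> \<delta> \<in> S \<Longrightarrow> (\<lambda>x. \<gamma> x * \<delta> x) \<in> S"
  shows "monomials F n \<subseteq> S"
proof -
  have pow: "(\<lambda>x. \<gamma> x ^ j) \<in> S" if "\<gamma> \<in> S" for \<gamma> and j :: nat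
  proof (induction j)
    case (Suc j) from mult[OF that Suc] show ?case by simp
  qed (simp add: one)
  have "(\<lambda>x. \<Prod>\<gamma>\<in>G. \<gamma> x ^ k \<gamma>) \<in> S" if "finite G" "G \<subseteq> S" for G and k :: "('a \<Rightarrow> complex) \<Rightarrow> nat"
    using that
  proof (induction G rule: finite_induct)
    case (insert \<gamma> G)
    have "(\<lambda>x. \<gamma> x ^ k \<gamma> * (\<Prod>\<gamma>\<in>G. \<gamma> x ^ k \<gamma>)) \<in> S"
      using insert by (intro mult[of "\<lambda>x. \<gamma> x ^ k \<gamma>"] pow) auto
    then show ?case using insert by simp
  qed (simp add: one)
  then show ?thesis using F by (auto simp: monomials_def)
qed

lemma disc_homs_one:
  assumes "h \<in> disc_homs S" "(\<lambda>x. 1) \<in> S"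
  shows "h (\<lambda>x. 1) = 1"
proof -
  obtain \<gamma> where g: "\<gamma> \<in> S" "h \<gamma> \<noteq> 0" using assms(1) by (auto simp: disc_homs_def)
  then have "h \<gamma> = h (\<lambda>x. 1) * h \<gamma>" using assms by (fastforce simp: disc_homs_def)
  then show ?thesis using g by simp
qed

text \<open>The same coefficients \<open>C\<close> must serve the polynomial and its image under
  \<open>h\<close>: orthogonality bounds them through the polynomial, and the bound is then used for
  \<open>h\<close>. They exist because evaluation at a point and \<open>h\<close> are both
  multiplicative.\<close>

lemma power_expansion:
  assumes F: "finite F" "F \<subseteq> S" and one: "(\<lambda>x. 1) \<in> S"
    and mult: "\<And>\<gamma> \<delta>. \<gamma> \<in> S \<Longrightarrow> \<delta> \<in> S \<Longrightarrow> (\<lambda>x. \<gamma> x * \<delta> x) \<in> S"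
    and h: "h \<in> disc_homs S"
  shows "\<exists>C. (\<forall>x. (\<Sum>\<gamma>\<in>F. c \<gamma> * \<gamma> x) ^ n = (\<Sum>\<delta>\<in>monomials F n. C \<delta> * \<delta> x)) \<and>
     (\<Sum>\<gamma>\<in>F. c \<gamma> * h \<gamma>) ^ n = (\<Sum>\<delta>\<in>monomials F n. C \<delta> * h \<delta>)"
proof (induction n)
  case 0
  have s: "(\<Sum>\<delta>\<in>monomials F 0. (if \<delta> = (\<lambda>x. 1) then 1 else 0) * g \<delta>) = g (\<lambda>x. 1)" for g :: "_ \<Rightarrow> complex"
    using finite_monomials[OF F(1)] monomials_one[OF F(1), of 0] by (simp add: if_distrib if_distribR cong: if_cong)
  show ?case
    by (intro exI[of _ "\<lambda>\<delta>. if \<delta> = (\<lambda>x. 1) then 1 else 0"] conjI allI, unfold s)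
       (simp_all add: disc_homs_one[OF h one])
next
  case (Suc n)
  then obtain C where C: "\<And>x. (\<Sum>\<gamma>\<in>F. c \<gamma> * \<gamma> x) ^ n = (\<Sum>\<delta>\<in>monomials F n. C \<delta> * \<delta> x)"
    "(\<Sum>\<gamma>\<in>F. c \<gamma> * h \<gamma>) ^ n = (\<Sum>\<delta>\<in>monomials F n. C \<delta> * h \<delta>)" by blast
  define m where "m p = (\<lambda>x. fst p x * snd p x :: complex)" for p :: "('a \<Rightarrow> complex) \<times> ('a \<Rightarrow> complex)"
  \<comment> \<open>Different pairs may have the same product, so coefficients are gathered by the
    resulting function.\<close>
  define D where "D \<epsilon> = (\<Sum>p | p \<in> F \<times> monomials F n \<and> m p = \<epsilon>. c (fst p) * C (snd p))" for \<epsilon>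
  have step: "(\<Sum>\<gamma>\<in>F. c \<gamma> * g \<gamma>) * (\<Sum>\<delta>\<in>monomials F n. C \<delta> * g \<delta>) = (\<Sum>\<epsilon>\<in>monomials F (Suc n). D \<epsilon> * g \<epsilon>)"
    if g: "\<And>p. p \<in> F \<times> monomials F n \<Longrightarrow> g (m p) = g (fst p) * g (snd p)" for g
  proof -
    have "(\<Sum>\<epsilon>\<in>monomials F (Suc n). D \<epsilon> * g \<epsilon>) =
        (\<Sum>\<epsilon>\<in>monomials F (Suc n). \<Sum>p | p \<in> F \<times> monomials F n \<and> m p = \<epsilon>. c (fst p) * C (snd p) * g (m p))"
      unfolding D_def sum_distrib_right by (intro sum.cong) auto
    also have "\<dots> = (\<Sum>p\<in>F \<times> monomials F n. c (fst p) * C (snd p) * g (m p))"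
    proof (rule sum.group)
      show "finite (F \<times> monomials F n)" "finite (monomials F (Suc n))" using F finite_monomials by auto
      show "m ` (F \<times> monomials F n) \<subseteq> monomials F (Suc n)"
        using monomials_mult[OF F(1)] by (auto simp: m_def)
    qed
    also have "\<dots> = (\<Sum>p\<in>F \<times> monomials F n. (c (fst p) * g (fst p)) * (C (snd p) * g (snd p)))"
      by (intro sum.cong refl) (simp add: g mult_ac)
    also have "\<dots> = (\<Sum>\<gamma>\<in>F. c \<gamma> * g \<gamma>) * (\<Sum>\<delta>\<in>monomials F n. C \<delta> * g \<delta>)"
      by (simp add: sum_product sum.cartesian_product case_prod_beta')
    finally show ?thesis by simp
  qed
  have hm: "h (m p) = h (fst p) * h (snd p)" if "p \<in> F \<times> monomials F n" for p
  proof -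
    have "monomials F n \<subseteq> S" by (rule monomials_subset[OF F one mult])
    then have S: "fst p \<in> S" "snd p \<in> S" using that F(2) by auto
    have "\<forall>\<gamma>\<in>S. \<forall>\<delta>\<in>S. h (\<lambda>x. \<gamma> x * \<delta> x) = h \<gamma> * h \<delta>" using h by (simp add: disc_homs_def)
    then show ?thesis unfolding m_def using S by simp
  qed
  have "(\<Sum>\<gamma>\<in>F. c \<gamma> * \<gamma> x) ^ Suc n = (\<Sum>\<delta>\<in>monomials F (Suc n). D \<delta> * \<delta> x)" for x
    using step[of "\<lambda>\<gamma>. \<gamma> x"] by (simp add: C(1) m_def)
  moreover have "(\<Sum>\<gamma>\<in>F. c \<gamma> * h \<gamma>) ^ Suc n = (\<Sum>\<delta>\<in>monomials F (Suc n). D \<delta> * h \<delta>)"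
    using step[of h, OF hm] by (simp add: C(2))
  ultimately show ?case by blast
qed

section \<open>Orthogonality of characters\<close>

context haar begin

lemma character_orthogonal:
  assumes g: "\<gamma> \<in> characters" and d: "\<delta> \<in> characters"
  shows "(\<integral>x. \<gamma> x * cnj (\<delta> x) \<partial>H) = (if \<gamma> = \<delta> then 1 else 0)"
proof -
  have unit: "\<delta> x * cnj (\<delta> x) = 1" for x
    using characterD(2)[OF d, of x] by (simp add: complex_norm_square[symmetric])
  show ?thesis
  proof (cases "\<gamma> = \<delta>")
    case True then show ?thesis by (simp add: unit prob_space)
  next
    case False
    then obtain a where a: "\<gamma> a \<noteq> \<delta> a" by blast
    have e: "(\<lambda>x. \<gamma> x * cnj (\<delta> x)) \<in> characters" by (intro characters_mult g characters_cnj d)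
    let ?e = "\<lambda>x. \<gamma> x * cnj (\<delta> x)" and ?I = "\<integral>x. \<gamma> x * cnj (\<delta> x) \<partial>H"
    have "?e a \<noteq> 1"
    proof
      assume "?e a = 1"
      then have "\<gamma> a * (cnj (\<delta> a) * \<delta> a) = \<delta> a" by (metis mult.assoc mult_1)
      then show False using a unit[of a] by (simp add: mult.commute)
    qed
    moreover have "?I = ?I * ?e a"
      using invariant[OF characterD(1)[OF e], of a] unfolding characterD(3)[OF e, of _ a] by simp
    ultimately have "?I = 0" by (metis mult_cancel_left1)
    then show ?thesis using False by simp
  qed
qed

lemma coef_trig:
  assumes F: "finite F" "F \<subseteq> characters" and d: "\<delta> \<in> F"
  shows "coef (\<lambda>x. \<Sum>\<gamma>\<in>F. c \<gamma> * \<gamma> x) \<delta> = c \<delta>"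
proof -
  have dc: "\<delta> \<in> characters" using F d by auto
  have "coef (\<lambda>x. \<Sum>\<gamma>\<in>F. c \<gamma> * \<gamma> x) \<delta> = (\<integral>x. (\<Sum>\<gamma>\<in>F. c \<gamma> * (\<gamma> x * cnj (\<delta> x))) \<partial>H)"
    unfolding coef_def by (simp add: sum_distrib_right mult.assoc)
  also have "\<dots> = (\<Sum>\<gamma>\<in>F. \<integral>x. c \<gamma> * (\<gamma> x * cnj (\<delta> x)) \<partial>H)"
    using F(2) dc by (intro Bochner_Integration.integral_sum integrable_continuous continuous_intros characterD(1)) auto
  also have "\<dots> = (\<Sum>\<gamma>\<in>F. c \<gamma> * (if \<gamma> = \<delta> then 1 else 0))"
    using F(2) by (intro sum.cong refl) (simp add: character_orthogonal[OF _ dc] subset_iff)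
  also have "\<dots> = c \<delta>" using F(1) d by (simp add: if_distrib cong: if_cong)
  finally show ?thesis .
qed

lemma coef_bound:
  assumes "continuous_on UNIV f" "\<gamma> \<in> characters" "\<And>x. cmod (f x) \<le> B"
  shows "cmod (coef f \<gamma>) \<le> B"
  unfolding coef_def
proof (rule norm_integral_le)
  show "continuous_on UNIV (\<lambda>x. f x * cnj (\<gamma> x))"
    by (intro continuous_on_mult continuous_on_cnj assms(1) characterD(1)[OF assms(2)])
  show "cmod (f x * cnj (\<gamma> x)) \<le> B" for x
    using assms(3) by (simp add: norm_mult characterD(2)[OF assms(2)])
qed

end

section \<open>Bounds and measures for disc homomorphisms\<close>

locale character_semigroup = haar H for H :: "'a::{topological_ab_group_add, t2_space} measure" +
  fixes S :: "('a \<Rightarrow> complex) set"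
  assumes S_chars: "S \<subseteq> characters" and S_one: "(\<lambda>x. 1) \<in> S"
    and S_mult: "\<And>\<gamma> \<delta>. \<gamma> \<in> S \<Longrightarrow> \<delta> \<in> S \<Longrightarrow> (\<lambda>x. \<gamma> x * \<delta> x) \<in> S"
begin

lemma disc_hom_bound:
  assumes h: "h \<in> disc_homs S" and F: "finite F" "F \<subseteq> S" and B: "B > 0" "\<And>x. cmod (\<Sum>\<gamma>\<in>F. c \<gamma> * \<gamma> x) \<le> B"
  shows "cmod (\<Sum>\<gamma>\<in>F. c \<gamma> * h \<gamma>) \<le> B"
proof -
  let ?p = "\<lambda>x. \<Sum>\<gamma>\<in>F. c \<gamma> * \<gamma> x" and ?v = "\<Sum>\<gamma>\<in>F. c \<gamma> * h \<gamma>"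
  have pc: "continuous_on UNIV ?p"
    using F S_chars by (intro continuous_intros characterD(1)) auto
  have "(cmod ?v / B) ^ n \<le> (real n + 1) ^ card F" for n
  proof -
    obtain C where C: "\<forall>x. ?p x ^ n = (\<Sum>\<delta>\<in>monomials F n. C \<delta> * \<delta> x)" "?v ^ n = (\<Sum>\<delta>\<in>monomials F n. C \<delta> * h \<delta>)"
      using power_expansion[OF F S_one S_mult h, of c n] by blast
    have ms: "monomials F n \<subseteq> S" by (rule monomials_subset[OF F S_one S_mult])
    \<comment> \<open>By orthogonality \<open>C \<delta>\<close> is a Fourier coefficient of the
      \<open>n\<close>-th power, hence at most its sup-norm.\<close>
    have Cb: "cmod (C \<delta>) \<le> B ^ n" if d: "\<delta> \<in> monomials F n" for \<delta>
    proof -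
      have eq: "(\<lambda>x. \<Sum>\<delta>\<in>monomials F n. C \<delta> * \<delta> x) = (\<lambda>x. ?p x ^ n)" using C(1) by auto
      have "C \<delta> = coef (\<lambda>x. ?p x ^ n) \<delta>"
        using coef_trig[OF finite_monomials[OF F(1)] order_trans[OF ms S_chars] d, of C] unfolding eq by simp
      moreover have "cmod (coef (\<lambda>x. ?p x ^ n) \<delta>) \<le> B ^ n"
        using d ms S_chars B by (intro coef_bound continuous_intros pc) (auto simp: norm_power intro: power_mono)
      ultimately show ?thesis by simp
    qed
    have hb: "cmod (h \<delta>) \<le> 1" if "\<delta> \<in> S" for \<delta> using h that by (auto simp: disc_homs_def)
    have "cmod ?v ^ n = cmod (\<Sum>\<delta>\<in>monomials F n. C \<delta> * h \<delta>)" by (simp add: norm_power[symmetric] C(2))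
    also have "\<dots> \<le> (\<Sum>\<delta>\<in>monomials F n. B ^ n)"
    proof (rule sum_norm_le)
      fix \<delta> assume d: "\<delta> \<in> monomials F n"
      have "cmod (C \<delta>) * cmod (h \<delta>) \<le> B ^ n * 1" using Cb[OF d] hb d ms B by (intro mult_mono) auto
      then show "cmod (C \<delta> * h \<delta>) \<le> B ^ n" by (simp add: norm_mult)
    qed
    also have "\<dots> = real (card (monomials F n)) * B ^ n" by simp
    also have "\<dots> \<le> (real n + 1) ^ card F * B ^ n"
    proof (intro mult_right_mono)
      have "real (card (monomials F n)) \<le> real ((n + 1) ^ card F)"
        using card_monomials[OF F(1)] by (intro of_nat_mono)
      then show "real (card (monomials F n)) \<le> (real n + 1) ^ card F" by (simp add: add.commute)
    qed (use B in simp)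
    finally show ?thesis using B by (simp add: power_divide divide_le_eq)
  qed
  then have "cmod ?v / B \<le> 1" by (rule polynomial_dominates_power)
  then show ?thesis using B by (simp add: divide_le_eq)
qed

text \<open>Apply the previous bound to \<open>p + t\<close> and let the real number \<open>t\<close> tend to infinity.\<close>

lemma disc_hom_Re:
  assumes h: "h \<in> disc_homs S" and F: "finite F" "F \<subseteq> S" and s: "\<And>x. Re (\<Sum>\<gamma>\<in>F. c \<gamma> * \<gamma> x) \<le> s"
  shows "Re (\<Sum>\<gamma>\<in>F. c \<gamma> * h \<gamma>) \<le> s"
proof -
  let ?p = "\<lambda>x. \<Sum>\<gamma>\<in>F. c \<gamma> * \<gamma> x" and ?v = "\<Sum>\<gamma>\<in>F. c \<gamma> * h \<gamma>"
  have pc: "continuous_on UNIV ?p"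
    using F S_chars by (intro continuous_intros characterD(1)) auto
  obtain B where B: "B > 0" "\<And>x. cmod (?p x) \<le> B" using compact_continuous_bounded[OF cpt pc] by blast
  have main: "2 * (Re ?v - s) * t \<le> s\<^sup>2 + B\<^sup>2 + 1 - (Re ?v)\<^sup>2" if t: "t \<ge> B" for t
  proof -
    \<comment> \<open>The constant \<open>t\<close> is added as a multiple of the trivial character,
      which may or may not already occur in \<open>F\<close>.\<close>
    define d where "d \<gamma> = (if \<gamma> \<in> F then c \<gamma> else 0) + (if \<gamma> \<in> {\<lambda>x. 1} then of_real t else 0)" for \<gamma> :: "'a \<Rightarrow> complex"
    have e: "(\<Sum>\<gamma>\<in>F \<union> {\<lambda>x. 1}. d \<gamma> * g \<gamma>) = (\<Sum>\<gamma>\<in>F. c \<gamma> * g \<gamma>) + of_real t * g (\<lambda>x. 1)" for g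
      unfolding d_def using F(1) by (subst merge_combinations) auto
    \<comment> \<open>\<open>Q\<close> bounds the modulus of \<open>p + t\<close>. The summand 1
      only makes the radicand positive.\<close>
    define Q where "Q = sqrt ((s + t)\<^sup>2 + B\<^sup>2 + 1)"
    have Qp: "Q > 0" unfolding Q_def by (intro real_sqrt_gt_zero add_nonneg_pos) auto
    have "cmod (\<Sum>\<gamma>\<in>F \<union> {\<lambda>x. 1}. d \<gamma> * h \<gamma>) \<le> Q"
    proof (rule disc_hom_bound[OF h _ _ Qp])
      fix x
      have r: "\<bar>Re (?p x)\<bar> \<le> B" "\<bar>Im (?p x)\<bar> \<le> B"
        using abs_Re_le_cmod[of "?p x"] abs_Im_le_cmod[of "?p x"] B(2)[of x] by linarith+
      \<comment> \<open>Because \<open>t \<ge> B\<close>, the quantity \<open>Re (?p x) + t\<close>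
        is nonnegative, so its upper bound may be squared. In the final comparison the terms
        \<open>t\<^sup>2\<close> cancel and a bound linear in \<open>t\<close> remains.\<close>
      have "(Re (?p x) + t)\<^sup>2 \<le> (s + t)\<^sup>2" using r(1) s[of x] t by (intro power_mono) auto
      moreover have "(Im (?p x))\<^sup>2 \<le> B\<^sup>2" using r(2) B(1) by (intro abs_le_square_iff[THEN iffD1]) auto
      ultimately have "(cmod (?p x + of_real t))\<^sup>2 \<le> (s + t)\<^sup>2 + B\<^sup>2 + 1" by (simp add: cmod_power2)
      then have "cmod (?p x + of_real t) \<le> Q" unfolding Q_def by (intro real_le_rsqrt)
      then show "cmod (\<Sum>\<gamma>\<in>F \<union> {\<lambda>x. 1}. d \<gamma> * \<gamma> x) \<le> Q" unfolding e by simp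
    qed (use F S_one in auto)
    then have "cmod (?v + of_real t) \<le> Q" unfolding e by (simp add: disc_homs_one[OF h S_one])
    then have "(cmod (?v + of_real t))\<^sup>2 \<le> Q\<^sup>2" by (intro power_mono) auto
    also have "Q\<^sup>2 = (s + t)\<^sup>2 + B\<^sup>2 + 1" unfolding Q_def by (intro real_sqrt_pow2) auto
    finally have "(Re ?v + t)\<^sup>2 + (Im ?v)\<^sup>2 \<le> (s + t)\<^sup>2 + B\<^sup>2 + 1" unfolding cmod_power2 by simp
    moreover have "0 \<le> (Im ?v)\<^sup>2" by simp
    ultimately have "(Re ?v + t)\<^sup>2 \<le> (s + t)\<^sup>2 + B\<^sup>2 + 1" by linarith
    then show ?thesis by (simp add: power2_eq_square algebra_simps)
  qed
  show ?thesis
  proof (rule ccontr)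
    assume "\<not> Re ?v \<le> s"
    then have pos: "2 * (Re ?v - s) > 0" by simp
    define R where "R = s\<^sup>2 + B\<^sup>2 + 1 - (Re ?v)\<^sup>2"
    define t where "t = max B ((\<bar>R\<bar> + 1) / (2 * (Re ?v - s)))"
    have "(\<bar>R\<bar> + 1) / (2 * (Re ?v - s)) \<le> t" by (simp add: t_def)
    then have "\<bar>R\<bar> + 1 \<le> 2 * (Re ?v - s) * t" using pos by (simp add: divide_le_eq mult.commute)
    moreover have "2 * (Re ?v - s) * t \<le> R" unfolding R_def by (rule main) (simp add: t_def)
    ultimately show False by linarith
  qed
qed

text \<open>A number \<open>v\<close> is admissible for \<open>u\<close> if, for some trigonometric
  polynomial \<open>p\<close>, the function \<open>u + Re p\<close> stays below
  \<open>v + Re h(p)\<close>, where \<open>h(p)\<close> is the linear extension. Integrals bounded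
  by admissible numbers must agree with \<open>h\<close> on characters. That admissible numbers
  respect lower bounds of \<open>u\<close> is \<open>disc_hom_Re\<close>.\<close>

lemma disc_hom_measure:
  assumes h: "h \<in> disc_homs S"
  obtains N where "regular_prob N" "\<And>\<gamma>. \<gamma> \<in> S \<Longrightarrow> (\<integral>x. \<gamma> x \<partial>N) = h \<gamma>"
proof -
  define V where "V u = {v :: real. \<exists>F c. finite F \<and> F \<subseteq> S \<and>
      (\<forall>x. u x + Re (\<Sum>\<gamma>\<in>F. c \<gamma> * \<gamma> x) \<le> v + Re (\<Sum>\<gamma>\<in>F. c \<gamma> * h \<gamma>))}" for u :: "'a \<Rightarrow> real"
  have VI: "v \<in> V u" if "finite F" "F \<subseteq> S" "\<And>x. u x + Re (\<Sum>\<gamma>\<in>F. c \<gamma> * \<gamma> x) \<le> v + Re (\<Sum>\<gamma>\<in>F. c \<gamma> * h \<gamma>)" for v u F c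
    unfolding V_def using that by blast
  have V_lower: "b \<le> v" if v: "v \<in> V u" and b: "\<And>x. b \<le> u x" for v u b
  proof -
    obtain F c where F: "finite F" "F \<subseteq> S"
      "\<forall>x. u x + Re (\<Sum>\<gamma>\<in>F. c \<gamma> * \<gamma> x) \<le> v + Re (\<Sum>\<gamma>\<in>F. c \<gamma> * h \<gamma>)" using v by (auto simp: V_def)
    have "Re (\<Sum>\<gamma>\<in>F. c \<gamma> * \<gamma> x) \<le> v + Re (\<Sum>\<gamma>\<in>F. c \<gamma> * h \<gamma>) - b" for x
      using F(3)[THEN spec, of x] b[of x] by simp
    from disc_hom_Re[OF h F(1,2) this] show "b \<le> v" by simp
  qed
  have V_upper: "v \<in> V u" if "\<And>x. u x \<le> v" for u v
    by (rule VI[of "{}"]) (use that in auto)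
  have V_add: "a + b \<in> V (\<lambda>x. u x + v x)" if a: "a \<in> V u" and b: "b \<in> V v" for a b u v
  proof -
    obtain F c where F: "finite F" "F \<subseteq> S"
      "\<forall>x. u x + Re (\<Sum>\<gamma>\<in>F. c \<gamma> * \<gamma> x) \<le> a + Re (\<Sum>\<gamma>\<in>F. c \<gamma> * h \<gamma>)" using a by (auto simp: V_def)
    obtain G d where G: "finite G" "G \<subseteq> S"
      "\<forall>x. v x + Re (\<Sum>\<gamma>\<in>G. d \<gamma> * \<gamma> x) \<le> b + Re (\<Sum>\<gamma>\<in>G. d \<gamma> * h \<gamma>)" using b by (auto simp: V_def)
    show ?thesis
    proof (rule VI)
      show "finite (F \<union> G)" "F \<union> G \<subseteq> S" using F G by auto
      fix x
      show "u x + v x + Re (\<Sum>\<gamma>\<in>F \<union> G. ((if \<gamma> \<in> F then c \<gamma> else 0) + (if \<gamma> \<in> G then d \<gamma> else 0)) * \<gamma> x) \<le>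
         a + b + Re (\<Sum>\<gamma>\<in>F \<union> G. ((if \<gamma> \<in> F then c \<gamma> else 0) + (if \<gamma> \<in> G then d \<gamma> else 0)) * h \<gamma>)"
        unfolding merge_combinations[OF F(1) G(1)] plus_complex.sel
        using F(3)[THEN spec, of x] G(3)[THEN spec, of x] by linarith
    qed
  qed
  have V_scale: "a * v \<in> V (\<lambda>x. a * u x)" if a: "a > 0" and v: "v \<in> V u" for a v u
  proof -
    obtain F c where F: "finite F" "F \<subseteq> S"
      "\<forall>x. u x + Re (\<Sum>\<gamma>\<in>F. c \<gamma> * \<gamma> x) \<le> v + Re (\<Sum>\<gamma>\<in>F. c \<gamma> * h \<gamma>)" using v by (auto simp: V_def)
    have sc: "(\<Sum>\<gamma>\<in>F. (of_real a * c \<gamma>) * g \<gamma>) = of_real a * (\<Sum>\<gamma>\<in>F. c \<gamma> * g \<gamma>)" for g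
      by (simp add: sum_distrib_left mult.assoc)
    show ?thesis
    proof (rule VI[OF F(1,2)])
      fix x
      have "a * (u x + Re (\<Sum>\<gamma>\<in>F. c \<gamma> * \<gamma> x)) \<le> a * (v + Re (\<Sum>\<gamma>\<in>F. c \<gamma> * h \<gamma>))"
        using F(3)[THEN spec, of x] a by (intro mult_left_mono) auto
      then show "a * u x + Re (\<Sum>\<gamma>\<in>F. (of_real a * c \<gamma>) * \<gamma> x) \<le> a * v + Re (\<Sum>\<gamma>\<in>F. (of_real a * c \<gamma>) * h \<gamma>)"
        unfolding sc by (simp add: distrib_left del: Re_sum)
    qed
  qed
  obtain N where N: "regular_prob N"
    "\<And>u v. continuous_on UNIV u \<Longrightarrow> v \<in> V u \<Longrightarrow> (\<integral>x. u x \<partial>N) \<le> v"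
  proof (rule regular_prob_below_upper_bounds[of V, OF cpt])
    show "b \<le> v" if "v \<in> V u" "\<And>x. b \<le> u x" for u v b using that by (rule V_lower)
    show "v \<in> V u" if "\<And>x. u x \<le> v" for u v using that by (rule V_upper)
    show "v + v' \<in> V (\<lambda>x. u x + u' x)" if "v \<in> V u" "v' \<in> V u'" for u u' v v' using that by (rule V_add)
    show "b * v \<in> V (\<lambda>x. b * u x)" if "b > 0" "v \<in> V u" for b u v using that by (rule V_scale)
  qed blast
  interpret N: regular_prob_space N using cpt N by unfold_locales
  have "(\<integral>x. \<gamma> x \<partial>N) = h \<gamma>" if g: "\<gamma> \<in> S" for \<gamma>
  proof -
    have gc: "continuous_on UNIV \<gamma>" using g S_chars by (auto intro: characterD(1))
    \<comment> \<open>Taking \<open>p = - d * \<gamma>\<close> makes both sides of the defining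
      inequality zero, so \<open>Re (d * h \<gamma>)\<close> is admissible for
      \<open>Re (d * \<gamma>)\<close>. The four units \<open>d\<close> then give equality.\<close>
    have le: "Re (d * (\<integral>x. \<gamma> x \<partial>N)) \<le> Re (d * h \<gamma>)" for d
    proof -
      have c: "continuous_on UNIV (\<lambda>x. Re (d * \<gamma> x))" by (intro continuous_intros gc)
      have "Re (d * h \<gamma>) \<in> V (\<lambda>x. Re (d * \<gamma> x))"
        by (rule VI[of "{\<gamma>}" _ "\<lambda>_. - d"]) (use g in auto)
      then have "(\<integral>x. Re (d * \<gamma> x) \<partial>N) \<le> Re (d * h \<gamma>)" by (rule N(2)[OF c])
      moreover have "(\<integral>x. Re (d * \<gamma> x) \<partial>N) = Re (\<integral>x. d * \<gamma> x \<partial>N)"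
        by (intro integral_bounded_linear[OF bounded_linear_Re] N.integrable_continuous continuous_intros gc)
      ultimately show ?thesis by simp
    qed
    show ?thesis using le[of 1] le[of "- 1"] le[of \<i>] le[of "- \<i>"] by (auto simp: complex_eq_iff)
  qed
  with N(1) show ?thesis by (rule that)
qed

end

section \<open>Multiplicative functionals\<close>

text \<open>For a positive measure the supremum over Borel subsets of \<open>B\<close> is attained
  at \<open>B\<close> itself.\<close>

lemma positive_variation_measure:
  assumes N: "prob_space N" "sets N = sets borel"
  shows "positive_variation (measure N) = N"
proof -
  interpret prob_space N by (rule N)
  have sp: "space N = UNIV" using sets_eq_imp_space_eq[OF N(2)] by simp
  have "positive_variation (measure N) = measure_of UNIV (sets borel) (emeasure N)"
    unfolding positive_variation_def
  proof (rule measure_of_eq)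
    fix B :: "'a set" assume "B \<in> sigma_sets UNIV (sets borel)"
    then have B: "B \<in> sets borel" using sets.sigma_sets_eq[of "borel :: 'a measure"] by simp
    show "(SUP C\<in>{C \<in> sets borel. C \<subseteq> B}. ennreal (measure N C)) = emeasure N B"
    proof (rule antisym)
      show "(SUP C\<in>{C \<in> sets borel. C \<subseteq> B}. ennreal (measure N C)) \<le> emeasure N B"
        using B by (intro SUP_least) (auto simp: emeasure_eq_measure[symmetric] N(2) intro: emeasure_mono)
      show "emeasure N B \<le> (SUP C\<in>{C \<in> sets borel. C \<subseteq> B}. ennreal (measure N C))"
        unfolding emeasure_eq_measure using B by (intro SUP_upper) auto
    qed
  qed simp
  also have "\<dots> = N" using measure_of_of_measure[of N] by (simp add: sp N(2))
  finally show ?thesis .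
qed

text \<open>Truncation by \<open>ennreal\<close> turns a nonpositive set function into the null
  measure. This disposes of the other three parts in \<open>complex_measure_integral\<close> when
  the complex measure is a probability measure.\<close>

lemma integral_positive_variation_nonpos:
  fixes f :: "'a::topological_space \<Rightarrow> complex"
  assumes "\<And>B. \<nu> B \<le> 0"
  shows "integral\<^sup>L (positive_variation \<nu>) f = 0"
proof -
  have "positive_variation \<nu> = measure_of UNIV (sets borel) (\<lambda>_. 0)"
    unfolding positive_variation_def
  proof (rule measure_of_eq)
    fix B :: "'a set" assume "B \<in> sigma_sets UNIV (sets borel)"
    have "(SUP C\<in>{C \<in> sets borel. C \<subseteq> B}. ennreal (\<nu> C)) = (SUP C\<in>{C \<in> sets borel. C \<subseteq> B}. 0)"
      using assms by (intro SUP_cong refl) (simp add: ennreal_neg)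
    also have "\<dots> = 0" by (rule cSUP_const) auto
    finally show "(SUP C\<in>{C \<in> sets borel. C \<subseteq> B}. ennreal (\<nu> C)) = 0" .
  qed simp
  also have "\<dots> = null_measure borel" by (simp add: null_measure_def)
  finally have eq: "positive_variation \<nu> = null_measure borel" .
  have "AE x in null_measure borel. f x = 0"
    by (rule AE_I[where N = UNIV]) auto
  then show ?thesis unfolding eq by (rule integral_eq_zero_AE)
qed

lemma complex_measure_integral_prob:
  fixes f :: "'a::topological_space \<Rightarrow> complex"
  assumes "prob_space N" "sets N = sets borel"
  shows "complex_measure_integral (\<lambda>B. complex_of_real (measure N B)) f = (\<integral>x. f x \<partial>N)"
  unfolding complex_measure_integral_def
  using positive_variation_measure[OF assms]
  by (simp add: integral_positive_variation_nonpos)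

text \<open>Every countable Borel partition of \<open>B\<close> gives the same sum by countable
  additivity, and the partition into \<open>B\<close> and empty sets shows that there is
  one.\<close>

lemma total_variation_prob:
  assumes N: "prob_space N" "sets N = sets borel" and B: "B \<in> sets borel"
  shows "total_variation (\<lambda>B. complex_of_real (measure N B)) B = emeasure N B"
proof -
  interpret prob_space N by (rule N)
  let ?P = "{E :: nat \<Rightarrow> 'a set. range E \<subseteq> sets borel \<and> disjoint_family E \<and> (\<Union>n. E n) = B}"
  have "(\<Sum>n. ennreal (cmod (complex_of_real (measure N (E n))))) = emeasure N B" if "E \<in> ?P" for E
  proof -
    have "(\<Sum>n. ennreal (cmod (complex_of_real (measure N (E n))))) = (\<Sum>n. emeasure N (E n))"
      by (simp add: emeasure_eq_measure)
    also have "\<dots> = emeasure N B" using that by (subst suminf_emeasure) (auto simp: N(2))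
    finally show ?thesis .
  qed
  then have "total_variation (\<lambda>B. complex_of_real (measure N B)) B = (SUP E\<in>?P. emeasure N B)"
    unfolding total_variation_def by (intro SUP_cong refl)
  also have "\<dots> = emeasure N B"
  proof (rule cSUP_const)
    have "(\<lambda>n::nat. if n = 0 then B else {}) \<in> ?P"
      using B by (auto simp: disjoint_family_on_def split: if_splits)
    then show "?P \<noteq> {}" by blast
  qed
  finally show ?thesis .
qed

lemma finite_regular_complex_measure_prob:
  fixes N :: "'a::t2_space measure"
  assumes "regular_prob N"
  shows "finite_regular_complex_measure (\<lambda>B. complex_of_real (measure N B))"
proof -
  have N: "prob_space N" "sets N = sets borel" using assms by (auto simp: regular_prob_def)
  interpret prob_space N by (rule N)
  have tv: "total_variation (\<lambda>B. complex_of_real (measure N B)) B = emeasure N B" if "B \<in> sets borel" for B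
    by (rule total_variation_prob[OF N that])
  have "complex_borel_measure (\<lambda>B. complex_of_real (measure N B))"
    unfolding complex_borel_measure_def
  proof (intro conjI allI impI)
    fix E :: "nat \<Rightarrow> 'a set" assume "range E \<subseteq> sets borel" "disjoint_family E"
    then have "(\<lambda>n. measure N (E n)) sums measure N (\<Union>n. E n)"
      by (intro finite_measure_UNION) (auto simp: N(2))
    then show "(\<lambda>n. complex_of_real (measure N (E n))) sums complex_of_real (measure N (\<Union>n. E n))"
      by (rule sums_of_real)
  qed simp
  moreover have "total_variation (\<lambda>B. complex_of_real (measure N B)) UNIV < \<infinity>"
    by (simp add: tv emeasure_eq_measure)
  moreover have "total_variation (\<lambda>B. complex_of_real (measure N B)) B =
      (INF U\<in>{U. open U \<and> B \<subseteq> U}. total_variation (\<lambda>B. complex_of_real (measure N B)) U) \<and>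
      total_variation (\<lambda>B. complex_of_real (measure N B)) B =
      (SUP K\<in>{K. compact K \<and> K \<subseteq> B}. total_variation (\<lambda>B. complex_of_real (measure N B)) K)"
    if B: "B \<in> sets borel" for B
  proof -
    have 1: "(INF U\<in>{U. open U \<and> B \<subseteq> U}. total_variation (\<lambda>B. complex_of_real (measure N B)) U) =
        (INF U\<in>{U. open U \<and> B \<subseteq> U}. emeasure N U)"
      by (intro INF_cong refl tv) auto
    have 2: "(SUP K\<in>{K. compact K \<and> K \<subseteq> B}. total_variation (\<lambda>B. complex_of_real (measure N B)) K) =
        (SUP K\<in>{K. compact K \<and> K \<subseteq> B}. emeasure N K)"
      by (intro SUP_cong refl tv) (auto intro: borel_closed compact_imp_closed)
    show ?thesis unfolding 1 2 tv[OF B] using assms B unfolding regular_prob_def by blast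
  qed
  ultimately show ?thesis unfolding finite_regular_complex_measure_def by blast
qed

section \<open>Functionals on an invariant algebra and their measures\<close>

locale haar_algebra = haar H for H :: "'a::{topological_ab_group_add, t2_space} measure" +
  fixes A :: "('a \<Rightarrow> complex) set"
  assumes A: "invariant_algebra A"
begin

sublocale character_semigroup H "Sp A"
  by unfold_locales (auto simp: Sp_def intro: Sp_one[OF A] Sp_mult[OF A, unfolded Sp_def]
      characters_one characters_mult invariant_algebraD[OF A])

lemma Sp_A: "\<gamma> \<in> Sp A \<Longrightarrow> \<gamma> \<in> A"
  by (simp add: Sp_def)

lemma A_cont: "f \<in> A \<Longrightarrow> continuous_on UNIV f"
  by (rule invariant_algebraD(1)[OF A])

lemma trig_A: "p \<in> trig (Sp A) \<Longrightarrow> p \<in> A"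
  using trig_subset_algebra[OF A] by blast

lemma A_diff: "f \<in> A \<Longrightarrow> g \<in> A \<Longrightarrow> (\<lambda>x. f x - g x) \<in> A"
  using invariant_algebraD(3)[OF A, of f "\<lambda>x. (- 1) * g x"] invariant_algebraD(5)[OF A, of g "- 1"] by simp

lemma trig_sequence:
  assumes "f \<in> A"
  obtains P where "\<And>n. P n \<in> trig (Sp A)" "uniform_limit UNIV P f sequentially"
proof -
  have "\<exists>p\<in>trig (Sp A). \<forall>x. cmod (f x - p x) \<le> inverse (real (Suc n))" for n
    by (rule trig_dense[OF A assms]) simp
  then obtain P where P: "\<And>n. P n \<in> trig (Sp A)" "\<And>n x. cmod (f x - P n x) \<le> inverse (real (Suc n))"
    by metis
  have "uniform_limit UNIV P f sequentially" by (rule uniform_limit_inverse) (rule P(2))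
  with P(1) show ?thesis by (rule that)
qed

lemma functionalD:
  assumes "\<phi> \<in> mult_functionals A"
  shows "f \<in> A \<Longrightarrow> g \<in> A \<Longrightarrow> \<phi> (\<lambda>x. f x + g x) = \<phi> f + \<phi> g"
    "f \<in> A \<Longrightarrow> \<phi> (\<lambda>x. c * f x) = c * \<phi> f"
    "f \<in> A \<Longrightarrow> g \<in> A \<Longrightarrow> \<phi> (\<lambda>x. f x * g x) = \<phi> f * \<phi> g"
    "\<phi> \<in> extensional A"
  using assms by (auto simp: mult_functionals_def)

lemma functional_one:
  assumes p: "\<phi> \<in> mult_functionals A"
  shows "\<phi> (\<lambda>x. 1) = 1"
proof -
  obtain f where f: "f \<in> A" "\<phi> f \<noteq> 0" using p by (auto simp: mult_functionals_def)
  have "\<phi> f = \<phi> f * \<phi> (\<lambda>x. 1)" using functionalD(3)[OF p f(1) invariant_algebraD(2)[OF A, of 1]] by simp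
  then show ?thesis using f(2) by simp
qed

lemma functional_diff:
  assumes p: "\<phi> \<in> mult_functionals A" and fg: "f \<in> A" "g \<in> A"
  shows "\<phi> (\<lambda>x. f x - g x) = \<phi> f - \<phi> g"
  using functionalD(1)[OF p fg(1) invariant_algebraD(5)[OF A fg(2), of "- 1"]] functionalD(2)[OF p fg(2), of "- 1"]
  by simp

lemma functional_sum:
  assumes p: "\<phi> \<in> mult_functionals A" and F: "finite F" "F \<subseteq> A"
  shows "\<phi> (\<lambda>x. \<Sum>\<gamma>\<in>F. c \<gamma> * \<gamma> x) = (\<Sum>\<gamma>\<in>F. c \<gamma> * \<phi> \<gamma>)"
  using F
proof (induction F rule: finite_induct)
  case empty
  have "(\<lambda>x. 0 * 1) = (\<lambda>x::'a. 0 :: complex)" by simp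
  then show ?case using functionalD(2)[OF p invariant_algebraD(2)[OF A, of 1], of 0] by simp
next
  case (insert \<gamma> F)
  have "(\<lambda>x. \<Sum>\<gamma>\<in>F. c \<gamma> * \<gamma> x) \<in> A"
    using insert by (intro invariant_algebra_sum[OF A] invariant_algebraD(5)[OF A]) auto
  moreover have "(\<lambda>x. c \<gamma> * \<gamma> x) \<in> A" using insert by (intro invariant_algebraD(5)[OF A]) auto
  ultimately show ?case using insert functionalD(1)[OF p] functionalD(2)[OF p] by simp
qed

text \<open>Otherwise \<open>1 - f / \<phi> f\<close> would be inverted in \<open>A\<close> by its Neumann series, although \<open>\<phi>\<close> kills it.\<close>

lemma functional_bound:
  assumes p: "\<phi> \<in> mult_functionals A" and f: "f \<in> A" and B: "\<And>x. cmod (f x) \<le> B"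
  shows "cmod (\<phi> f) \<le> B"
proof (rule ccontr)
  assume "\<not> cmod (\<phi> f) \<le> B"
  then have gt: "cmod (\<phi> f) > B" by simp
  have B0: "B \<ge> 0" using B[of 0] norm_ge_zero order_trans by blast
  then have ne: "\<phi> f \<noteq> 0" using gt by auto
  define g where "g = (\<lambda>x. (1 / \<phi> f) * f x)"
  define q where "q = B / cmod (\<phi> f)"
  have q: "0 \<le> q" "q < 1" using B0 gt by (auto simp: q_def divide_less_eq)
  have gq: "cmod (g x) \<le> q" for x
    using B[of x] by (simp add: g_def q_def norm_mult norm_divide divide_right_mono)
  then have g1: "cmod (g x) < 1" for x using q by (meson le_less_trans)
  have gne: "1 - g x \<noteq> 0" for x using g1[of x] by auto
  have gA: "g \<in> A" unfolding g_def by (rule invariant_algebraD(5)[OF A f])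
  have pg: "\<phi> g = 1" unfolding g_def functionalD(2)[OF p f] using ne by simp
  have powA: "(\<lambda>x. g x ^ i) \<in> A" for i
  proof (induction i)
    case (Suc i) from invariant_algebraD(4)[OF A gA Suc] show ?case by simp
  qed (simp add: invariant_algebraD[OF A])
  \<comment> \<open>The partial geometric sums lie in the algebra and differ from the inverse by at
    most \<open>q ^ n / (1 - q)\<close>, uniformly in \<open>x\<close>.\<close>
  have sA: "(\<lambda>x. 1 / (1 - g x)) \<in> A"
  proof (rule invariant_algebra_closed[OF cpt A])
    fix e :: real assume e: "e > 0"
    have "e * (1 - q) > 0" using e q by simp
    moreover have "(\<lambda>n. q ^ n) \<longlonglongrightarrow> 0" using q by (intro LIMSEQ_power_zero) simp
    ultimately have "\<forall>\<^sub>F n in sequentially. q ^ n < e * (1 - q)" by (metis order_tendstoD(2))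
    then obtain n where n: "q ^ n < e * (1 - q)" by (auto simp: eventually_sequentially)
    have "cmod (1 / (1 - g x) - (\<Sum>i<n. g x ^ i)) \<le> e" for x
    proof -
      have "(\<Sum>i<n. g x ^ i) = (1 - g x ^ n) / (1 - g x)" using gne[of x] by (simp add: sum_gp_strict)
      then have "1 / (1 - g x) - (\<Sum>i<n. g x ^ i) = g x ^ n / (1 - g x)" by (simp add: diff_divide_distrib)
      then have "cmod (1 / (1 - g x) - (\<Sum>i<n. g x ^ i)) = cmod (g x) ^ n / cmod (1 - g x)"
        by (simp add: norm_divide norm_power)
      also have "\<dots> \<le> q ^ n / (1 - q)"
      proof (rule frac_le)
        show "cmod (g x) ^ n \<le> q ^ n" using gq by (intro power_mono) auto
        show "1 - q \<le> cmod (1 - g x)" using norm_triangle_ineq2[of 1 "g x"] gq[of x] by simp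
      qed (use q in auto)
      also have "\<dots> \<le> e" using n q by (simp add: divide_le_eq)
      finally show ?thesis .
    qed
    moreover have "(\<lambda>x. \<Sum>i<n. g x ^ i) \<in> A" by (intro invariant_algebra_sum[OF A] powA) simp
    ultimately show "\<exists>s\<in>A. \<forall>x. cmod (1 / (1 - g x) - s x) \<le> e" by (intro bexI[of _ "\<lambda>x. \<Sum>i<n. g x ^ i"]) auto
  qed
  have dA: "(\<lambda>x. 1 - g x) \<in> A" using A_diff[OF invariant_algebraD(2)[OF A, of 1] gA] .
  have "\<phi> (\<lambda>x. 1 / (1 - g x) * (1 - g x)) = \<phi> (\<lambda>x. 1 / (1 - g x)) * \<phi> (\<lambda>x. 1 - g x)"
    by (rule functionalD(3)[OF p sA dA])
  moreover have "\<phi> (\<lambda>x. 1 - g x) = 0"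
    using functional_diff[OF p invariant_algebraD(2)[OF A, of 1] gA] by (simp add: pg functional_one[OF p])
  ultimately show False using functional_one[OF p] gne by simp
qed

lemma functional_limit:
  assumes p: "\<phi> \<in> mult_functionals A" and g: "\<And>n. g n \<in> A" and f: "f \<in> A"
    and lim: "uniform_limit UNIV g f sequentially"
  shows "(\<lambda>n. \<phi> (g n)) \<longlonglongrightarrow> \<phi> f"
proof (rule tendstoI)
  fix e :: real assume e: "e > 0"
  have "\<forall>\<^sub>F n in sequentially. \<forall>x\<in>UNIV. dist (g n x) (f x) < e / 2"
    using lim e by (intro uniform_limitD) auto
  then show "\<forall>\<^sub>F n in sequentially. dist (\<phi> (g n)) (\<phi> f) < e"
  proof (rule eventually_mono)
    fix n assume n: "\<forall>x\<in>UNIV. dist (g n x) (f x) < e / 2"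
    have "cmod (\<phi> (\<lambda>x. g n x - f x)) \<le> e / 2"
      using n by (intro functional_bound[OF p A_diff[OF g f]]) (auto simp: dist_norm less_imp_le)
    then show "dist (\<phi> (g n)) (\<phi> f) < e" using e by (simp add: functional_diff[OF p g f] dist_norm)
  qed
qed

lemma functional_eqI:
  assumes p: "\<phi> \<in> mult_functionals A" and s: "\<psi> \<in> mult_functionals A"
    and eq: "\<And>\<gamma>. \<gamma> \<in> Sp A \<Longrightarrow> \<phi> \<gamma> = \<psi> \<gamma>"
  shows "\<phi> = \<psi>"
proof (rule extensionalityI[OF functionalD(4)[OF p] functionalD(4)[OF s]])
  fix f assume f: "f \<in> A"
  obtain P where P: "\<And>n. P n \<in> trig (Sp A)" "uniform_limit UNIV P f sequentially" using trig_sequence[OF f] by metis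
  have "\<phi> (P n) = \<psi> (P n)" for n
  proof -
    obtain F c where F: "finite F" "F \<subseteq> Sp A" "P n = (\<lambda>x. \<Sum>\<gamma>\<in>F. c \<gamma> * \<gamma> x)"
      using P(1)[of n] by (auto simp: trig_def)
    have "F \<subseteq> A" using F(2) Sp_A by blast
    then show ?thesis unfolding F(3) functional_sum[OF p F(1) \<open>F \<subseteq> A\<close>] functional_sum[OF s F(1) \<open>F \<subseteq> A\<close>]
      using F(2) eq by (intro sum.cong) auto
  qed
  then show "\<phi> f = \<psi> f"
    using functional_limit[OF p trig_A[OF P(1)] f P(2)] functional_limit[OF s trig_A[OF P(1)] f P(2)]
    by (simp add: LIMSEQ_unique)
qed

lemma restrict_disc_hom:
  assumes p: "\<phi> \<in> mult_functionals A"
  shows "restrict \<phi> (Sp A) \<in> disc_homs (Sp A)"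
  unfolding disc_homs_def
proof (intro CollectI conjI ballI)
  show "restrict \<phi> (Sp A) \<in> Sp A \<rightarrow>\<^sub>E cball 0 1"
  proof (rule restrict_PiE_iff[THEN iffD2], intro ballI)
    fix \<gamma> assume g: "\<gamma> \<in> Sp A"
    then have "cmod (\<gamma> x) \<le> 1" for x using characterD(2)[of \<gamma> x] by (simp add: Sp_def)
    then show "\<phi> \<gamma> \<in> cball 0 1" using functional_bound[OF p Sp_A[OF g], of 1] by simp
  qed
  show "restrict \<phi> (Sp A) (\<lambda>x. \<gamma> x * \<delta> x) = restrict \<phi> (Sp A) \<gamma> * restrict \<phi> (Sp A) \<delta>"
    if "\<gamma> \<in> Sp A" "\<delta> \<in> Sp A" for \<gamma> \<delta>
    using that functionalD(3)[OF p, of \<gamma> \<delta>] by (simp add: S_mult Sp_A)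
  show "\<exists>\<gamma>\<in>Sp A. restrict \<phi> (Sp A) \<gamma> \<noteq> 0"
    using functional_one[OF p] by (intro bexI[OF _ S_one]) (simp add: S_one)
qed

lemma integral_trig:
  assumes N: "group_prob N" and F: "finite F" "F \<subseteq> Sp A"
  shows "(\<integral>x. (\<Sum>\<gamma>\<in>F. c \<gamma> * \<gamma> x) \<partial>N) = (\<Sum>\<gamma>\<in>F. c \<gamma> * (\<integral>x. \<gamma> x \<partial>N))"
proof -
  interpret N: group_prob N by (rule N)
  have "(\<integral>x. (\<Sum>\<gamma>\<in>F. c \<gamma> * \<gamma> x) \<partial>N) = (\<Sum>\<gamma>\<in>F. \<integral>x. c \<gamma> * \<gamma> x \<partial>N)"
    using F(2) by (intro Bochner_Integration.integral_sum N.integrable_continuous continuous_intros A_cont Sp_A) auto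
  then show ?thesis by simp
qed

text \<open>The measure of the restricted homomorphism reproduces \<phi> on characters. Both the
  integral and \<phi> are linear and continuous for uniform convergence, so density of trigonometric
  polynomials extends the agreement to \<open>A\<close>.\<close>

lemma functional_measure:
  assumes p: "\<phi> \<in> mult_functionals A"
  obtains N where "regular_prob N" "\<And>f. f \<in> A \<Longrightarrow> (\<integral>x. f x \<partial>N) = \<phi> f"
proof -
  obtain N where N: "regular_prob N" "\<And>\<gamma>. \<gamma> \<in> Sp A \<Longrightarrow> (\<integral>x. \<gamma> x \<partial>N) = restrict \<phi> (Sp A) \<gamma>"
    using disc_hom_measure[OF restrict_disc_hom[OF p]] by metis
  interpret N: group_prob N using cpt N(1) by unfold_locales
  have "(\<integral>x. f x \<partial>N) = \<phi> f" if f: "f \<in> A" for f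
  proof -
    obtain P where P: "\<And>n. P n \<in> trig (Sp A)" "uniform_limit UNIV P f sequentially" using trig_sequence[OF f] by metis
    have "(\<integral>x. P n x \<partial>N) = \<phi> (P n)" for n
    proof -
      obtain F c where F: "finite F" "F \<subseteq> Sp A" "P n = (\<lambda>x. \<Sum>\<gamma>\<in>F. c \<gamma> * \<gamma> x)"
        using P(1)[of n] by (auto simp: trig_def)
      have FA: "F \<subseteq> A" using F(2) Sp_A by blast
      show ?thesis
        unfolding F(3) functional_sum[OF p F(1) FA] integral_trig[OF N.group_prob_axioms F(1,2)]
        using F(2) N(2) by (intro sum.cong) (auto simp: subset_iff)
    qed
    then have "(\<lambda>n. \<phi> (P n)) \<longlonglongrightarrow> (\<integral>x. f x \<partial>N)"
      using N.integral_uniform_limit[OF A_cont[OF trig_A[OF P(1)]] P(2)] by simp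
    then show ?thesis using functional_limit[OF p trig_A[OF P(1)] f P(2)] LIMSEQ_unique by blast
  qed
  with N(1) show ?thesis by (rule that)
qed

text \<open>Integration against the measure of \<open>h\<close> is multiplicative on characters,
  hence on trigonometric polynomials by bilinear expansion, hence on \<open>A\<close> by uniform
  limits.\<close>

lemma disc_hom_extends:
  assumes h: "h \<in> disc_homs (Sp A)"
  obtains \<phi> where "\<phi> \<in> mult_functionals A" "restrict \<phi> (Sp A) = h"
proof -
  obtain N where N: "regular_prob N" "\<And>\<gamma>. \<gamma> \<in> Sp A \<Longrightarrow> (\<integral>x. \<gamma> x \<partial>N) = h \<gamma>"
    using disc_hom_measure[OF h] by metis
  interpret N: group_prob N using cpt N(1) by unfold_locales
  have trig_mult: "(\<integral>x. p x * q x \<partial>N) = (\<integral>x. p x \<partial>N) * (\<integral>x. q x \<partial>N)"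
    if pq: "p \<in> trig (Sp A)" "q \<in> trig (Sp A)" for p q
  proof -
    obtain F c where F: "finite F" "F \<subseteq> Sp A" "p = (\<lambda>x. \<Sum>\<gamma>\<in>F. c \<gamma> * \<gamma> x)" using pq(1) by (auto simp: trig_def)
    obtain G d where G: "finite G" "G \<subseteq> Sp A" "q = (\<lambda>x. \<Sum>\<gamma>\<in>G. d \<gamma> * \<gamma> x)" using pq(2) by (auto simp: trig_def)
    have c: "continuous_on UNIV \<gamma>" if "\<gamma> \<in> Sp A" for \<gamma> using that by (intro A_cont Sp_A)
    have hm: "(\<integral>x. \<gamma> x * \<delta> x \<partial>N) = h \<gamma> * h \<delta>" if "\<gamma> \<in> Sp A" "\<delta> \<in> Sp A" for \<gamma> \<delta>
      using N(2)[OF S_mult[OF that]] h that by (simp add: disc_homs_def)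
    have "(\<integral>x. p x * q x \<partial>N) = (\<integral>x. (\<Sum>\<gamma>\<in>F. \<Sum>\<delta>\<in>G. (c \<gamma> * d \<delta>) * (\<gamma> x * \<delta> x)) \<partial>N)"
      unfolding F(3) G(3) by (simp add: sum_product mult_ac)
    also have "\<dots> = (\<Sum>\<gamma>\<in>F. \<integral>x. (\<Sum>\<delta>\<in>G. (c \<gamma> * d \<delta>) * (\<gamma> x * \<delta> x)) \<partial>N)"
      using F G by (intro Bochner_Integration.integral_sum N.integrable_continuous continuous_intros c) auto
    also have "\<dots> = (\<Sum>\<gamma>\<in>F. \<Sum>\<delta>\<in>G. \<integral>x. (c \<gamma> * d \<delta>) * (\<gamma> x * \<delta> x) \<partial>N)"
      using F G by (intro sum.cong refl Bochner_Integration.integral_sum N.integrable_continuous continuous_intros c) auto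
    also have "\<dots> = (\<Sum>\<gamma>\<in>F. \<Sum>\<delta>\<in>G. (c \<gamma> * h \<gamma>) * (d \<delta> * h \<delta>))"
      using F(2) G(2) hm by (intro sum.cong refl) (auto simp: subset_iff)
    also have "\<dots> = (\<Sum>\<gamma>\<in>F. c \<gamma> * h \<gamma>) * (\<Sum>\<delta>\<in>G. d \<delta> * h \<delta>)" by (simp add: sum_product)
    also have "\<dots> = (\<integral>x. p x \<partial>N) * (\<integral>x. q x \<partial>N)"
      unfolding F(3) G(3) integral_trig[OF N.group_prob_axioms F(1,2)] integral_trig[OF N.group_prob_axioms G(1,2)]
      using F(2) G(2) N(2) by (intro arg_cong2[of _ _ _ _ "(*)"] sum.cong) (auto simp: subset_iff)
    finally show ?thesis .
  qed
  have mult: "(\<integral>x. f x * g x \<partial>N) = (\<integral>x. f x \<partial>N) * (\<integral>x. g x \<partial>N)" if f: "f \<in> A" and g: "g \<in> A" for f g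
  proof -
    obtain P where P: "\<And>n. P n \<in> trig (Sp A)" "uniform_limit UNIV P f sequentially" using trig_sequence[OF f] by metis
    obtain Q where Q: "\<And>n. Q n \<in> trig (Sp A)" "uniform_limit UNIV Q g sequentially" using trig_sequence[OF g] by metis
    have c: "continuous_on UNIV (P n)" "continuous_on UNIV (Q n)" for n
      using P(1) Q(1) by (auto intro: A_cont trig_A)
    have bd: "bounded (u ` UNIV)" if "u \<in> A" for u
      by (rule compact_imp_bounded[OF compact_continuous_image[OF A_cont[OF that] cpt]])
    have "uniform_limit UNIV (\<lambda>n x. P n x * Q n x) (\<lambda>x. f x * g x) sequentially"
      by (intro uniform_lim_mult P Q bd f g)
    then have "(\<lambda>n. \<integral>x. P n x * Q n x \<partial>N) \<longlonglongrightarrow> (\<integral>x. f x * g x \<partial>N)"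
      by (intro N.integral_uniform_limit continuous_intros c)
    moreover have "(\<lambda>n. (\<integral>x. P n x \<partial>N) * (\<integral>x. Q n x \<partial>N)) \<longlonglongrightarrow> (\<integral>x. f x \<partial>N) * (\<integral>x. g x \<partial>N)"
      by (intro tendsto_intros N.integral_uniform_limit c P Q)
    ultimately show ?thesis using LIMSEQ_unique by (simp add: trig_mult[OF P(1) Q(1)])
  qed
  define \<phi> where "\<phi> = (\<lambda>f\<in>A. \<integral>x. f x \<partial>N)"
  have "\<phi> \<in> mult_functionals A"
    unfolding mult_functionals_def
  proof (intro CollectI conjI ballI allI)
    show "\<phi> \<in> extensional A" by (simp add: \<phi>_def)
    fix f g assume f: "f \<in> A" and g: "g \<in> A"
    show "\<phi> (\<lambda>x. f x + g x) = \<phi> f + \<phi> g"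
      using f g by (simp add: \<phi>_def invariant_algebraD[OF A] N.integrable_continuous A_cont)
    show "\<phi> (\<lambda>x. f x * g x) = \<phi> f * \<phi> g"
      using f g by (simp add: \<phi>_def invariant_algebraD[OF A] mult)
  next
    fix c f assume f: "f \<in> A"
    then show "\<phi> (\<lambda>x. c * f x) = c * \<phi> f" by (simp add: \<phi>_def invariant_algebraD[OF A])
  next
    show "\<exists>f\<in>A. \<phi> f \<noteq> 0"
      by (intro bexI[of _ "\<lambda>x. 1"]) (simp_all add: \<phi>_def invariant_algebraD[OF A] N.prob_space)
  qed
  moreover have "restrict \<phi> (Sp A) = h"
  proof (rule extensionalityI)
    show "restrict \<phi> (Sp A) \<in> extensional (Sp A)" by simp
    show "h \<in> extensional (Sp A)" using h by (auto simp: disc_homs_def PiE_def)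
    show "restrict \<phi> (Sp A) \<gamma> = h \<gamma>" if "\<gamma> \<in> Sp A" for \<gamma>
      using that N(2) by (simp add: \<phi>_def Sp_A)
  qed
  ultimately show ?thesis by (rule that)
qed

text \<open>\<open>T f x\<close> is the value of \<phi> at the translate of \<open>f\<close> by
  \<open>x\<close>. On trigonometric polynomials \<open>T\<close> multiplies the coefficient at
  \<gamma> by \<open>\<phi> \<gamma>\<close>, and it does not increase distances in the sup-norm, so
  it maps \<open>A\<close> into \<open>A\<close>. Inner integration against any representing measure
  of \<phi> produces \<open>T f\<close>, outer integration against any one of \<psi> produces
  \<open>\<psi> (T f)\<close>; this makes the definite description meaningful.\<close>

lemma convolution_eq:
  assumes p: "\<phi> \<in> mult_functionals A" and s: "\<psi> \<in> mult_functionals A" and e: "\<eta> \<in> mult_functionals A"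
    and eq: "\<And>\<gamma>. \<gamma> \<in> Sp A \<Longrightarrow> \<eta> \<gamma> = \<phi> \<gamma> * \<psi> \<gamma>"
  shows "convolution A \<phi> \<psi> = \<eta>"
proof (rule extensionalityI[of _ A])
  show "convolution A \<phi> \<psi> \<in> extensional A" by (simp add: convolution_def)
  show "\<eta> \<in> extensional A" by (rule functionalD(4)[OF e])
  fix f assume f: "f \<in> A"
  define T where "T u x = \<phi> (\<lambda>g. u (g + x))" for u :: "'a \<Rightarrow> complex" and x
  obtain P where P: "\<And>n. P n \<in> trig (Sp A)" "uniform_limit UNIV P f sequentially" using trig_sequence[OF f] by metis
  have tA: "(\<lambda>g. u (g + x)) \<in> A" if "u \<in> A" for u x by (rule invariant_algebraD(6)[OF A that])
  have TP: "T (P n) \<in> A \<and> \<psi> (T (P n)) = \<eta> (P n)" for n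
  proof -
    obtain F c where F: "finite F" "F \<subseteq> Sp A" "P n = (\<lambda>x. \<Sum>\<gamma>\<in>F. c \<gamma> * \<gamma> x)"
      using P(1)[of n] by (auto simp: trig_def)
    have FA: "F \<subseteq> A" using F(2) Sp_A by blast
    have "T (P n) = (\<lambda>x. \<Sum>\<gamma>\<in>F. (c \<gamma> * \<phi> \<gamma>) * \<gamma> x)"
    proof
      fix x
      have "T (P n) x = \<phi> (\<lambda>g. \<Sum>\<gamma>\<in>F. (c \<gamma> * \<gamma> x) * \<gamma> g)"
        unfolding T_def F(3) using F(2)
        by (intro arg_cong[of _ _ \<phi>] ext sum.cong) (auto simp: Sp_def subset_iff characterD(3) mult_ac)
      also have "\<dots> = (\<Sum>\<gamma>\<in>F. (c \<gamma> * \<gamma> x) * \<phi> \<gamma>)" by (rule functional_sum[OF p F(1) FA])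
      finally show "T (P n) x = (\<Sum>\<gamma>\<in>F. (c \<gamma> * \<phi> \<gamma>) * \<gamma> x)" by (simp add: mult_ac)
    qed
    moreover have "(\<lambda>x. \<Sum>\<gamma>\<in>F. (c \<gamma> * \<phi> \<gamma>) * \<gamma> x) \<in> A"
      using FA F(1) by (intro invariant_algebra_sum[OF A] invariant_algebraD(5)[OF A]) auto
    moreover have "\<psi> (\<lambda>x. \<Sum>\<gamma>\<in>F. (c \<gamma> * \<phi> \<gamma>) * \<gamma> x) = \<eta> (P n)"
      unfolding F(3) functional_sum[OF s F(1) FA] functional_sum[OF e F(1) FA]
      using F(2) eq by (intro sum.cong) (auto simp: subset_iff)
    ultimately show ?thesis by simp
  qed
  have lim: "uniform_limit UNIV (\<lambda>n. T (P n)) (T f) sequentially"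
  proof (rule uniform_limitI)
    fix r :: real assume r: "r > 0"
    have "\<forall>\<^sub>F n in sequentially. \<forall>x\<in>UNIV. dist (P n x) (f x) < r / 2"
      using P(2) r by (intro uniform_limitD) auto
    then show "\<forall>\<^sub>F n in sequentially. \<forall>x\<in>UNIV. dist (T (P n) x) (T f x) < r"
    proof (rule eventually_mono, intro ballI)
      fix n x assume n: "\<forall>x\<in>UNIV. dist (P n x) (f x) < r / 2"
      have "cmod (\<phi> (\<lambda>g. P n (g + x) - f (g + x))) \<le> r / 2"
        using n by (intro functional_bound[OF p A_diff[OF tA[OF trig_A[OF P(1)]] tA[OF f]]])
          (auto simp: dist_norm less_imp_le)
      then show "dist (T (P n) x) (T f x) < r"
        using r functional_diff[OF p tA[OF trig_A[OF P(1)], of n x] tA[OF f, of x]] by (simp add: T_def dist_norm)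
    qed
  qed
  have TA: "T f \<in> A"
  proof (rule invariant_algebra_closed[OF cpt A])
    fix r :: real assume "r > 0"
    then have "\<forall>\<^sub>F n in sequentially. \<forall>x\<in>UNIV. dist (T (P n) x) (T f x) < r" using lim by (intro uniform_limitD)
    then obtain n where n: "\<forall>x\<in>UNIV. dist (T (P n) x) (T f x) < r" by (auto simp: eventually_sequentially)
    show "\<exists>g\<in>A. \<forall>x. cmod (T f x - g x) \<le> r"
      using n TP[of n] by (intro bexI[of _ "T (P n)"]) (auto simp: dist_norm norm_minus_commute less_imp_le)
  qed
  have "(\<lambda>n. \<psi> (T (P n))) \<longlonglongrightarrow> \<psi> (T f)" using TP by (intro functional_limit[OF s _ TA lim]) blast
  moreover have "(\<lambda>n. \<eta> (P n)) \<longlonglongrightarrow> \<eta> f" by (rule functional_limit[OF e trig_A[OF P(1)] f P(2)])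
  ultimately have val: "\<psi> (T f) = \<eta> f" using TP LIMSEQ_unique by simp
  have int: "complex_measure_integral \<nu> (\<lambda>h. complex_measure_integral \<mu> (\<lambda>g. f (g + h))) = \<eta> f"
    if "representing_measure A \<phi> \<mu>" "representing_measure A \<psi> \<nu>" for \<mu> \<nu>
  proof -
    have "(\<lambda>h. complex_measure_integral \<mu> (\<lambda>g. f (g + h))) = T f"
      using that(1) tA[OF f] by (auto simp: representing_measure_def T_def)
    then show ?thesis using that(2) TA val by (simp add: representing_measure_def)
  qed
  \<comment> \<open>Uniqueness of the value alone would not suffice for \<open>THE\<close>; a
    witness comes from the probability measure of the functional.\<close>
  have ex: "\<exists>\<mu>. representing_measure A \<theta> \<mu>" if th: "\<theta> \<in> mult_functionals A" for \<theta>
  proof -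
    obtain N where N: "regular_prob N" "\<And>f. f \<in> A \<Longrightarrow> (\<integral>x. f x \<partial>N) = \<theta> f"
      using functional_measure[OF th] by metis
    then have "representing_measure A \<theta> (\<lambda>B. complex_of_real (measure N B))"
      unfolding representing_measure_def
      using finite_regular_complex_measure_prob[OF N(1)]
      by (auto simp: complex_measure_integral_prob regular_prob_def)
    then show ?thesis by blast
  qed
  obtain \<mu> \<nu> where mn: "representing_measure A \<phi> \<mu>" "representing_measure A \<psi> \<nu>" using ex[OF p] ex[OF s] by blast
  have "(THE z. \<exists>\<mu> \<nu>. representing_measure A \<phi> \<mu> \<and> representing_measure A \<psi> \<nu> \<and>
        z = complex_measure_integral \<nu> (\<lambda>h. complex_measure_integral \<mu> (\<lambda>g. f (g + h)))) = \<eta> f"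
  proof (rule the_equality)
    show "\<exists>\<mu> \<nu>. representing_measure A \<phi> \<mu> \<and> representing_measure A \<psi> \<nu> \<and>
        \<eta> f = complex_measure_integral \<nu> (\<lambda>h. complex_measure_integral \<mu> (\<lambda>g. f (g + h)))"
      using mn int[OF mn] by (intro exI[of _ \<mu>] exI[of _ \<nu>]) simp
  qed (use int in auto)
  then show "convolution A \<phi> \<psi> f = \<eta> f" using f by (simp add: convolution_def)
qed

text \<open>The operation fixes every character and conjugates coefficients, so it preserves
  trigonometric polynomials over \<open>Sp A\<close>; it is isometric, and closedness does the
  rest.\<close>

lemma star_mem:
  assumes f: "f \<in> A"
  shows "star f \<in> A"
proof (rule invariant_algebra_closed[OF cpt A])
  fix e :: real assume "e > 0"
  from trig_dense[OF A f this] obtain p where p: "p \<in> trig (Sp A)" "\<forall>x. cmod (f x - p x) \<le> e" by blast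
  obtain F c where F: "finite F" "F \<subseteq> Sp A" "p = (\<lambda>x. \<Sum>\<gamma>\<in>F. c \<gamma> * \<gamma> x)" using p(1) by (auto simp: trig_def)
  have "star p = (\<lambda>x. \<Sum>\<gamma>\<in>F. cnj (c \<gamma>) * \<gamma> x)"
    unfolding star_def F(3) using F(2) by (auto simp: Sp_def subset_iff characterD(5) intro!: sum.cong)
  moreover have "(\<lambda>x. \<Sum>\<gamma>\<in>F. cnj (c \<gamma>) * \<gamma> x) \<in> A"
    using F by (intro invariant_algebra_sum[OF A] invariant_algebraD(5)[OF A]) (auto intro: Sp_A)
  moreover have "cmod (star f x - star p x) \<le> e" for x
    using p(2) by (simp add: star_def flip: complex_cnj_diff)
  ultimately show "\<exists>g\<in>A. \<forall>x. cmod (star f x - g x) \<le> e" by (intro bexI[of _ "star p"]) auto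
qed

lemma star_character: "\<gamma> \<in> Sp A \<Longrightarrow> star \<gamma> = \<gamma>"
  by (auto simp: star_def Sp_def characterD(5))

lemma involution_mem:
  assumes p: "\<phi> \<in> mult_functionals A"
  shows "involution A \<phi> \<in> mult_functionals A"
  unfolding mult_functionals_def
proof (intro CollectI conjI ballI allI)
  show "involution A \<phi> \<in> extensional A" by (simp add: involution_def)
  fix f g assume f: "f \<in> A" and g: "g \<in> A"
  have "star (\<lambda>x. f x + g x) = (\<lambda>x. star f x + star g x)" "star (\<lambda>x. f x * g x) = (\<lambda>x. star f x * star g x)"
    by (simp_all add: star_def)
  then show "involution A \<phi> (\<lambda>x. f x + g x) = involution A \<phi> f + involution A \<phi> g"
    "involution A \<phi> (\<lambda>x. f x * g x) = involution A \<phi> f * involution A \<phi> g"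
    using f g by (simp_all add: involution_def invariant_algebraD[OF A] functionalD[OF p] star_mem)
next
  fix c f assume f: "f \<in> A"
  have "star (\<lambda>x. c * f x) = (\<lambda>x. cnj c * star f x)" by (simp add: star_def)
  then show "involution A \<phi> (\<lambda>x. c * f x) = c * involution A \<phi> f"
    using f by (simp add: involution_def invariant_algebraD[OF A] functionalD[OF p] star_mem)
next
  have "star (\<lambda>x. 1) = (\<lambda>x::'a. 1)" by (simp add: star_def)
  then show "\<exists>f\<in>A. involution A \<phi> f \<noteq> 0"
    by (intro bexI[of _ "\<lambda>x. 1"]) (simp_all add: involution_def invariant_algebraD[OF A] functional_one[OF p])
qed

text \<open>The inverse of the restriction map. The choice is only formal, since functionals are
  determined by their values on characters.\<close>

definition extend :: "(('a \<Rightarrow> complex) \<Rightarrow> complex) \<Rightarrow> ('a \<Rightarrow> complex) \<Rightarrow> complex" where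
  "extend h = (SOME \<phi>. \<phi> \<in> mult_functionals A \<and> restrict \<phi> (Sp A) = h)"

lemma extend:
  assumes "h \<in> disc_homs (Sp A)"
  shows "extend h \<in> mult_functionals A" "restrict (extend h) (Sp A) = h"
proof -
  have "\<exists>\<phi>. \<phi> \<in> mult_functionals A \<and> restrict \<phi> (Sp A) = h"
    using disc_hom_extends[OF assms] by metis
  from someI_ex[OF this] show "extend h \<in> mult_functionals A" "restrict (extend h) (Sp A) = h"
    by (simp_all add: extend_def)
qed

lemma extend_restrict:
  assumes p: "\<phi> \<in> mult_functionals A"
  shows "extend (restrict \<phi> (Sp A)) = \<phi>"
  by (rule functional_eqI[OF extend(1)[OF restrict_disc_hom[OF p]] p])
     (metis extend(2)[OF restrict_disc_hom[OF p]] restrict_apply)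

section \<open>Topologies and semigroup structure\<close>

lemma topspaces:
  "topspace (mult_functionals_topology A) = mult_functionals A"
  "topspace (disc_homs_topology (Sp A)) = disc_homs (Sp A)"
  by (auto simp: mult_functionals_topology_def disc_homs_topology_def mult_functionals_def disc_homs_def PiE_def)

lemma continuous_eval:
  "f \<in> A \<Longrightarrow> continuous_map (mult_functionals_topology A) euclidean (\<lambda>\<phi>. \<phi> f)"
  "\<gamma> \<in> Sp A \<Longrightarrow> continuous_map (disc_homs_topology (Sp A)) euclidean (\<lambda>h. h \<gamma>)"
  unfolding mult_functionals_topology_def disc_homs_topology_def
  by (intro continuous_map_from_subtopology continuous_map_product_projection; assumption)+

lemma continuous_map_into_homs:
  assumes "\<And>x. x \<in> topspace X \<Longrightarrow> g x \<in> disc_homs (Sp A)"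
    "\<And>\<gamma>. \<gamma> \<in> Sp A \<Longrightarrow> continuous_map X euclidean (\<lambda>x. g x \<gamma>)"
  shows "continuous_map X (disc_homs_topology (Sp A)) g"
  unfolding disc_homs_topology_def
proof (rule continuous_map_into_subtopology)
  show "continuous_map X (product_topology (\<lambda>_. euclidean) (Sp A)) g"
    unfolding continuous_map_componentwise using assms by (auto simp: disc_homs_def PiE_def)
qed (use assms in auto)

lemma continuous_restrict:
  "continuous_map (mult_functionals_topology A) (disc_homs_topology (Sp A)) (spectral_restriction A)"
  unfolding spectral_restriction_def[abs_def]
  by (rule continuous_map_into_homs)
     (auto simp: topspaces restrict_disc_hom continuous_eval Sp_A)

text \<open>Pointwise convergence on \<open>Sp A\<close> controls only trigonometric polynomials.
  For \<open>f\<close> in \<open>A\<close> the evaluation at \<open>f\<close> is a limit of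
  evaluations at such polynomials, uniformly over all homomorphisms because every functional is
  contractive, so it remains continuous.\<close>

lemma continuous_extend:
  "continuous_map (disc_homs_topology (Sp A)) (mult_functionals_topology A) extend"
  unfolding mult_functionals_topology_def
proof (rule continuous_map_into_subtopology)
  let ?X = "disc_homs_topology (Sp A)"
  show "extend \<in> topspace ?X \<rightarrow> mult_functionals A" using extend by (auto simp: topspaces)
  have "continuous_map ?X euclidean (\<lambda>h. extend h f)" if f: "f \<in> A" for f
  proof -
    obtain P where P: "\<And>n. P n \<in> trig (Sp A)" "uniform_limit UNIV P f sequentially" using trig_sequence[OF f] by metis
    have cP: "continuous_map ?X euclidean (\<lambda>h. extend h (P n))" for n
    proof -
      obtain F c where F: "finite F" "F \<subseteq> Sp A" "P n = (\<lambda>x. \<Sum>\<gamma>\<in>F. c \<gamma> * \<gamma> x)"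
        using P(1)[of n] by (auto simp: trig_def)
      have FA: "F \<subseteq> A" using F(2) Sp_A by blast
      have "continuous_map ?X euclidean (\<lambda>h. c \<gamma> * h \<gamma>)" if "\<gamma> \<in> F" for \<gamma>
      proof -
        have "continuous_map euclidean euclidean (\<lambda>z. c \<gamma> * z)" by (simp add: continuous_intros)
        from continuous_map_compose[OF continuous_eval(2) this, of \<gamma>] show ?thesis
          using that F(2) by (auto simp: o_def)
      qed
      then have "continuous_map ?X euclidean (\<lambda>h. \<Sum>\<gamma>\<in>F. c \<gamma> * h \<gamma>)"
        using F(1) by (intro continuous_map_sum) auto
      moreover have "(\<Sum>\<gamma>\<in>F. c \<gamma> * h \<gamma>) = extend h (P n)" if "h \<in> topspace ?X" for h
      proof -
        have h: "h \<in> disc_homs (Sp A)" using that by (simp add: topspaces)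
        have "extend h \<gamma> = h \<gamma>" if "\<gamma> \<in> F" for \<gamma>
          using that F(2) extend(2)[OF h] by (metis restrict_apply' subsetD)
        then show ?thesis unfolding F(3) functional_sum[OF extend(1)[OF h] F(1) FA] by simp
      qed
      ultimately show ?thesis by (rule continuous_map_eq)
    qed
    have "continuous_map ?X Met_TC.mtopology (\<lambda>h. extend h f)"
    proof (rule Met_TC.continuous_map_uniform_limit[where F = sequentially and f = "\<lambda>n h. extend h (P n)"])
      show "\<forall>\<^sub>F n in sequentially. continuous_map ?X Met_TC.mtopology (\<lambda>h. extend h (P n))"
        using cP by simp
      fix e :: real assume e: "e > 0"
      have "\<forall>\<^sub>F n in sequentially. \<forall>x\<in>UNIV. dist (P n x) (f x) < e / 2"
        using P(2) e by (intro uniform_limitD) auto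
      then show "\<forall>\<^sub>F n in sequentially. \<forall>h\<in>topspace ?X. extend h f \<in> UNIV \<and> dist (extend h (P n)) (extend h f) < e"
      proof (rule eventually_mono, intro ballI conjI UNIV_I)
        fix n h assume n: "\<forall>x\<in>UNIV. dist (P n x) (f x) < e / 2" and "h \<in> topspace ?X"
        then have eh: "extend h \<in> mult_functionals A" using extend(1) by (simp add: topspaces)
        have "cmod (extend h (\<lambda>x. P n x - f x)) \<le> e / 2"
          using n by (intro functional_bound[OF eh A_diff[OF trig_A[OF P(1)] f]]) (auto simp: dist_norm less_imp_le)
        then show "dist (extend h (P n)) (extend h f) < e"
          using e by (simp add: functional_diff[OF eh trig_A[OF P(1)] f] dist_norm)
      qed
    qed simp
    then show ?thesis by simp
  qed
  then show "continuous_map ?X (product_topology (\<lambda>_. euclidean) A) extend"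
    unfolding continuous_map_componentwise using extend(1) by (auto simp: topspaces intro: functionalD(4))
qed

lemma disc_homs_mult_mem:
  assumes h: "h \<in> disc_homs (Sp A)" and k: "k \<in> disc_homs (Sp A)"
  shows "disc_homs_mult (Sp A) h k \<in> disc_homs (Sp A)"
  unfolding disc_homs_def
proof (intro CollectI conjI ballI)
  have b: "cmod (h \<gamma>) \<le> 1" "cmod (k \<gamma>) \<le> 1" if "\<gamma> \<in> Sp A" for \<gamma> using h k that by (auto simp: disc_homs_def)
  show "disc_homs_mult (Sp A) h k \<in> Sp A \<rightarrow>\<^sub>E cball 0 1"
    using b by (auto simp: disc_homs_mult_def norm_mult intro!: mult_le_one)
  show "disc_homs_mult (Sp A) h k (\<lambda>x. \<gamma> x * \<delta> x) = disc_homs_mult (Sp A) h k \<gamma> * disc_homs_mult (Sp A) h k \<delta>"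
    if "\<gamma> \<in> Sp A" "\<delta> \<in> Sp A" for \<gamma> \<delta>
    using that h k S_mult[OF that] by (simp add: disc_homs_mult_def disc_homs_def)
  show "\<exists>\<gamma>\<in>Sp A. disc_homs_mult (Sp A) h k \<gamma> \<noteq> 0"
    by (intro bexI[OF _ S_one]) (simp add: disc_homs_mult_def S_one disc_homs_one[OF h S_one] disc_homs_one[OF k S_one])
qed

lemma semigroup_homs: "topological_semigroup (disc_homs_topology (Sp A)) (disc_homs_mult (Sp A))"
  unfolding topological_semigroup_def
proof (intro conjI ballI)
  let ?T = "disc_homs_topology (Sp A)"
  show "disc_homs_mult (Sp A) h k \<in> topspace ?T" if "h \<in> topspace ?T" "k \<in> topspace ?T" for h k
    using that by (simp add: topspaces disc_homs_mult_mem)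
  show "disc_homs_mult (Sp A) (disc_homs_mult (Sp A) h k) l = disc_homs_mult (Sp A) h (disc_homs_mult (Sp A) k l)" for h k l
    by (auto simp: disc_homs_mult_def)
  show "continuous_map (prod_topology ?T ?T) ?T (\<lambda>(h, k). disc_homs_mult (Sp A) h k)"
  proof (rule continuous_map_into_homs)
    show "(case p of (h, k) \<Rightarrow> disc_homs_mult (Sp A) h k) \<in> disc_homs (Sp A)"
      if "p \<in> topspace (prod_topology ?T ?T)" for p
      using that by (auto simp: topspaces disc_homs_mult_mem)
    fix \<gamma> assume g: "\<gamma> \<in> Sp A"
    have "continuous_map (prod_topology ?T ?T) euclidean (\<lambda>p. fst p \<gamma>)"
      "continuous_map (prod_topology ?T ?T) euclidean (\<lambda>p. snd p \<gamma>)"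
      using continuous_map_compose[OF continuous_map_fst continuous_eval(2)[OF g]]
        continuous_map_compose[OF continuous_map_snd continuous_eval(2)[OF g]]
      by (simp_all add: o_def)
    then have "continuous_map (prod_topology ?T ?T) (prod_topology euclidean euclidean) (\<lambda>p. (fst p \<gamma>, snd p \<gamma>))"
      by (rule continuous_map_pairedI)
    moreover have "continuous_map (prod_topology euclidean euclidean) euclidean (\<lambda>p. fst p * snd p :: complex)"
      by (simp add: euclidean_product_topology continuous_intros)
    ultimately have "continuous_map (prod_topology ?T ?T) euclidean ((\<lambda>p. fst p * snd p) \<circ> (\<lambda>p. (fst p \<gamma>, snd p \<gamma>)))"
      by (rule continuous_map_compose)
    then show "continuous_map (prod_topology ?T ?T) euclidean (\<lambda>p. (case p of (h, k) \<Rightarrow> disc_homs_mult (Sp A) h k) \<gamma>)"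
      using g by (simp add: o_def case_prod_beta' disc_homs_mult_def)
  qed
qed

text \<open>Convolution is pointwise multiplication transported along the bijection. Closure,
  associativity and joint continuity on the side of functionals are all drawn from this
  formula.\<close>

lemma convolution_extend:
  assumes p: "\<phi> \<in> mult_functionals A" and s: "\<psi> \<in> mult_functionals A"
  shows "convolution A \<phi> \<psi> = extend (disc_homs_mult (Sp A) (restrict \<phi> (Sp A)) (restrict \<psi> (Sp A)))"
proof (rule convolution_eq[OF p s])
  have h: "disc_homs_mult (Sp A) (restrict \<phi> (Sp A)) (restrict \<psi> (Sp A)) \<in> disc_homs (Sp A)"
    by (intro disc_homs_mult_mem restrict_disc_hom p s)
  show "extend (disc_homs_mult (Sp A) (restrict \<phi> (Sp A)) (restrict \<psi> (Sp A))) \<in> mult_functionals A"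
    by (rule extend(1)[OF h])
  show "extend (disc_homs_mult (Sp A) (restrict \<phi> (Sp A)) (restrict \<psi> (Sp A))) \<gamma> = \<phi> \<gamma> * \<psi> \<gamma>" if g: "\<gamma> \<in> Sp A" for \<gamma>
    using fun_cong[OF extend(2)[OF h], of \<gamma>] g by (simp add: disc_homs_mult_def)
qed

lemma convolution_mem:
  assumes "\<phi> \<in> mult_functionals A" "\<psi> \<in> mult_functionals A"
  shows "convolution A \<phi> \<psi> \<in> mult_functionals A"
  unfolding convolution_extend[OF assms]
  by (intro extend(1) disc_homs_mult_mem restrict_disc_hom assms)

lemma restrict_convolution:
  assumes "\<phi> \<in> mult_functionals A" "\<psi> \<in> mult_functionals A"
  shows "restrict (convolution A \<phi> \<psi>) (Sp A) = disc_homs_mult (Sp A) (restrict \<phi> (Sp A)) (restrict \<psi> (Sp A))"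
  unfolding convolution_extend[OF assms]
  by (intro extend(2) disc_homs_mult_mem restrict_disc_hom assms)

lemma semigroup_functionals: "topological_semigroup (mult_functionals_topology A) (convolution A)"
  unfolding topological_semigroup_def
proof (intro conjI ballI)
  let ?T = "mult_functionals_topology A" and ?S = "disc_homs_topology (Sp A)"
  show "convolution A \<phi> \<psi> \<in> topspace ?T" if "\<phi> \<in> topspace ?T" "\<psi> \<in> topspace ?T" for \<phi> \<psi>
    using that by (simp add: topspaces convolution_mem)
  show "convolution A (convolution A \<phi> \<psi>) \<theta> = convolution A \<phi> (convolution A \<psi> \<theta>)"
    if "\<phi> \<in> topspace ?T" "\<psi> \<in> topspace ?T" "\<theta> \<in> topspace ?T" for \<phi> \<psi> \<theta>
  proof -
    have m: "\<phi> \<in> mult_functionals A" "\<psi> \<in> mult_functionals A" "\<theta> \<in> mult_functionals A"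
      using that by (simp_all add: topspaces)
    have "disc_homs_mult (Sp A) (disc_homs_mult (Sp A) h k) l = disc_homs_mult (Sp A) h (disc_homs_mult (Sp A) k l)" for h k l
      by (auto simp: disc_homs_mult_def)
    then show ?thesis
      using m by (simp add: convolution_extend[of "convolution A \<phi> \<psi>" \<theta>] convolution_extend[of \<phi> "convolution A \<psi> \<theta>"]
        convolution_mem restrict_convolution)
  qed
  have "continuous_map (prod_topology ?T ?T) (prod_topology ?S ?S) (\<lambda>(x, y). (spectral_restriction A x, spectral_restriction A y))"
    using continuous_restrict by (simp add: continuous_map_prod_top)
  moreover have "continuous_map (prod_topology ?S ?S) ?S (\<lambda>(h, k). disc_homs_mult (Sp A) h k)"
    using semigroup_homs by (simp add: topological_semigroup_def)
  ultimately have "continuous_map (prod_topology ?T ?T) ?T (extend \<circ> ((\<lambda>(h, k). disc_homs_mult (Sp A) h k) \<circ>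
      (\<lambda>(x, y). (spectral_restriction A x, spectral_restriction A y))))"
    by (intro continuous_map_compose[OF _ continuous_extend] continuous_map_compose)
  then show "continuous_map (prod_topology ?T ?T) ?T (\<lambda>(x, y). convolution A x y)"
    by (rule continuous_map_eq) (auto simp: topspaces convolution_extend spectral_restriction_def)
qed

lemma restriction_homeomorphic:
  "homeomorphic_map (mult_functionals_topology A) (disc_homs_topology (Sp A)) (spectral_restriction A)"
  unfolding homeomorphic_map_maps homeomorphic_maps_def
  by (intro exI[of _ extend] conjI ballI continuous_restrict continuous_extend)
     (auto simp: topspaces spectral_restriction_def extend_restrict extend)

lemma involution_character: "\<gamma> \<in> Sp A \<Longrightarrow> involution A \<phi> \<gamma> = cnj (\<phi> \<gamma>)"
  by (simp add: involution_def Sp_A star_character)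

end

theorem theorem3:
  fixes A :: "('a::{topological_ab_group_add, t2_space} \<Rightarrow> complex) set"
  assumes "compact (UNIV :: 'a set)"
    and "invariant_algebra A"
  shows "topological_semigroup_iso
           (mult_functionals_topology A) (convolution A)
           (disc_homs_topology (Sp A)) (disc_homs_mult (Sp A))
           (spectral_restriction A) \<and>
         (\<forall>\<phi>\<in>mult_functionals A. involution A \<phi> \<in> mult_functionals A \<and>
            (\<forall>\<gamma>\<in>Sp A. spectral_restriction A (involution A \<phi>) \<gamma> = cnj (\<phi> \<gamma>)))"
proof -
  \<comment> \<open>Haar measure is an auxiliary object: the statement does not mention it, and any
    choice serves.\<close>
  obtain H :: "'a measure" where "haar H" by (rule haar_exists[OF assms(1)])
  then interpret haar_algebra H A
    using assms(2) by (simp add: haar_algebra_def haar_algebra_axioms_def)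
  show ?thesis
    unfolding topological_semigroup_iso_def
    by (simp add: semigroup_functionals semigroup_homs restriction_homeomorphic topspaces
        restrict_convolution involution_mem involution_character spectral_restriction_def)
qed

end
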